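(* For $i\in\{1,2\}$ let $G_i=F_{k_i}^{W_i}(K_{n_i})$ be a $k_i$-fan graph of $K_{n_i}$ on the set $W_i\subseteq[n_i]$, with $n_i\ge 2$ and $k_i\ge 1$, let $f_i$ be a leaf of $G_i$ whose neighbor $v_i$ satisfies $\deg_{G_i}(v_i)\ge 2$, and let $G=(G_1,f_1)\circ(G_2,f_2)$. Let $$t=|\{i\in\{1,2\} : \operatorname{reg}(S_{G_i\setminus v_i}/I_{G_i\setminus v_i})\ne\operatorname{reg}(S_{G_i}/I_{G_i})\}|.$$ Then: (1) If $t\le 1$, then $\operatorname{reg}(S_G/I_G)=\operatorname{reg}(S_{G_1}/I_{G_1})+\operatorname{reg}(S_{G_2}/I_{G_2})-t$. (2) If $t=2$ and $|W_i|=n_i-1$ for some $i\in\{1,2\}$, then $\operatorname{reg}(S_G/I_G)=\operatorname{reg}(S_{G_1}/I_{G_1})+\operatorname{reg}(S_{G_2}/I_{G_2})-1$. (3) If $t=2$ and $|W_i|=n_i$ for all $i\in\{1,2\}$, then $\operatorname{reg}(S_G/I_G)=\operatorname{reg}(S_{G_1}/I_{G_1})+\operatorname{reg}(S_{G_2}/I_{G_2})-2$.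
   Context: $\mathbb{K}$ is a field; $[n]=\{1,\dots,n\}$. For a finite simple graph $H$, $S_H=\mathbb{K}[x_u:u\in V(H)]$ and $I_H=(x_ux_v : \{u,v\}\in E(H))\subset S_H$ is the edge ideal. $H\setminus v$ denotes the induced subgraph of $H$ on $V(H)\setminus\{v\}$. For a finitely generated graded $S$-module $M$, $\operatorname{reg}(M)=\max\{j-i : \operatorname{Tor}_i^S(M,\mathbb{K})_j\ne 0\}$ is the Castelnuovo–Mumford regularity. A leaf is a vertex of degree $1$. Fan graphs: let $K_n$ be the complete graph on $[n]$. Given $U=\{u_1,\dots,u_r\}\subseteq[n]$ (with a chosen ordering), suppose that for each $i\in[r]$ a new complete graph $K_{a_i}$ on $a_i>i$ vertices is attached to $K_n$ in such a way that $V(K_n)\cap V(K_{a_i})=\{u_1,\dots,u_i\}$ (the new vertices of different attached cliques are pairwise distinct). The resulting graph is said to be obtained by adding a fan to $K_n$ on $U$, and $\{K_{a_1},\dots,K_{a_r}\}$ is the branch of that fan on $U$. If $W\subseteq[n]$ and $W=W_1\sqcup\cdots\sqcup W_k$ is a partition into nonempty subsets, a $k$-fan graph $F_k^W(K_n)$ of $K_n$ on $W$ is a graph obtained from $K_n$ by adding a fan on each $W_i$. The $\circ$ operation: let $G_1,G_2$ be (vertex-disjoint) graphs, and for $i=1,2$ let $f_i$ be a leaf of $G_i$ with neighbor $v_i$, $\deg_{G_i}(v_i)\ge 2$. Then $(G_1,f_1)\circ(G_2,f_2)$ is the graph obtained from $G_1$ and $G_2$ by first removing the leaves $f_1,f_2$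 and then identifying the vertices $v_1$ and $v_2$. *)

theory Defs
  imports "HOL-Library.Poly_Mapping" "HOL-Algebra.QuotRing" "HOL-Algebra.Module"
begin

section \<open>Polynomial rings over a field\<close>

text \<open>A monomial is a finitely supported exponent vector. The field is the type \<^typ>\<open>'k\<close>;
  the ring \<open>S\<^sub>V\<close> of polynomials in the variables \<open>x\<^sub>u\<close>, \<open>u \<in> V\<close>, is carved out of the polynomials
  whose variables range over the whole type \<^typ>\<open>'v\<close>.\<close>

type_synonym ('v, 'k) mpoly = "('v \<Rightarrow>\<^sub>0 nat) \<Rightarrow>\<^sub>0 'k"

definition poly_ring :: "'v set \<Rightarrow> ('v, 'k::field) mpoly ring" where
  "poly_ring V =
    \<lparr>carrier = {p. \<forall>m \<in> Poly_Mapping.keys p. Poly_Mapping.keys m \<subseteq> V},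
     mult = (*), one = 1, zero = 0, add = (+)\<rparr>"

definition var :: "'v \<Rightarrow> ('v, 'k::field) mpoly" where
  "var u = Poly_Mapping.single (Poly_Mapping.single u 1) 1"

definition mon_degree :: "('v \<Rightarrow>\<^sub>0 nat) \<Rightarrow> nat" where
  "mon_degree m = (\<Sum>u \<in> Poly_Mapping.keys m. Poly_Mapping.lookup m u)"

definition homogeneous :: "int \<Rightarrow> ('v, 'k::field) mpoly \<Rightarrow> bool" where
  "homogeneous d p \<longleftrightarrow> (\<forall>m \<in> Poly_Mapping.keys p. int (mon_degree m) = d)"

definition const_coeff :: "('v, 'k::field) mpoly \<Rightarrow> 'k" where
  "const_coeff p = Poly_Mapping.lookup p 0"


section \<open>Graded free resolutions, Tor and regularity\<close>

text \<open>Vectors of length \<open>r\<close> are functions on \<^typ>\<open>nat\<close> that vanish from \<open>r\<close> on, and a matrix is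
  applied to them columnwise: \<open>A p q\<close> is the entry in row \<open>p\<close> and column \<open>q\<close>.\<close>

definition free_module :: "'v set \<Rightarrow> nat \<Rightarrow> (nat \<Rightarrow> ('v, 'k::field) mpoly) set" where
  "free_module V r =
    {s. (\<forall>q<r. s q \<in> carrier (poly_ring V)) \<and> (\<forall>q\<ge>r. s q = 0)}"

definition mat_app :: "nat \<Rightarrow> (nat \<Rightarrow> nat \<Rightarrow> 'a::comm_ring_1) \<Rightarrow> (nat \<Rightarrow> 'a) \<Rightarrow> nat \<Rightarrow> 'a" where
  "mat_app r A s = (\<lambda>p. \<Sum>q<r. A p q * s q)"

text \<open>Let \<open>M\<close> be a graded module over \<open>S = S\<^sub>V\<close>, with \<open>gr j\<close> its component of degree \<open>j\<close>.
  A graded free resolution of \<open>M\<close> by finitely generated modules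
  \[ \cdots \to F_2 \to F_1 \to F_0 \to M \to 0, \qquad F_i = \bigoplus_{q < r_i} S(-d_{i,q}), \]
  is given by the ranks \<open>r i\<close>, the degrees \<open>d i q\<close> of the basis elements, the matrices \<open>A i\<close> of the
  maps from \<open>F (i + 1)\<close> to \<open>F i\<close> (index shifted by one), and the images \<open>g q\<close> in \<open>M\<close> of the
  basis elements of \<open>F 0\<close>. All maps are homogeneous of degree \<open>0\<close>.\<close>

definition graded_free_resolution ::
  "'v set \<Rightarrow> (('v, 'k::field) mpoly, 'm) module \<Rightarrow> (int \<Rightarrow> 'm set) \<Rightarrow>
   (nat \<Rightarrow> nat) \<Rightarrow> (nat \<Rightarrow> nat \<Rightarrow> int) \<Rightarrow>
   (nat \<Rightarrow> nat \<Rightarrow> nat \<Rightarrow> ('v, 'k) mpoly) \<Rightarrow> (nat \<Rightarrow> 'm) \<Rightarrow> bool" where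
  "graded_free_resolution V M gr r d A g \<longleftrightarrow>
     (\<forall>i p q. p < r i \<and> q < r (Suc i) \<longrightarrow>
        A i p q \<in> carrier (poly_ring V) \<and> homogeneous (d (Suc i) q - d i p) (A i p q)) \<and>
     (\<forall>i p q. p \<ge> r i \<or> q \<ge> r (Suc i) \<longrightarrow> A i p q = 0) \<and>
     (\<forall>q<r 0. g q \<in> gr (d 0 q)) \<and>
     (\<forall>x \<in> carrier M. \<exists>s \<in> free_module V (r 0). x = finsum M (\<lambda>q. s q \<odot>\<^bsub>M\<^esub> g q) {..<r 0}) \<and>
     (\<forall>s \<in> free_module V (r 0).
        finsum M (\<lambda>q. s q \<odot>\<^bsub>M\<^esub> g q) {..<r 0} = \<zero>\<^bsub>M\<^esub> \<longleftrightarrow>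
        s \<in> mat_app (r 1) (A 0) ` free_module V (r 1)) \<and>
     (\<forall>i. \<forall>s \<in> free_module V (r (Suc i)).
        mat_app (r (Suc i)) (A i) s = (\<lambda>p. 0) \<longleftrightarrow>
        s \<in> mat_app (r (Suc (Suc i))) (A (Suc i)) ` free_module V (r (Suc (Suc i))))"

text \<open>Variables act as \<open>0\<close> on the residue field, so tensoring a resolution with it gives the complex
  of \<^typ>\<open>'k\<close>-vector spaces with basis \<open>{q. q < r i}\<close> in homological degree \<open>i\<close>, and with the matrices
  of constant coefficients as differentials. Its strand of internal degree \<open>j\<close> is spanned by the
  basis elements of degree \<open>j\<close>.\<close>

definition tensor_strand ::
  "(nat \<Rightarrow> nat) \<Rightarrow> (nat \<Rightarrow> nat \<Rightarrow> int) \<Rightarrow> nat \<Rightarrow> int \<Rightarrow> (nat \<Rightarrow> 'k::field) set" where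
  "tensor_strand r d i j = {w. \<forall>q. w q \<noteq> 0 \<longrightarrow> q < r i \<and> d i q = j}"

definition tensor_diff ::
  "(nat \<Rightarrow> nat) \<Rightarrow> (nat \<Rightarrow> nat \<Rightarrow> nat \<Rightarrow> ('v, 'k::field) mpoly) \<Rightarrow> nat \<Rightarrow> (nat \<Rightarrow> 'k) \<Rightarrow> nat \<Rightarrow> 'k" where
  "tensor_diff r A i w = mat_app (r (Suc i)) (\<lambda>p q. const_coeff (A i p q)) w"

definition tor_cycles ::
  "(nat \<Rightarrow> nat) \<Rightarrow> (nat \<Rightarrow> nat \<Rightarrow> int) \<Rightarrow> (nat \<Rightarrow> nat \<Rightarrow> nat \<Rightarrow> ('v, 'k::field) mpoly) \<Rightarrow>
   nat \<Rightarrow> int \<Rightarrow> (nat \<Rightarrow> 'k) set" where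
  "tor_cycles r d A i j =
    {w \<in> tensor_strand r d i j. \<forall>l. i = Suc l \<longrightarrow> tensor_diff r A l w = (\<lambda>p. 0)}"

definition tor_boundaries ::
  "(nat \<Rightarrow> nat) \<Rightarrow> (nat \<Rightarrow> nat \<Rightarrow> int) \<Rightarrow> (nat \<Rightarrow> nat \<Rightarrow> nat \<Rightarrow> ('v, 'k::field) mpoly) \<Rightarrow>
   nat \<Rightarrow> int \<Rightarrow> (nat \<Rightarrow> 'k) set" where
  "tor_boundaries r d A i j = tensor_diff r A i ` tensor_strand r d (Suc i) j"

text \<open>The degree \<open>j\<close> part of \<open>Tor\<^sub>i(M, K)\<close> is nonzero. Tor does not depend on the resolution, so it
  is immaterial which one is used.\<close>

definition tor_nonzero ::
  "'v set \<Rightarrow> (('v, 'k::field) mpoly, 'm) module \<Rightarrow> (int \<Rightarrow> 'm set) \<Rightarrow> nat \<Rightarrow> int \<Rightarrow> bool" where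
  "tor_nonzero V M gr i j \<longleftrightarrow>
    (\<exists>r d A g. graded_free_resolution V M gr r d A g \<and>
       tor_cycles r d A i j \<noteq> tor_boundaries r d A i j)"

definition regularity ::
  "'v set \<Rightarrow> (('v, 'k::field) mpoly, 'm) module \<Rightarrow> (int \<Rightarrow> 'm set) \<Rightarrow> int" where
  "regularity V M gr = Max {j - int i | i j. tor_nonzero V M gr i j}"

definition quotient_module :: "('a, 'b) ring_scheme \<Rightarrow> 'a set \<Rightarrow> ('a, 'a set) module" where
  "quotient_module R I =
    \<lparr>carrier = carrier (R Quot I), mult = mult (R Quot I), one = one (R Quot I),
     zero = zero (R Quot I), add = add (R Quot I),
     smult = (\<lambda>a X. (I +>\<^bsub>R\<^esub> a) \<otimes>\<^bsub>R Quot I\<^esub> X)\<rparr>"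

definition quotient_grading :: "'v set \<Rightarrow> ('v, 'k::field) mpoly set \<Rightarrow> int \<Rightarrow> ('v, 'k) mpoly set set" where
  "quotient_grading V I j =
    {I +>\<^bsub>poly_ring V\<^esub> p | p. p \<in> carrier (poly_ring V) \<and> homogeneous j p}"


section \<open>Graphs and edge ideals\<close>

text \<open>A graph is a vertex set together with a set of two-element sets of vertices.\<close>

type_synonym 'v sgraph = "'v set \<times> 'v set set"

abbreviation vertices :: "'v sgraph \<Rightarrow> 'v set" where "vertices \<equiv> fst"
abbreviation edges :: "'v sgraph \<Rightarrow> 'v set set" where "edges \<equiv> snd"

definition degree :: "'v sgraph \<Rightarrow> 'v \<Rightarrow> nat" where
  "degree H v = card {u \<in> vertices H. {u, v} \<in> edges H}"

definition leaf :: "'v sgraph \<Rightarrow> 'v \<Rightarrow> bool" where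
  "leaf H f \<longleftrightarrow> f \<in> vertices H \<and> degree H f = 1"

definition delete_vertex :: "'v sgraph \<Rightarrow> 'v \<Rightarrow> 'v sgraph" where
  "delete_vertex H v = (vertices H - {v}, {e \<in> edges H. v \<notin> e})"

definition complete_graph :: "'v set \<Rightarrow> 'v sgraph" where
  "complete_graph B = (B, {e. e \<subseteq> B \<and> card e = 2})"

definition edge_ideal :: "'v sgraph \<Rightarrow> ('v, 'k::field) mpoly set" where
  "edge_ideal H =
    Idl\<^bsub>poly_ring (vertices H)\<^esub> {var u * var v | u v. {u, v} \<in> edges H}"

text \<open>The regularity of \<open>S\<^sub>H / I\<^sub>H\<close>; the first argument fixes the coefficient field.\<close>

definition edge_reg :: "'k::field itself \<Rightarrow> 'v sgraph \<Rightarrow> int" where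
  "edge_reg K H =
    (let I = (edge_ideal H :: ('v, 'k) mpoly set)
     in regularity (vertices H) (quotient_module (poly_ring (vertices H)) I)
          (quotient_grading (vertices H) I))"


section \<open>Fan graphs\<close>

text \<open>A fan on \<open>U = {u\<^sub>1, \<dots>, u\<^sub>r}\<close> attached to the complete graph with vertex set \<open>B\<close>: the list
  \<open>us\<close> is the chosen ordering of \<open>U\<close>, and \<open>Cs\<close> lists the vertex sets of the cliques of the branch.
  Lists are indexed from \<open>0\<close>, whence the shift by one in sizes.\<close>

definition fan_on :: "'v set \<Rightarrow> 'v list \<Rightarrow> 'v set list \<Rightarrow> bool" where
  "fan_on B us Cs \<longleftrightarrow>
     distinct us \<and> set us \<subseteq> B \<and> length Cs = length us \<and>
     (\<forall>i<length us. finite (Cs ! i) \<and> card (Cs ! i) > Suc i \<and>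
        B \<inter> Cs ! i = set (take (Suc i) us)) \<and>
     (\<forall>i<length us. \<forall>j<length us. i \<noteq> j \<longrightarrow> Cs ! i \<inter> Cs ! j \<subseteq> B)"

text \<open>\<open>H\<close> is a \<open>k\<close>-fan graph on \<open>W\<close> of the complete graph with vertex set \<open>B\<close> (an arbitrary
  finite set instead of \<open>{1, \<dots>, n}\<close>, so that disjoint copies are available). The fans are
  \<open>fan_on B (Us ! l) (Css ! l)\<close>, and the parts of the partition of \<open>W\<close> are the sets
  \<open>set (Us ! l)\<close>, for \<open>l < k\<close>.\<close>

definition k_fan_graph :: "nat \<Rightarrow> 'v set \<Rightarrow> 'v set \<Rightarrow> 'v sgraph \<Rightarrow> bool" where
  "k_fan_graph k W B H \<longleftrightarrow>
     finite B \<and>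
     (\<exists>Us Css. length Us = k \<and> length Css = k \<and>
        (\<forall>l<k. Us ! l \<noteq> [] \<and> fan_on B (Us ! l) (Css ! l)) \<and>
        (\<forall>l<k. \<forall>m<k. l \<noteq> m \<longrightarrow>
           set (Us ! l) \<inter> set (Us ! m) = {} \<and>
           \<Union> (set (Css ! l)) \<inter> \<Union> (set (Css ! m)) \<subseteq> B) \<and>
        W = (\<Union>l<k. set (Us ! l)) \<and>
        (let cliques = insert B (\<Union>l<k. set (Css ! l))
         in H = (\<Union>C\<in>cliques. vertices (complete_graph C),
                 \<Union>C\<in>cliques. edges (complete_graph C))))"


section \<open>The operation \<open>\<circ>\<close>\<close>

definition disjoint_union_graph :: "'v sgraph \<Rightarrow> 'v sgraph \<Rightarrow> 'v sgraph" where
  "disjoint_union_graph G H = (vertices G \<union> vertices H, edges G \<union> edges H)"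

definition identify :: "'v \<Rightarrow> 'v \<Rightarrow> 'v sgraph \<Rightarrow> 'v sgraph" where
  "identify v w H =
    (let \<phi> = (\<lambda>x. if x = w then v else x)
     in (\<phi> ` vertices H, (\<lambda>e. \<phi> ` e) ` edges H))"

text \<open>\<open>v1\<close> and \<open>v2\<close> are the neighbours of the leaves \<open>f1\<close> and \<open>f2\<close>, and \<open>G1\<close>, \<open>G2\<close> are
  assumed to be vertex-disjoint.\<close>

definition circ_op ::
  "'v sgraph \<Rightarrow> 'v \<Rightarrow> 'v \<Rightarrow> 'v sgraph \<Rightarrow> 'v \<Rightarrow> 'v \<Rightarrow> 'v sgraph" where
  "circ_op G1 f1 v1 G2 f2 v2 =
    identify v1 v2 (disjoint_union_graph (delete_vertex G1 f1) (delete_vertex G2 f2))"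

end

theory Submission
  imports Defs "HOL-Library.Function_Algebras"
begin

text \<open>
  All graphs involved are chordal, and for a chordal graph \<open>H\<close> the regularity of \<open>S\<^sub>H / I\<^sub>H\<close> is the
  induced matching number. Tor is balanced, so the Koszul complex of \<open>S\<^sub>H / I\<^sub>H\<close> computes it. Its
  strands in squarefree multidegrees are cochain complexes of independence complexes; deleting a
  neighbour of a simplicial vertex and passing to its link bounds their cohomology, while an induced
  matching spans the boundary of a cross polytope, whose fundamental class is a nonzero cohomology
  class. The Taylor resolution shows that there is a graded free resolution at all.

  Write \<open>\<nu>\<close> for the induced matching number. An induced matching of \<open>G\<close> restricts to induced matchings
  of \<open>G\<^sub>1\<close> and \<open>G\<^sub>2\<close>, only one of which can use the common vertex \<open>v\<close>; the other one can then be
  extended by the edge at the removed leaf. This determines \<open>\<nu>(G)\<close> up to the question, for \<open>t = 2\<close>,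
  whether some maximum induced matching of \<open>G\<^sub>i\<close> avoids the leaf. It does if \<open>|W\<^sub>i| = n\<^sub>i - 1\<close>, and
  it does not if \<open>|W\<^sub>i| = n\<^sub>i\<close>, because its edge at \<open>v\<close> could be moved away from \<open>v\<close>.
\<close>

section \<open>Double complexes\<close>

text \<open>Regularity is a \<open>Max\<close> over all pairs with nonzero Tor, and
  \<open>tor_nonzero\<close> only asks for some resolution with nonvanishing homology. So the upper
  bound needs balance for every resolution, while the lower bound needs one resolution to exist.
  Only vanishing matters, so no homology group is formed: all is phrased as exactness at one spot,
  where at index 0 each element counts as a cycle. In the Koszul complex of S / I the basis set
  \<open>T\<close> carries in multidegree \<alpha> the monomial \<alpha> divided by the product of
  \<open>T\<close>, which must lie outside I. In squarefree degrees this makes the complement of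
  \<open>T\<close> independent, so faces are closed under enlarging, and the boundary on the sets
  \<open>T\<close> is the coboundary on their complements. On the combinatorial side each graph
  enters through three numbers m \<le> p \<le> n \<le> m + 1, the induced matching numbers after
  deleting v, after deleting the leaf, and of the graph itself. Then t counts the sides with m < n,
  and for t = 2 the value is n1 + n2 - 1 if p = n on some side, and n1 + n2 - 2 otherwise.\<close>

definition exact_at :: "(nat \<Rightarrow> 'a::zero set) \<Rightarrow> (nat \<Rightarrow> 'a \<Rightarrow> 'a) \<Rightarrow> nat \<Rightarrow> bool" where
  "exact_at C d i \<longleftrightarrow> (\<forall>w\<in>C i. (\<forall>l. i = Suc l \<longrightarrow> d l w = 0) \<longrightarrow> w \<in> d i ` C (Suc i))"

text \<open>A first-quadrant double complex with exact rows and columns, augmented to the complexes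
  \<open>M\<close> (rows) and \<open>N\<close> (columns).\<close>

locale double_complex =
  fixes D :: "nat \<Rightarrow> nat \<Rightarrow> 'a::ab_group_add set"
    and M :: "nat \<Rightarrow> 'm::ab_group_add set" and N :: "nat \<Rightarrow> 'n::ab_group_add set"
    and dh dv :: "nat \<Rightarrow> 'a \<Rightarrow> 'a" and eh :: "'a \<Rightarrow> 'm" and ev :: "'a \<Rightarrow> 'n"
    and dM :: "nat \<Rightarrow> 'm \<Rightarrow> 'm" and dN :: "nat \<Rightarrow> 'n \<Rightarrow> 'n"
  assumes D_diff: "x \<in> D p q \<Longrightarrow> y \<in> D p q \<Longrightarrow> x - y \<in> D p q"
    and dh_diff: "dh p (x - y) = dh p x - dh p y"
    and dv_diff: "dv q (x - y) = dv q x - dv q y"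
    and eh_diff: "eh (x - y) = eh x - eh y"
    and ev_diff: "ev (x - y) = ev x - ev y"
    and dh_closed: "x \<in> D (Suc p) q \<Longrightarrow> dh p x \<in> D p q"
    and dv_closed: "x \<in> D p (Suc q) \<Longrightarrow> dv q x \<in> D p q"
    and eh_closed: "x \<in> D 0 q \<Longrightarrow> eh x \<in> M q"
    and ev_closed: "x \<in> D p 0 \<Longrightarrow> ev x \<in> N p"
    and dh_dv: "x \<in> D (Suc p) (Suc q) \<Longrightarrow> dh p (dv q x) = dv q (dh p x)"
    and eh_dv: "x \<in> D 0 (Suc q) \<Longrightarrow> eh (dv q x) = dM q (eh x)"
    and ev_dh: "x \<in> D (Suc p) 0 \<Longrightarrow> ev (dh p x) = dN p (ev x)"
    and dh_dh: "x \<in> D (Suc (Suc p)) q \<Longrightarrow> dh p (dh (Suc p) x) = 0"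
    and eh_dh: "x \<in> D (Suc 0) q \<Longrightarrow> eh (dh 0 x) = 0"
    and dv_dv: "x \<in> D p (Suc (Suc q)) \<Longrightarrow> dv q (dv (Suc q) x) = 0"
    and ev_dv: "x \<in> D p (Suc 0) \<Longrightarrow> ev (dv 0 x) = 0"
    and row_exact: "x \<in> D (Suc p) q \<Longrightarrow> dh p x = 0 \<Longrightarrow> x \<in> dh (Suc p) ` D (Suc (Suc p)) q"
    and row_exact0: "x \<in> D 0 q \<Longrightarrow> eh x = 0 \<Longrightarrow> x \<in> dh 0 ` D (Suc 0) q"
    and row_surj: "M q \<subseteq> eh ` D 0 q"
    and col_exact: "x \<in> D p (Suc q) \<Longrightarrow> dv q x = 0 \<Longrightarrow> x \<in> dv (Suc q) ` D p (Suc (Suc q))"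
    and col_exact0: "x \<in> D p 0 \<Longrightarrow> ev x = 0 \<Longrightarrow> x \<in> dv 0 ` D p (Suc 0)"
    and col_surj: "N p \<subseteq> ev ` D p 0"
begin

text \<open>Elements of \<open>N\<close> lift along the surjective \<open>ev\<close>, so
  \<open>dN\<close> inherits this from \<open>dh\<close>.\<close>

lemma dN_dN: assumes "w \<in> N (Suc (Suc i))" shows "dN i (dN (Suc i) w) = 0"
proof -
  obtain x where x: "x \<in> D (Suc (Suc i)) 0" "w = ev x" using assms col_surj by blast
  have "ev 0 = 0" using ev_diff[of 0 0] by simp
  then show ?thesis
    unfolding x(2) ev_dh[OF x(1), symmetric] ev_dh[OF dh_closed[OF x(1)], symmetric] dh_dh[OF x(1)] .
qed

lemma dN_closed: assumes "w \<in> N (Suc i)" shows "dN i w \<in> N i"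
proof -
  obtain x where x: "x \<in> D (Suc i) 0" "w = ev x" using assms col_surj by blast
  show ?thesis unfolding x(2) ev_dh[OF x(1), symmetric] by (rule ev_closed[OF dh_closed[OF x(1)]])
qed

text \<open>The staircase argument. The vertical image of \<open>a\<close> is a horizontal cycle,
  hence the horizontal image of some \<open>a'\<close> one step further along the same antidiagonal;
  a decomposition of \<open>a'\<close> yields one of \<open>a\<close> by column exactness. The walk
  ends at \<open>q = 0\<close>, where the exactness of \<open>N\<close> enters.\<close>

lemma zigzag:
  assumes "exact_at N dN n" "a \<in> D p q" "p + q = n"
    and "\<And>p' q'. p = Suc p' \<Longrightarrow> q = Suc q' \<Longrightarrow> dh p' (dv q' a) = 0"
    and "\<And>q'. p = 0 \<Longrightarrow> q = Suc q' \<Longrightarrow> eh (dv q' a) = 0"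
    and "\<And>p'. p = Suc p' \<Longrightarrow> q = 0 \<Longrightarrow> ev (dh p' a) = 0"
  shows "\<exists>b\<in>D (Suc p) q. \<exists>b'\<in>D p (Suc q). a - dh p b = dv q b'"
  using assms(2-)
proof (induction q arbitrary: p a)
  case 0
  have "ev a \<in> N n" using 0 ev_closed by auto
  moreover have "\<forall>l. n = Suc l \<longrightarrow> dN l (ev a) = 0" using 0 ev_dh by auto
  ultimately obtain w where w: "w \<in> N (Suc n)" "ev a = dN n w"
    using assms(1) unfolding exact_at_def by blast
  then obtain b where b: "b \<in> D (Suc p) 0" "w = ev b"
    using col_surj[of "Suc p"] 0 by auto
  have "ev (a - dh p b) = 0" using w b 0 ev_dh ev_diff by auto
  moreover have "a - dh p b \<in> D p 0" using b 0 dh_closed D_diff by blast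
  ultimately show ?case using col_exact0 b by blast
next
  case (Suc q)
  have dva: "dv q a \<in> D p q" using Suc.prems dv_closed by blast
  have "dv q a \<in> dh p ` D (Suc p) q"
  proof (cases p)
    case 0 then show ?thesis using Suc.prems(4)[OF 0] dva row_exact0 by blast
  next
    case (Suc p')
    then show ?thesis using Suc.prems(3)[OF Suc] dva row_exact by blast
  qed
  then obtain a' where a': "a' \<in> D (Suc p) q" "dv q a = dh p a'" by blast
  have z: "dh r 0 = 0" "eh 0 = 0" "ev 0 = 0" for r
    using dh_diff[of r 0 0] eh_diff[of 0 0] ev_diff[of 0 0] by simp_all
  have "\<exists>b\<in>D (Suc (Suc p)) q. \<exists>b'\<in>D (Suc p) (Suc q). a' - dh (Suc p) b = dv q b'"
  proof (rule Suc.IH)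
    show "a' \<in> D (Suc p) q" "Suc p + q = n" using a' Suc.prems by auto
    show "dh p' (dv q' a') = 0" if "Suc p = Suc p'" "q = Suc q'" for p' q'
    proof -
      have "dh p (dv q' a') = dv q' (dh p a')" using that a'(1) by (intro dh_dv) simp
      also have "\<dots> = 0" using that a'(2) dv_dv[of a p q'] Suc.prems(1) by simp
      finally show ?thesis using that by simp
    qed
    show "eh (dv q' a') = 0" if "Suc p = 0" for q' using that by simp
    show "ev (dh p' a') = 0" if "Suc p = Suc p'" "q = 0" for p'
      using that a'(2) ev_dv[of a p] Suc.prems(1) by simp
  qed
  then obtain b b' where b: "b \<in> D (Suc (Suc p)) q" "b' \<in> D (Suc p) (Suc q)"
    "a' - dh (Suc p) b = dv q b'" by blast
  have "dv q (a - dh p b') = dh p a' - dh p (dv q b')"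
    using a' b dh_dv dv_diff by simp
  also have "\<dots> = dh p (dh (Suc p) b)" unfolding dh_diff[symmetric] b(3)[symmetric] by simp
  also have "\<dots> = 0" using b dh_dh by blast
  finally have "dv q (a - dh p b') = 0" .
  moreover have "a - dh p b' \<in> D p (Suc q)" using b Suc.prems dh_closed D_diff by blast
  ultimately show ?case using col_exact b by blast
qed

text \<open>A cycle of \<open>M\<close> lifts to the corner \<open>p = 0\<close> of the
  antidiagonal. The horizontal correction found by \<open>zigzag\<close> dies under
  \<open>eh\<close>, and the vertical part maps to a boundary.\<close>

lemma exact_transfer:
  assumes "exact_at N dN n" shows "exact_at M dM n"
  unfolding exact_at_def
proof (intro ballI impI)
  fix c assume c: "c \<in> M n" "\<forall>l. n = Suc l \<longrightarrow> dM l c = 0"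
  obtain a where a: "a \<in> D 0 n" "c = eh a" using c row_surj by blast
  have "\<exists>b\<in>D (Suc 0) n. \<exists>b'\<in>D 0 (Suc n). a - dh 0 b = dv n b'"
    by (rule zigzag[OF assms]) (use a c eh_dv in auto)
  then obtain b b' where b: "b \<in> D (Suc 0) n" "b' \<in> D 0 (Suc n)" "a - dh 0 b = dv n b'" by blast
  have "c = eh (a - dh 0 b)" unfolding eh_diff using a b eh_dh by simp
  also have "\<dots> = dM n (eh b')" unfolding b(3) using b eh_dv by simp
  finally show "c \<in> dM n ` M (Suc n)" using b eh_closed by blast
qed

text \<open>The axioms are symmetric under exchanging rows and columns, so the converse direction
  comes for free.\<close>

lemma transpose: "double_complex (\<lambda>p q. D q p) N M dv dh ev eh dN dM"
  by (unfold_locales; (rule D_diff dh_diff dv_diff eh_diff ev_diff dh_closed dv_closed eh_closed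
      ev_closed dh_dv[symmetric] eh_dv ev_dh dh_dh eh_dh dv_dv ev_dv row_exact row_exact0 row_surj
      col_exact col_exact0 col_surj; assumption))

theorem exact_iff: "exact_at N dN n \<longleftrightarrow> exact_at M dM n"
  using exact_transfer double_complex.exact_transfer[OF transpose] by blast

end

section \<open>Signed boundary operators\<close>

text \<open>Working with all systems of signs that make the simplicial boundary square to zero, instead of
  those of a fixed vertex order, makes them stable under passing to links and subsets.\<close>

definition alt_sign :: "'e set \<Rightarrow> ('e \<Rightarrow> 'e set \<Rightarrow> 'k::comm_ring_1) \<Rightarrow> bool" where
  "alt_sign E \<sigma> \<longleftrightarrow>
    (\<forall>e\<in>E. \<forall>T. T \<subseteq> E \<longrightarrow> e \<notin> T \<longrightarrow> \<sigma> e T * \<sigma> e T = 1) \<and>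
    (\<forall>e\<in>E. \<forall>e'\<in>E. \<forall>T. T \<subseteq> E \<longrightarrow> e \<notin> T \<longrightarrow> e' \<notin> T \<longrightarrow> e \<noteq> e' \<longrightarrow>
       \<sigma> e T * \<sigma> e' (insert e T) = - (\<sigma> e' T * \<sigma> e (insert e' T)))"

lemma alt_signD:
  assumes "alt_sign E \<sigma>" "e \<in> E" "T \<subseteq> E" "e \<notin> T"
  shows "\<sigma> e T * \<sigma> e T = 1"
    and "e' \<in> E \<Longrightarrow> e' \<notin> T \<Longrightarrow> e \<noteq> e' \<Longrightarrow> \<sigma> e T * \<sigma> e' (insert e T) = - (\<sigma> e' T * \<sigma> e (insert e' T))"
  using assms unfolding alt_sign_def by blast+

text \<open>The usual orientation signs: the parity of the number of elements of \<open>T\<close>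
  that precede \<open>e\<close> in some linear order.\<close>

lemma alt_sign_exists:
  assumes "finite E" shows "\<exists>\<sigma> :: 'e \<Rightarrow> 'e set \<Rightarrow> 'k::comm_ring_1. alt_sign E \<sigma>"
proof -
  obtain f :: "'e \<Rightarrow> nat" where f: "inj_on f E"
    using finite_imp_inj_to_nat_seg[OF assms] by blast
  define n where "n e T = card {u\<in>T. f u < f e}" for e and T :: "'e set"
  have n: "n e (insert e' T) = n e T + (if f e' < f e then 1 else 0)"
    if "e' \<notin> T" "T \<subseteq> E" for e e' T
  proof -
    have "{u \<in> insert e' T. f u < f e} =
        (if f e' < f e then insert e' {u\<in>T. f u < f e} else {u\<in>T. f u < f e})" by auto
    moreover have "finite T" using that assms finite_subset by blast
    ultimately show ?thesis using that by (simp add: n_def)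
  qed
  have "alt_sign E (\<lambda>e T. (-1) ^ n e T :: 'k)"
    unfolding alt_sign_def
  proof (intro conjI ballI allI impI)
    fix e T show "(-1) ^ n e T * (-1) ^ n e T = (1::'k)"
      by (simp flip: power_mult_distrib)
  next
    fix e e' T assume a: "e \<in> E" "e' \<in> E" "T \<subseteq> E" "e \<notin> T" "e' \<notin> T" "e \<noteq> e'"
    then have "f e \<noteq> f e'" using f by (auto dest: inj_onD)
    then show "(-1) ^ n e T * (-1) ^ n e' (insert e T) = - ((-1) ^ n e' T * (-1) ^ n e (insert e' T) :: 'k)"
      using a by (auto simp: n)
  qed
  then show ?thesis by blast
qed

text \<open>Sets that all contain \<open>X\<close> are indexed by their remaining elements. With
  \<open>X\<close> a vertex or its neighbourhood this supplies the signs for the deletion and for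
  the link of that vertex.\<close>

lemma alt_sign_shift:
  assumes "alt_sign U \<sigma>" "U' \<subseteq> U" "X \<subseteq> U" "U' \<inter> X = {}"
  shows "alt_sign U' (\<lambda>e T. \<sigma> e (X \<union> T))"
  unfolding alt_sign_def
proof (intro conjI ballI allI impI, goal_cases)
  case (1 e T)
  show ?case by (rule alt_signD(1)[OF assms(1)]) (use assms 1 in auto)
next
  case (2 e e' T)
  have i: "X \<union> insert a T = insert a (X \<union> T)" for a by auto
  show ?case unfolding i by (rule alt_signD(2)[OF assms(1)]) (use assms 2 in auto)
qed

text \<open>A chain is given by its coefficients, so the coefficient of its boundary at
  \<open>T\<close> collects those of the sets with one more element. The families of faces used
  below are closed under enlarging, so values off the family never enter.\<close>

definition bdry :: "'e set \<Rightarrow> ('e \<Rightarrow> 'e set \<Rightarrow> 'k::comm_ring_1) \<Rightarrow> ('e set \<Rightarrow> 'k) \<Rightarrow> 'e set \<Rightarrow> 'k" where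
  "bdry E \<sigma> c T = (\<Sum>e\<in>E - T. \<sigma> e T * c (insert e T))"

text \<open>Reindexing along the involution would only show that twice the sum vanishes, which says
  nothing in characteristic 2. Hence the orbits are removed pair by pair.\<close>

lemma sum_involution_zero:
  fixes g :: "'b \<Rightarrow> 'a::ab_group_add"
  assumes "finite P" "\<And>p. p \<in> P \<Longrightarrow> \<iota> p \<in> P" "\<And>p. p \<in> P \<Longrightarrow> \<iota> (\<iota> p) = p" "\<And>p. p \<in> P \<Longrightarrow> \<iota> p \<noteq> p"
    and "\<And>p. p \<in> P \<Longrightarrow> g (\<iota> p) = - g p"
  shows "sum g P = 0"
  using assms
proof (induction P rule: finite_psubset_induct)
  case (psubset P)
  show ?case
  proof (cases "P = {}")
    case False
    then obtain p where p: "p \<in> P" by blast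
    define P' where "P' = P - {p, \<iota> p}"
    have "sum g P' = 0"
    proof (rule psubset.IH)
      show "P' \<subset> P" using p by (auto simp: P'_def)
      show "\<iota> q \<in> P'" if "q \<in> P'" for q
        using that psubset.prems(1,2) p unfolding P'_def by (metis Diff_iff insert_iff empty_iff)
    qed (use psubset.prems in \<open>auto simp: P'_def\<close>)
    moreover have "P = insert p (insert (\<iota> p) P')" using p psubset.prems(1) by (auto simp: P'_def)
    moreover have "p \<notin> insert (\<iota> p) P'" "\<iota> p \<notin> P'" "finite P'"
      using p psubset.prems(3)[OF p] psubset.hyps by (auto simp: P'_def)
    ultimately show ?thesis using psubset.prems(4)[OF p] by simp
  qed simp
qed

lemma bdry_bdry:
  assumes "finite E" "alt_sign E \<sigma>" "T \<subseteq> E"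
  shows "bdry E \<sigma> (bdry E \<sigma> c) T = 0"
proof -
  define g where "g = (\<lambda>(e, e'). \<sigma> e T * \<sigma> e' (insert e T) * c (insert e' (insert e T)))"
  define P where "P = Sigma (E - T) (\<lambda>e. E - insert e T)"
  have "bdry E \<sigma> (bdry E \<sigma> c) T = (\<Sum>e\<in>E - T. \<Sum>e'\<in>E - insert e T. g (e, e'))"
    unfolding bdry_def g_def by (simp add: sum_distrib_left mult.assoc)
  also have "\<dots> = sum g P"
    unfolding P_def by (subst sum.Sigma) (use assms in auto)
  also have "\<dots> = 0"
  proof (rule sum_involution_zero[where \<iota> = prod.swap])
    show "finite P" using assms by (auto simp: P_def)
    fix p assume p: "p \<in> P"
    then show "prod.swap p \<in> P" "prod.swap p \<noteq> p" by (auto simp: P_def)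
    obtain e e' where [simp]: "p = (e, e')" by force
    have "\<sigma> e' T * \<sigma> e (insert e' T) = - (\<sigma> e T * \<sigma> e' (insert e T))"
      by (intro alt_signD(2)[OF assms(2)]) (use assms p in \<open>auto simp: P_def\<close>)
    then show "g (prod.swap p) = - g p" by (simp add: g_def insert_commute)
  qed simp
  finally show ?thesis .
qed

lemma bdry_diff: "bdry E \<sigma> (\<lambda>T. c T - d T) T = bdry E \<sigma> c T - bdry E \<sigma> d T"
  by (simp add: bdry_def sum_subtractf algebra_simps)

lemma bdry_add: "bdry E \<sigma> (\<lambda>T. c T + d T) T = bdry E \<sigma> c T + bdry E \<sigma> d T"
  by (simp add: bdry_def sum.distrib algebra_simps)

lemma cone_exact:
  assumes "finite E" "alt_sign E \<sigma>" "e0 \<in> E"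
    and F: "\<And>T. T \<subseteq> E \<Longrightarrow> e0 \<notin> T \<Longrightarrow> F (insert e0 T) \<longleftrightarrow> F T"
    and c: "\<And>T. T \<subseteq> E \<Longrightarrow> F T \<Longrightarrow> Suc (card T) = n \<Longrightarrow> bdry E \<sigma> c T = 0"
  shows "\<exists>b. \<forall>T. T \<subseteq> E \<longrightarrow> F T \<longrightarrow> card T = n \<longrightarrow> bdry E \<sigma> b T = c T"
proof -
  \<comment> \<open>The contracting homotopy of a cone: strip off the apex \<open>e0\<close>, with
    the sign that the boundary will cancel.\<close>
  define b where "b T = (if e0 \<in> T then \<sigma> e0 (T - {e0}) * c (T - {e0}) else 0)" for T
  have "bdry E \<sigma> b T = c T" if T: "T \<subseteq> E" "F T" "card T = n" for T
  proof (cases "e0 \<in> T")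
    case False
    have "bdry E \<sigma> b T = (\<Sum>e\<in>E - T. if e = e0 then \<sigma> e T * b (insert e T) else 0)"
      unfolding bdry_def by (rule sum.cong) (use False in \<open>auto simp: b_def\<close>)
    also have "\<dots> = \<sigma> e0 T * b (insert e0 T)"
      using False assms by (simp add: sum.delta)
    also have "\<dots> = c T" using False alt_signD(1)[OF assms(2,3) T(1) False]
      by (simp add: b_def mult.assoc[symmetric])
    finally show ?thesis .
  next
    case True
    \<comment> \<open>For \<open>T\<close> containing the apex, the cycle condition at
      \<open>T'\<close> expresses the sum over the other elements through \<open>c T\<close>;
      anticommutation of the signs turns that sum into the boundary of \<open>b\<close>.\<close>
    define T' where "T' = T - {e0}"
    have T': "T = insert e0 T'" "e0 \<notin> T'" "T' \<subseteq> E" using True T by (auto simp: T'_def)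
    have finT: "finite T'" using T' assms(1) finite_subset by blast
    have "F T'" using F[of T'] T T' by auto
    moreover have "Suc (card T') = n" using T T' finT by simp
    ultimately have "bdry E \<sigma> c T' = 0" using c T' by blast
    moreover have E: "E - T' = insert e0 (E - T)" using T' assms(3) by blast
    have "e0 \<notin> E - T" "finite (E - T)" using T' assms(1) by auto
    then have "bdry E \<sigma> c T' = \<sigma> e0 T' * c (insert e0 T') + (\<Sum>e\<in>E - T. \<sigma> e T' * c (insert e T'))"
      unfolding bdry_def E by (rule sum.insert[rotated])
    ultimately have "\<sigma> e0 T' * c T + (\<Sum>e\<in>E - T. \<sigma> e T' * c (insert e T')) = 0"
      by (simp only: T'(1)[symmetric])
    then have z: "(\<Sum>e\<in>E - T. \<sigma> e T' * c (insert e T')) = - (\<sigma> e0 T' * c T)"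
      by (simp only: eq_neg_iff_add_eq_0 add.commute)
    have "bdry E \<sigma> b T = (\<Sum>e\<in>E - T. - \<sigma> e0 T' * (\<sigma> e T' * c (insert e T')))"
      unfolding bdry_def
    proof (rule sum.cong[OF refl])
      fix e assume e: "e \<in> E - T"
      then have "insert e T - {e0} = insert e T'" using T' by auto
      moreover have "\<sigma> e0 T' * \<sigma> e (insert e0 T') = - (\<sigma> e T' * \<sigma> e0 (insert e T'))"
        by (rule alt_signD(2)[OF assms(2)]) (use e T' assms in auto)
      then have "\<sigma> e0 T' * \<sigma> e0 T' * \<sigma> e T = - (\<sigma> e0 T' * \<sigma> e T' * \<sigma> e0 (insert e T'))"
        using T' by (simp add: mult.assoc)
      then have "\<sigma> e T = - (\<sigma> e0 T' * \<sigma> e T' * \<sigma> e0 (insert e T'))"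
        using alt_signD(1)[OF assms(2,3) T'(3,2)] by simp
      moreover have "\<sigma> e0 (insert e T') * \<sigma> e0 (insert e T') = 1"
        by (rule alt_signD(1)[OF assms(2)]) (use e T' assms in auto)
      then have "\<sigma> e0 (insert e T') * (\<sigma> e0 (insert e T') * x) = x" for x
        by (simp flip: mult.assoc)
      ultimately show "\<sigma> e T * b (insert e T) = - \<sigma> e0 T' * (\<sigma> e T' * c (insert e T'))"
        using T' by (simp add: b_def mult.assoc)
    qed
    also have "\<dots> = - \<sigma> e0 T' * - (\<sigma> e0 T' * c T)" by (simp only: sum_distrib_left[symmetric] z)
    also have "\<dots> = c T" using alt_signD(1)[OF assms(2,3) T'(3,2)] by (simp flip: mult.assoc)
    finally show ?thesis .
  qed
  then show ?thesis by blast
qed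

section \<open>Independent sets of chordal graphs\<close>

definition indep :: "'v set set \<Rightarrow> 'v set \<Rightarrow> bool" where
  "indep Ed B \<longleftrightarrow> (\<forall>e\<in>Ed. \<not> e \<subseteq> B)"

lemma indep_mono: "indep Ed B \<Longrightarrow> A \<subseteq> B \<Longrightarrow> indep Ed A"
  unfolding indep_def by blast

definition simplicial :: "'v set set \<Rightarrow> 'v set \<Rightarrow> 'v \<Rightarrow> bool" where
  "simplicial Ed W z \<longleftrightarrow>
    (\<forall>u\<in>W. \<forall>v\<in>W. {u, z} \<in> Ed \<longrightarrow> {v, z} \<in> Ed \<longrightarrow> u \<noteq> v \<longrightarrow> {u, v} \<in> Ed)"

text \<open>Dirac's characterisation of chordal graphs serves as the definition.\<close>

definition chordal :: "'v set set \<Rightarrow> 'v set \<Rightarrow> bool" where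
  "chordal Ed U \<longleftrightarrow> (\<forall>W. W \<subseteq> U \<longrightarrow> W \<noteq> {} \<longrightarrow> (\<exists>z\<in>W. simplicial Ed W z))"

lemma chordal_mono: "chordal Ed U \<Longrightarrow> U' \<subseteq> U \<Longrightarrow> chordal Ed U'"
  unfolding chordal_def by blast

definition ind_matching :: "'v set set \<Rightarrow> 'v set set \<Rightarrow> bool" where
  "ind_matching Ed Mt \<longleftrightarrow> Mt \<subseteq> Ed \<and> (\<forall>e\<in>Mt. \<forall>e'\<in>Mt. e \<noteq> e' \<longrightarrow> e \<inter> e' = {}) \<and>
    (\<forall>e\<in>Ed. e \<subseteq> \<Union>Mt \<longrightarrow> e \<in> Mt)"

lemma ind_matching_insert:
  assumes Mt: "ind_matching Ed Mt" and card2: "\<forall>e\<in>Ed. card e = 2"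
    and e: "{x, z} \<in> Ed" and far: "\<And>u. u \<in> \<Union>Mt \<Longrightarrow> u \<noteq> x \<and> u \<noteq> z \<and> {u, x} \<notin> Ed \<and> {u, z} \<notin> Ed"
  shows "ind_matching Ed (insert {x, z} Mt)"
  unfolding ind_matching_def
proof (intro conjI ballI impI)
  show "insert {x, z} Mt \<subseteq> Ed" using Mt e unfolding ind_matching_def by blast
  show "a \<inter> b = {}" if "a \<in> insert {x, z} Mt" "b \<in> insert {x, z} Mt" "a \<noteq> b" for a b
  proof -
    have "m \<inter> {x, z} = {}" if "m \<in> Mt" for m using far that by blast
    moreover have "a \<in> Mt \<Longrightarrow> b \<in> Mt \<Longrightarrow> a \<inter> b = {}" using Mt that(3) by (simp add: ind_matching_def)
    ultimately show ?thesis using that by (metis insert_iff inf_commute)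
  qed
  fix e' assume e': "e' \<in> Ed" "e' \<subseteq> \<Union>(insert {x, z} Mt)"
  have x: "x \<noteq> z" using card2 e by auto
  obtain a b where ab: "e' = {a, b}" "a \<noteq> b" using card2 e'(1) by (meson card_2_iff)
  consider "a \<in> \<Union>Mt" "b \<in> \<Union>Mt" | "a \<in> \<Union>Mt" "b \<in> {x, z}" | "b \<in> \<Union>Mt" "a \<in> {x, z}"
    | "a \<in> {x, z}" "b \<in> {x, z}" using ab e'(2) by auto
  then show "e' \<in> insert {x, z} Mt"
  proof cases
    case 1 then show ?thesis using Mt e' ab unfolding ind_matching_def by auto
  next
    case 2 then show ?thesis using far[OF 2(1)] e' ab by auto
  next
    case 3 then show ?thesis using far[OF 3(1)] e' ab by (auto simp: insert_commute)
  next
    case 4 then show ?thesis using ab by auto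
  qed
qed

text \<open>\<^term>\<open>T\<close> stands for the complement of an independent set, so this says that the reduced
  cohomology of the independence complex of \<^term>\<open>U\<close> vanishes on faces with \<^term>\<open>k\<close> vertices. The
  induction deletes a neighbour \<open>x\<close> of a simplicial vertex, and then passes to the link of \<open>x\<close>.\<close>

lemma indep_exact:
  fixes \<sigma> :: "'v \<Rightarrow> 'v set \<Rightarrow> 'k::comm_ring_1"
  assumes card2: "\<forall>e\<in>Ed. card e = 2" and "finite U" "chordal Ed U" "alt_sign U \<sigma>"
    and "\<not> (\<exists>Mt. ind_matching Ed Mt \<and> \<Union>Mt \<subseteq> U \<and> finite Mt \<and> card Mt = k)"
    and "\<And>T. T \<subseteq> U \<Longrightarrow> indep Ed (U - T) \<Longrightarrow> Suc (card T) + k = card U \<Longrightarrow> bdry U \<sigma> c T = 0"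
  shows "\<exists>b. \<forall>T. T \<subseteq> U \<longrightarrow> indep Ed (U - T) \<longrightarrow> card T + k = card U \<longrightarrow> bdry U \<sigma> b T = c T"
  using assms(2-)
proof (induction U arbitrary: \<sigma> c k rule: finite_psubset_induct)
  case (psubset U)
  note fin = psubset.hyps and chord = psubset.prems(1) and \<sigma> = psubset.prems(2)
    and noM = psubset.prems(3) and cyc = psubset.prems(4)
  have "k \<noteq> 0"
  proof
    assume "k = 0"
    moreover have "ind_matching Ed {}" using card2 by (auto simp: ind_matching_def)
    ultimately show False using noM by (metis Union_empty card.empty empty_subsetI finite.emptyI)
  qed
  show ?case
  proof (cases "U = {}")
    case True
    then show ?thesis using \<open>k \<noteq> 0\<close> by simp
  next
    case False
    then obtain z where z: "z \<in> U" "simplicial Ed U z" using chord unfolding chordal_def by blast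
    show ?thesis
    proof (cases "\<exists>x\<in>U. {x, z} \<in> Ed")
      case False
      \<comment> \<open>An isolated vertex \<open>z\<close> can be added to every independent set,
        so the complex is a cone with apex \<open>z\<close>.\<close>
      have F: "indep Ed (U - insert z T) \<longleftrightarrow> indep Ed (U - T)" if "T \<subseteq> U" "z \<notin> T" for T
      proof
        assume "indep Ed (U - T)"
        then show "indep Ed (U - insert z T)" by (rule indep_mono) blast
      next
        assume l: "indep Ed (U - insert z T)"
        show "indep Ed (U - T)"
          unfolding indep_def
        proof (intro ballI notI)
          fix e assume e: "e \<in> Ed" "e \<subseteq> U - T"
          then have "z \<in> e" using l unfolding indep_def by blast
          moreover obtain a b where "e = {a, b}" using card2 e(1) by (meson card_2_iff)
          ultimately have "\<exists>x. e = {x, z}" by auto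
          then show False using False e by auto
        qed
      qed
      show ?thesis
      proof (cases "k \<le> card U")
        case True
        have "\<exists>b. \<forall>T. T \<subseteq> U \<longrightarrow> indep Ed (U - T) \<longrightarrow> card T = card U - k \<longrightarrow> bdry U \<sigma> b T = c T"
          by (rule cone_exact[OF fin \<sigma> z(1)]) (use F cyc True in auto)
        then show ?thesis using True by (metis add_diff_cancel_right')
      qed auto
    next
      case True
      then obtain x where x: "x \<in> U" "{x, z} \<in> Ed" by blast
      have "x \<noteq> z" using card2 x(2) by auto
      \<comment> \<open>\<open>U1\<close> carries the deletion of \<open>x\<close>, and
        \<open>U0\<close>, the vertices neither equal nor adjacent to \<open>x\<close>, carries its
        link.\<close>
      define U1 where "U1 = U - {x}"
      define Nx where "Nx = {u\<in>U. {u, x} \<in> Ed}"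
      define U0 where "U0 = U1 - Nx"
      have "x \<notin> Nx" using card2 by (auto simp: Nx_def)
      have Ueq: "U = insert x (Nx \<union> U0)"
        using x by (auto simp: U1_def U0_def Nx_def)
      have UU: "x \<notin> U0" "Nx \<inter> U0 = {}" "Nx \<subseteq> U" "U0 \<subseteq> U" "U1 \<subset> U" "U0 \<subset> U"
        using x by (auto simp: U1_def U0_def Nx_def)
      have finN: "finite Nx" "finite U0" "finite U1" using fin by (auto simp: Nx_def U0_def U1_def)
      have cardU: "card U = Suc (card Nx + card U0)" "card U = Suc (card U1)"
        proof -
        show "card U = Suc (card Nx + card U0)"
          unfolding Ueq using UU finN \<open>x \<notin> Nx\<close> by (simp add: card_Un_disjoint)
        show "card U = Suc (card U1)" unfolding U1_def by (rule card.remove[OF fin x(1)])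
      qed
      have zN: "z \<in> Nx" using x z by (auto simp: Nx_def insert_commute)

      define \<sigma>1 where "\<sigma>1 e T = \<sigma> e ({x} \<union> T)" for e T
      have \<sigma>1: "alt_sign U1 \<sigma>1"
        unfolding \<sigma>1_def using alt_sign_shift[OF \<sigma>, of U1 "{x}"] x by (auto simp: U1_def)
      have ins: "\<sigma>1 e T = \<sigma> e (insert x T)" for e T by (simp add: \<sigma>1_def)
      have bd1: "bdry U1 \<sigma>1 d T = bdry U \<sigma> d' (insert x T)"
        if "T \<subseteq> U1" "\<And>e. e \<in> U1 - T \<Longrightarrow> d' (insert x (insert e T)) = d (insert e T)" for d d' T
      proof -
        have "U - insert x T = U1 - T" by (auto simp: U1_def)
        then show ?thesis unfolding bdry_def ins using that by (auto intro!: sum.cong simp: insert_commute)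
      qed
      \<comment> \<open>First the sets containing \<open>x\<close>, whose complements lie in
        \<open>U1\<close>. Removing \<open>x\<close> lowers both the set and the ground set by one,
        so \<open>k\<close> is unchanged.\<close>
      have "\<exists>b1. \<forall>T. T \<subseteq> U1 \<longrightarrow> indep Ed (U1 - T) \<longrightarrow> card T + k = card U1 \<longrightarrow>
          bdry U1 \<sigma>1 b1 T = c (insert x T)"
      proof (rule psubset.IH[OF \<open>U1 \<subset> U\<close> chordal_mono[OF chord] \<sigma>1])
        show "U1 \<subseteq> U" using UU by blast
        show "\<not> (\<exists>Mt. ind_matching Ed Mt \<and> \<Union>Mt \<subseteq> U1 \<and> finite Mt \<and> card Mt = k)"
          using noM \<open>U1 \<subseteq> U\<close> by blast
        fix T assume T: "T \<subseteq> U1" "indep Ed (U1 - T)" "Suc (card T) + k = card U1"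
        then have "x \<notin> T" "finite T" using finN finite_subset by (auto simp: U1_def)
        moreover have "U - insert x T = U1 - T" by (auto simp: U1_def)
        ultimately have "bdry U \<sigma> c (insert x T) = 0"
          using T cardU x UU by (intro cyc) auto
        then show "bdry U1 \<sigma>1 (\<lambda>T. c (insert x T)) T = 0"
          using bd1[OF T(1), of c "\<lambda>T. c (insert x T)"] by simp
      qed
      then obtain b1 where b1: "\<And>T. T \<subseteq> U1 \<Longrightarrow> indep Ed (U1 - T) \<Longrightarrow> card T + k = card U1 \<Longrightarrow>
          bdry U1 \<sigma>1 b1 T = c (insert x T)" by blast
      \<comment> \<open>Extended by zero, \<open>b1\<close> solves the equation at all sets
        containing \<open>x\<close>; subtracting its boundary leaves a cycle \<open>c'\<close> that
        vanishes there.\<close>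
      define \<beta> where "\<beta> T = (if x \<in> T then b1 (T - {x}) else 0)" for T
      define c' where "c' T = c T - bdry U \<sigma> \<beta> T" for T
      have c'0: "c' T = 0" if T: "T \<subseteq> U" "indep Ed (U - T)" "card T + k = card U" "x \<in> T" for T
      proof -
        define T1 where "T1 = T - {x}"
        have T1: "T = insert x T1" "x \<notin> T1" "T1 \<subseteq> U1" using T by (auto simp: T1_def U1_def)
        have "finite T1" using T1(3) finN finite_subset by blast
        have "U1 - T1 = U - T" using T1 by (auto simp: U1_def)
        then have "bdry U1 \<sigma>1 b1 T1 = c T"
          using b1[OF T1(3)] T T1 \<open>finite T1\<close> cardU by auto
        moreover have "bdry U1 \<sigma>1 b1 T1 = bdry U \<sigma> \<beta> T"
          unfolding T1(1) using T1 by (intro bd1) (auto simp: \<beta>_def U1_def insert_Diff_if)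
        ultimately show ?thesis by (simp add: c'_def)
      qed
      have c'cyc: "bdry U \<sigma> c' T = 0" if "T \<subseteq> U" "indep Ed (U - T)" "Suc (card T) + k = card U" for T
        unfolding c'_def bdry_diff using cyc[OF that] bdry_bdry[OF fin \<sigma> that(1)] by simp

      \<comment> \<open>An independent complement containing \<open>x\<close> avoids the neighbours
        of \<open>x\<close>. So the sets still to be treated contain \<open>Nx\<close> but not
        \<open>x\<close>, and correspond to subsets of \<open>U0\<close>.\<close>
      define \<sigma>0 where "\<sigma>0 e T = \<sigma> e (Nx \<union> T)" for e T
      have \<sigma>0: "alt_sign U0 \<sigma>0"
        unfolding \<sigma>0_def by (rule alt_sign_shift[OF \<sigma>]) (use UU in auto)
      have Ux: "U - (Nx \<union> T) = insert x (U0 - T)" "x \<notin> U0 - T" if "T \<subseteq> U0" for T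
        unfolding Ueq using that UU \<open>x \<notin> Nx\<close> by blast+
      have bd0: "bdry U \<sigma> d' (Nx \<union> T) = bdry U0 \<sigma>0 d T"
        if "T \<subseteq> U0" "d' (insert x (Nx \<union> T)) = 0" "\<And>e. e \<in> U0 - T \<Longrightarrow> d' (Nx \<union> insert e T) = d (insert e T)"
        for d d' T
      proof -
        have "bdry U \<sigma> d' (Nx \<union> T) = (\<Sum>e\<in>U0 - T. \<sigma> e (Nx \<union> T) * d' (insert e (Nx \<union> T)))"
          unfolding bdry_def Ux(1)[OF that(1)] using Ux(2)[OF that(1)] finN that(2) by simp
        also have "\<dots> = bdry U0 \<sigma>0 d T"
          unfolding bdry_def \<sigma>0_def using that(3) by (intro sum.cong) auto
        finally show ?thesis .
      qed
      have indx: "indep Ed (insert x B)" if "indep Ed B" "B \<subseteq> U0" for B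
        unfolding indep_def
      proof (intro ballI notI)
        fix e assume e: "e \<in> Ed" "e \<subseteq> insert x B"
        then have "x \<in> e" using that unfolding indep_def by blast
        moreover obtain a b where "e = {a, b}" "a \<noteq> b" using card2 e(1) by (meson card_2_iff)
        ultimately obtain y where y: "e = {y, x}" "y \<noteq> x" by (metis doubleton_eq_iff insert_iff singletonD)
        then have "y \<in> U0" using e(2) that(2) by blast
        then show False using e(1) y by (simp add: U0_def U1_def Nx_def)
      qed
      \<comment> \<open>In the link the independent set has lost \<open>x\<close>, whence
        \<open>k - 1\<close>; the subtraction is exact because \<open>k\<close> is nonzero.\<close>
      have "\<exists>b0. \<forall>T. T \<subseteq> U0 \<longrightarrow> indep Ed (U0 - T) \<longrightarrow> card T + (k - 1) = card U0 \<longrightarrow>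
          bdry U0 \<sigma>0 b0 T = c' (Nx \<union> T)"
      proof (rule psubset.IH[OF \<open>U0 \<subset> U\<close> chordal_mono[OF chord] \<sigma>0])
        show "U0 \<subseteq> U" using UU by blast
        show "\<not> (\<exists>Mt. ind_matching Ed Mt \<and> \<Union>Mt \<subseteq> U0 \<and> finite Mt \<and> card Mt = k - 1)"
        proof
          assume "\<exists>Mt. ind_matching Ed Mt \<and> \<Union>Mt \<subseteq> U0 \<and> finite Mt \<and> card Mt = k - 1"
          then obtain Mt where Mt: "ind_matching Ed Mt" "\<Union>Mt \<subseteq> U0" "finite Mt" "card Mt = k - 1" by blast
          have far: "u \<noteq> x \<and> u \<noteq> z \<and> {u, x} \<notin> Ed \<and> {u, z} \<notin> Ed" if "u \<in> \<Union>Mt" for u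
          proof -
            have "u \<in> U0" using Mt(2) that by blast
            then have u: "u \<in> U" "u \<noteq> x" "{u, x} \<notin> Ed" by (auto simp: U0_def U1_def Nx_def)
            moreover have "u \<noteq> z" using \<open>u \<in> U0\<close> zN UU by blast
            \<comment> \<open>This is where \<open>z\<close> must be simplicial: if \<open>u\<close>
              were adjacent to \<open>z\<close>, then \<open>u\<close> and \<open>x\<close>, both
              neighbours of \<open>z\<close>, would be adjacent.\<close>
            moreover have "{u, z} \<notin> Ed" using u x z(2) unfolding simplicial_def by blast
            ultimately show ?thesis by blast
          qed
          then have "ind_matching Ed (insert {x, z} Mt)" using ind_matching_insert[OF Mt(1) card2 x(2)] by blast
          moreover have "{x, z} \<notin> Mt" using far by blast
          then have "card (insert {x, z} Mt) = k" using Mt \<open>k \<noteq> 0\<close> by simp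
          moreover have "\<Union>(insert {x, z} Mt) \<subseteq> U" using Mt x z UU by blast
          ultimately show False using noM Mt(3) by (metis finite_insert)
        qed
        fix T assume T: "T \<subseteq> U0" "indep Ed (U0 - T)" "Suc (card T) + (k - 1) = card U0"
        have finT: "finite T" using T finN finite_subset by blast
        have dj: "Nx \<inter> T = {}" "x \<notin> T" using UU T by auto
        have cT: "card (Nx \<union> T) = card Nx + card T" "card (insert x (Nx \<union> T)) = Suc (card Nx + card T)"
          using dj finT finN \<open>x \<notin> Nx\<close> by (auto simp: card_Un_disjoint)
        have i: "indep Ed (U - (Nx \<union> T))" unfolding Ux(1)[OF T(1)] using T by (intro indx) auto
        have "c' (insert x (Nx \<union> T)) = 0"
        proof (rule c'0)
          have "U - insert x (Nx \<union> T) \<subseteq> U0 - T" using Ux(1)[OF T(1)] by blast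
          then show "indep Ed (U - insert x (Nx \<union> T))" using T(2) indep_mono by blast
        qed (use T UU x cT cardU \<open>k \<noteq> 0\<close> in auto)
        then have "bdry U \<sigma> c' (Nx \<union> T) = bdry U0 \<sigma>0 (\<lambda>T. c' (Nx \<union> T)) T" using T by (intro bd0) auto
        moreover have "bdry U \<sigma> c' (Nx \<union> T) = 0"
          by (rule c'cyc) (use T UU i cT cardU \<open>k \<noteq> 0\<close> in auto)
        ultimately show "bdry U0 \<sigma>0 (\<lambda>T. c' (Nx \<union> T)) T = 0" by simp
      qed
      then obtain b0 where b0: "\<And>T. T \<subseteq> U0 \<Longrightarrow> indep Ed (U0 - T) \<Longrightarrow> card T + (k - 1) = card U0 \<Longrightarrow>
          bdry U0 \<sigma>0 b0 T = c' (Nx \<union> T)" by blast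
      \<comment> \<open>The boundary of \<gamma> vanishes at every set containing \<open>x\<close>,
        so it does not disturb what \<beta> achieves there.\<close>
      define \<gamma> where "\<gamma> T = (if x \<notin> T \<and> Nx \<subseteq> T then b0 (T - Nx) else 0)" for T
      have "bdry U \<sigma> \<gamma> T = c' T" if T: "T \<subseteq> U" "indep Ed (U - T)" "card T + k = card U" for T
      proof (cases "x \<in> T")
        case True
        then have "bdry U \<sigma> \<gamma> T = 0" by (simp add: bdry_def \<gamma>_def)
        then show ?thesis using c'0[OF T True] by simp
      next
        case False
        have "Nx \<subseteq> T"
        proof
          fix u assume u: "u \<in> Nx"
          show "u \<in> T"
          proof (rule ccontr)
            assume "u \<notin> T"
            then have "{u, x} \<subseteq> U - T" using u False x UU by auto
            then show False using T(2) u unfolding indep_def Nx_def by blast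
          qed
        qed
        define T0 where "T0 = T - Nx"
        have T0: "T = Nx \<union> T0" "T0 \<subseteq> U0" "Nx \<inter> T0 = {}"
          using \<open>Nx \<subseteq> T\<close> False T(1) unfolding Ueq T0_def by blast+
        have finT0: "finite T0" using T0 finN finite_subset by blast
        have "U0 - T0 \<subseteq> U - T" using T0 UU by blast
        then have i: "indep Ed (U0 - T0)" using T(2) indep_mono by blast
        have "bdry U \<sigma> \<gamma> T = bdry U0 \<sigma>0 b0 T0"
          unfolding T0(1)
        proof (rule bd0[OF T0(2)])
          fix e assume "e \<in> U0 - T0"
          then have "x \<notin> Nx \<union> insert e T0" "Nx \<union> insert e T0 - Nx = insert e T0"
            using T0 UU \<open>x \<notin> Nx\<close> by auto
          then show "\<gamma> (Nx \<union> insert e T0) = b0 (insert e T0)" by (auto simp: \<gamma>_def)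
        qed (simp add: \<gamma>_def)
        also have "\<dots> = c' T"
          unfolding T0(1) using T0 finT0 finN T(3) cardU \<open>k \<noteq> 0\<close> i
          by (intro b0) (auto simp: card_Un_disjoint)
        finally show ?thesis .
      qed
      then have "\<forall>T. T \<subseteq> U \<longrightarrow> indep Ed (U - T) \<longrightarrow> card T + k = card U \<longrightarrow>
          bdry U \<sigma> (\<lambda>T. \<gamma> T + \<beta> T) T = c T"
        unfolding bdry_add by (simp add: c'_def)
      then show ?thesis by blast
    qed
  qed
qed

text \<open>These are the facets of the boundary of the cross polytope whose pairs of antipodal
  vertices are the edges of \<open>Mt\<close>.\<close>

definition transversal :: "'v set set \<Rightarrow> 'v set \<Rightarrow> bool" where
  "transversal Mt A \<longleftrightarrow> A \<subseteq> \<Union>Mt \<and> (\<forall>e\<in>Mt. \<exists>x. A \<inter> e = {x})"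

text \<open>The fundamental class of the boundary of the cross polytope spanned by the edges of \<^term>\<open>Mt\<close>.\<close>

lemma transversal_class:
  fixes \<sigma> :: "'v \<Rightarrow> 'v set \<Rightarrow> 'k::comm_ring_1"
  assumes "finite Mt" "\<forall>e\<in>Mt. card e = 2" "\<forall>e\<in>Mt. \<forall>e'\<in>Mt. e \<noteq> e' \<longrightarrow> e \<inter> e' = {}"
    and "\<Union>Mt \<subseteq> U" "alt_sign U \<sigma>"
  shows "\<exists>\<epsilon>. (\<forall>A. transversal Mt A \<longrightarrow> \<epsilon> A * \<epsilon> A = 1) \<and>
    (\<forall>a b R. {a, b} \<in> Mt \<longrightarrow> transversal (Mt - {{a, b}}) R \<longrightarrow>
       \<epsilon> (insert a R) * \<sigma> b (insert a R) + \<epsilon> (insert b R) * \<sigma> a (insert b R) = 0)"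
  using assms
proof (induction Mt rule: finite_induct)
  case empty
  show ?case by (rule exI[of _ "\<lambda>_. 1"]) simp
next
  case (insert e Mt)
  obtain \<mu> where \<mu>: "\<And>A. transversal Mt A \<Longrightarrow> \<mu> A * \<mu> A = 1"
    "\<And>a b R. {a, b} \<in> Mt \<Longrightarrow> transversal (Mt - {{a, b}}) R \<Longrightarrow>
       \<mu> (insert a R) * \<sigma> b (insert a R) + \<mu> (insert b R) * \<sigma> a (insert b R) = 0"
  proof -
    have "\<forall>e\<in>Mt. card e = 2" "\<forall>e\<in>Mt. \<forall>e'\<in>Mt. e \<noteq> e' \<longrightarrow> e \<inter> e' = {}" "\<Union>Mt \<subseteq> U"
      using insert.prems(1-3) by auto
    from insert.IH[OF this insert.prems(4)] show thesis using that by blast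
  qed
  obtain x y where e: "e = {x, y}" "x \<noteq> y" using insert.prems(1) by (meson card_2_iff insertI1)
  have xy: "x \<notin> \<Union>Mt" "y \<notin> \<Union>Mt" using insert.prems(2) insert.hyps(2) e by auto
  have xyU: "x \<in> U" "y \<in> U" "\<Union>Mt \<subseteq> U" using insert.prems(3) e by auto
  note \<sigma> = \<open>alt_sign U \<sigma>\<close>
  \<comment> \<open>A cross polytope grows by suspension: the vertex chosen from the new edge
    contributes its sign, the other vertices their old class.\<close>
  define \<epsilon> where "\<epsilon> A = (if x \<in> A then \<sigma> x (A - {x}) * \<mu> (A - {x}) else \<sigma> y (A - {y}) * \<mu> (A - {y}))" for A
  have \<epsilon>: "\<epsilon> (insert w A) = \<sigma> w A * \<mu> A" if "w \<in> e" "A \<subseteq> \<Union>Mt" for w A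
  proof -
    have "x \<notin> A" "y \<notin> A" using that xy by auto
    then show ?thesis using that e by (auto simp: \<epsilon>_def)
  qed
  have dec: "\<exists>w A'. w \<in> e \<and> A = insert w A' \<and> A' \<subseteq> \<Union>Mt' \<and> transversal Mt' A'"
    if tr: "transversal (insert e Mt') A" "Mt' \<subseteq> Mt" for A Mt'
  proof -
    obtain w where w: "A \<inter> e = {w}" using tr unfolding transversal_def by blast
    have "A' \<inter> e = {}" if "A' \<in> Mt" for A' using that xy e by auto
    then have "(A - {w}) \<inter> A' = A \<inter> A'" if "A' \<in> Mt" for A' using that w by blast
    moreover have "A - {w} \<subseteq> \<Union>Mt'" using tr w unfolding transversal_def by blast
    ultimately have "transversal Mt' (A - {w})" using tr unfolding transversal_def by (metis insertCI subset_iff)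
    moreover have "w \<in> e" "A = insert w (A - {w})" using w by auto
    ultimately show ?thesis using \<open>A - {w} \<subseteq> \<Union>Mt'\<close> by metis
  qed
  show ?case
  proof (intro exI[of _ \<epsilon>] conjI allI impI)
    fix A assume "transversal (insert e Mt) A"
    from dec[OF this subset_refl] obtain w A'
      where w: "w \<in> e" "A = insert w A'" "A' \<subseteq> \<Union>Mt" "transversal Mt A'" by (elim exE conjE)
    have "\<sigma> w A' * \<sigma> w A' = 1" by (rule alt_signD(1)[OF \<sigma>]) (use w xyU xy e in auto)
    then have "(\<sigma> w A' * \<sigma> w A') * (\<mu> A' * \<mu> A') = 1" using \<mu>(1)[OF w(4)] by simp
    then show "\<epsilon> A * \<epsilon> A = 1" using \<epsilon>[OF w(1,3)] w(2) by (simp add: ac_simps)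
  next
    fix a b R assume ab: "{a, b} \<in> insert e Mt" and R: "transversal (insert e Mt - {{a, b}}) R"
    show "\<epsilon> (insert a R) * \<sigma> b (insert a R) + \<epsilon> (insert b R) * \<sigma> a (insert b R) = 0"
    proof (cases "{a, b} = e")
      case True
      have "a \<noteq> b" using True insert.prems(1) by auto
      have R': "R \<subseteq> \<Union>Mt" using R True insert.hyps by (simp add: transversal_def)
      have "\<sigma> a R * \<sigma> b (insert a R) = - (\<sigma> b R * \<sigma> a (insert b R))"
      proof -
        have "a = x \<or> a = y" "b = x \<or> b = y" using True e(1) by (auto simp: doubleton_eq_iff)
        then have "a \<in> U" "b \<in> U" "a \<notin> R" "b \<notin> R" "R \<subseteq> U" using R' xyU xy by blast+
        then show ?thesis by (intro alt_signD(2)[OF \<sigma>] \<open>a \<noteq> b\<close>)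
      qed
      then have "\<sigma> a R * \<sigma> b (insert a R) * \<mu> R + \<sigma> b R * \<sigma> a (insert b R) * \<mu> R = 0" by simp
      then show ?thesis using \<epsilon>[of a R, OF _ R'] \<epsilon>[of b R, OF _ R'] unfolding True[symmetric] by (simp add: ac_simps)
    next
      case False
      define Mt' where "Mt' = Mt - {{a, b}}"
      have abM: "{a, b} \<in> Mt" using ab False by simp
      then have "a \<noteq> b" using insert.prems(1) by fastforce
      have "insert e Mt - {{a, b}} = insert e Mt'" using False by (auto simp: Mt'_def)
      then have "transversal (insert e Mt') R" using R by simp
      moreover have "Mt' \<subseteq> Mt" by (auto simp: Mt'_def)
      ultimately obtain w R' where w: "w \<in> e" "R = insert w R'" "R' \<subseteq> \<Union>Mt'" "transversal Mt' R'"
        by (elim dec[elim_format] exE conjE)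
      have disj: "a \<notin> \<Union>Mt'" "b \<notin> \<Union>Mt'"
      proof -
        have "m \<inter> {a, b} = {}" if "m \<in> Mt'" for m
          using insert.prems(2) abM that unfolding Mt'_def by (metis Diff_iff insertCI)
        then show "a \<notin> \<Union>Mt'" "b \<notin> \<Union>Mt'" by blast+
      qed
      have sub: "insert a R' \<subseteq> \<Union>Mt" "insert b R' \<subseteq> \<Union>Mt" using abM w(3) by (auto simp: Mt'_def)
      have n: "a \<in> U" "b \<in> U" "a \<noteq> w" "b \<noteq> w" "w \<in> U" "w \<notin> R'" "a \<notin> R'" "b \<notin> R'"
      proof -
        have ab': "a \<in> \<Union>Mt" "b \<in> \<Union>Mt" using sub by blast+
        then show "a \<in> U" "b \<in> U" using xyU(3) by blast+
        have w': "w \<in> U" "w \<notin> \<Union>Mt" using w(1) e(1) xy xyU(1,2) by auto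
        then show "a \<noteq> w" "b \<noteq> w" "w \<in> U" "w \<notin> R'" using ab' sub(1) by blast+
        show "a \<notin> R'" "b \<notin> R'" using disj w(3) by blast+
      qed
      \<comment> \<open>Moving \<open>w\<close> past \<open>b\<close>, respectively past
        \<open>a\<close>, produces the same factor, the sign of \<open>w\<close> over both ends;
        what remains is the relation for the smaller matching.\<close>
      have "\<sigma> w (insert a R') * \<sigma> b (insert w (insert a R')) = - (\<sigma> b (insert a R') * \<sigma> w (insert b (insert a R')))"
        by (rule alt_signD(2)[OF \<sigma>]) (use n sub xyU \<open>a \<noteq> b\<close> in auto)
      moreover have "\<sigma> w (insert b R') * \<sigma> a (insert w (insert b R')) = - (\<sigma> a (insert b R') * \<sigma> w (insert a (insert b R')))"
        by (rule alt_signD(2)[OF \<sigma>]) (use n sub xyU \<open>a \<noteq> b\<close> in auto)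
      ultimately have "\<epsilon> (insert a R) * \<sigma> b (insert a R) + \<epsilon> (insert b R) * \<sigma> a (insert b R) =
          - \<sigma> w (insert a (insert b R')) *
            (\<mu> (insert a R') * \<sigma> b (insert a R') + \<mu> (insert b R') * \<sigma> a (insert b R'))"
        using \<epsilon>[OF w(1) sub(1)] \<epsilon>[OF w(1) sub(2)] w(2)
        by (simp add: insert_commute algebra_simps)
      also have "\<dots> = 0" using \<mu>(2)[OF abM] w(4) by (simp add: Mt'_def)
      finally show ?thesis .
    qed
  qed
qed

text \<open>Pairing with the fundamental class kills every boundary, but sends the indicator of a
  single facet to a unit.\<close>

lemma transversal_not_boundary:
  fixes \<sigma> :: "'v \<Rightarrow> 'v set \<Rightarrow> 'k::comm_ring_1"
  assumes fin: "finite Mt" and card2: "\<forall>e\<in>Mt. card e = 2"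
    and disj: "\<forall>e\<in>Mt. \<forall>e'\<in>Mt. e \<noteq> e' \<longrightarrow> e \<inter> e' = {}"
    and \<sigma>: "alt_sign (\<Union>Mt) \<sigma>" and A0: "transversal Mt A0"
    and b: "\<And>A. transversal Mt A \<Longrightarrow> bdry (\<Union>Mt) \<sigma> b A = (if A = A0 then 1 else 0)"
  shows False
proof -
  let ?U = "\<Union>Mt"
  obtain \<epsilon> where \<epsilon>: "\<And>A. transversal Mt A \<Longrightarrow> \<epsilon> A * \<epsilon> A = 1"
    "\<And>a b R. {a, b} \<in> Mt \<Longrightarrow> transversal (Mt - {{a, b}}) R \<Longrightarrow>
       \<epsilon> (insert a R) * \<sigma> b (insert a R) + \<epsilon> (insert b R) * \<sigma> a (insert b R) = 0"
    using transversal_class[OF fin card2 disj subset_refl \<sigma>] by blast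
  have "finite e" if "e \<in> Mt" for e using card2 that card.infinite by fastforce
  then have finU: "finite ?U" using fin by blast
  define TS where "TS = {A. transversal Mt A}"
  have finT: "finite TS" by (rule finite_subset[of _ "Pow ?U"]) (use finU in \<open>auto simp: TS_def transversal_def\<close>)
  define P where "P = Sigma TS (\<lambda>A. ?U - A)"
  define g where "g = (\<lambda>(A, e). \<epsilon> A * (\<sigma> e A * b (insert e A)))"
  \<comment> \<open>A term is a set \<open>insert e A\<close> containing both ends of exactly one
    matching edge. It arises twice, according to which of the two ends is regarded as added, and
    \<iota> exchanges these two ways.\<close>
  define partner where "partner e = (THE a. {a, e} \<in> Mt)" for e
  define \<iota> where "\<iota> = (\<lambda>(A, e). (insert e A - {partner e}, partner e))"
  have partner: "partner y = x" if "{x, y} \<in> Mt" for x y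
    unfolding partner_def
  proof (rule the_equality[where P = "\<lambda>a. {a, y} \<in> Mt", OF that])
    fix a assume "{a, y} \<in> Mt"
    then have "{a, y} \<noteq> {x, y} \<Longrightarrow> {a, y} \<inter> {x, y} = {}" using disj that by simp
    then show "a = x" by (auto simp: doubleton_eq_iff)
  qed
  have P: "\<exists>R a e. p = (insert a R, e) \<and> {a, e} \<in> Mt \<and> a \<noteq> e \<and> a \<notin> R \<and> e \<notin> R \<and> transversal (Mt - {{a, e}}) R
      \<and> \<iota> p = (insert e R, a) \<and> \<iota> (\<iota> p) = p \<and> \<iota> p \<in> P" if pP: "p \<in> P" for p
  proof -
    obtain A e where p: "p = (A, e)" "transversal Mt A" "e \<in> ?U" "e \<notin> A"
      using pP by (auto simp: P_def TS_def)
    obtain m where m: "m \<in> Mt" "e \<in> m" using p by blast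
    obtain a where a: "A \<inter> m = {a}" using p m unfolding transversal_def by blast
    have djm: "m' \<inter> m = {}" if "m' \<in> Mt" "m' \<noteq> m" for m' using disj that m by simp
    have "card m = 2" using card2 m by simp
    then obtain u v where uv: "m = {u, v}" by (meson card_2_iff)
    have am: "a \<in> m" "a \<in> A" "a \<noteq> e" using a p(4) by auto
    then have meq: "m = {a, e}" "a \<noteq> e" using uv m(2) by auto
    define R where "R = A - {a}"
    have A: "A = insert a R" "a \<notin> R" "e \<notin> R" using am p by (auto simp: R_def)
    have R: "R \<subseteq> \<Union>(Mt - {m})"
    proof
      fix u assume u: "u \<in> R"
      then obtain m' where m': "m' \<in> Mt" "u \<in> m'" using p(2) unfolding transversal_def R_def by blast
      moreover have "u \<notin> m" using u A(2,3) meq by auto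
      ultimately show "u \<in> \<Union>(Mt - {m})" by blast
    qed
    have other: "insert w R \<inter> m' = A \<inter> m'" "R \<inter> m' = A \<inter> m'" if "m' \<in> Mt" "m' \<noteq> m" "w \<in> m" for m' w
      using djm[OF that(1,2)] that(3) am unfolding R_def by blast+
    have p2: "A \<subseteq> \<Union>Mt" "\<And>m. m \<in> Mt \<Longrightarrow> \<exists>x. A \<inter> m = {x}" using p(2) unfolding transversal_def by auto
    have "\<exists>x. R \<inter> m' = {x}" if "m' \<in> Mt - {m}" for m'
      using p2(2)[of m'] other(2)[of m' a] that am by auto
    then have tR: "transversal (Mt - {m}) R"
      using R unfolding transversal_def by simp
    have eR: "insert e R \<inter> m = {e}" using meq A by auto
    have "insert e R \<subseteq> ?U" using R p(3) by blast
    moreover have "\<exists>x. insert e R \<inter> m' = {x}" if "m' \<in> Mt" for m'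
      using eR p2(2)[OF that] other(1)[OF that _ m(2)] by (cases "m' = m") auto
    ultimately have "transversal Mt (insert e R)" unfolding transversal_def by blast
    moreover have pt: "partner e = a" "partner a = e"
      using partner[of a e] partner[of e a] m meq by (auto simp: insert_commute)
    moreover have "insert e A - {a} = insert e R" "insert a (insert e R) - {e} = A"
      using A am p(4) by auto
    ultimately have \<iota>: "\<iota> p = (insert e R, a)" "\<iota> (insert e R, a) = p"
      unfolding \<iota>_def p(1) by simp_all
    have "a \<in> ?U" "a \<notin> insert e R" using am m A by auto
    then have "\<iota> p \<in> P" using \<open>transversal Mt (insert e R)\<close> unfolding \<iota> P_def TS_def by simp
    moreover have "p = (insert a R, e)" using p A by simp
    ultimately show ?thesis using \<iota> A(2,3) meq m(1) tR by (intro exI[of _ R] exI[of _ a] exI[of _ e]) simp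
  qed
  have "(\<Sum>A\<in>TS. \<epsilon> A * bdry ?U \<sigma> b A) = (\<Sum>A\<in>TS. \<Sum>e\<in>?U - A. g (A, e))"
    by (simp add: bdry_def g_def sum_distrib_left)
  also have "\<dots> = sum g P" unfolding P_def by (subst sum.Sigma) (use finT finU in auto)
  also have "\<dots> = 0"
  proof (rule sum_involution_zero[where \<iota> = \<iota>])
    show "finite P" unfolding P_def using finT finU by auto
    fix p assume "p \<in> P"
    from P[OF this] obtain R a e where p: "p = (insert a R, e)" "{a, e} \<in> Mt" "a \<noteq> e" "a \<notin> R" "e \<notin> R"
      "transversal (Mt - {{a, e}}) R" "\<iota> p = (insert e R, a)" "\<iota> (\<iota> p) = p" "\<iota> p \<in> P"
      by (elim exE conjE)
    show "\<iota> p \<in> P" "\<iota> (\<iota> p) = p" "\<iota> p \<noteq> p" using p by auto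
    have "\<epsilon> (insert e R) * \<sigma> a (insert e R) = - (\<epsilon> (insert a R) * \<sigma> e (insert a R))"
      using \<epsilon>(2)[OF p(2,6)] by (simp add: eq_neg_iff_add_eq_0 add.commute)
    then show "g (\<iota> p) = - g p" unfolding p(7) unfolding p(1) g_def by (simp add: insert_commute flip: mult.assoc)
  qed
  finally have "(\<Sum>A\<in>TS. \<epsilon> A * bdry ?U \<sigma> b A) = 0" .
  moreover have "(\<Sum>A\<in>TS. \<epsilon> A * bdry ?U \<sigma> b A) = (\<Sum>A\<in>TS. if A = A0 then \<epsilon> A0 else 0)"
    by (rule sum.cong) (auto simp: TS_def b)
  ultimately have "\<epsilon> A0 = 0" using finT A0 by (simp add: TS_def sum.delta')
  then show False using \<epsilon>(1)[OF A0] by simp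
qed

section \<open>Complexes of monomial type\<close>

abbreviation "keys \<equiv> Poly_Mapping.keys"
abbreviation "lookup \<equiv> Poly_Mapping.lookup"
abbreviation "single \<equiv> Poly_Mapping.single"

lemma poly_mapping_sum_single:
  "p = (\<Sum>m\<in>keys p. single m (lookup p m))"
proof (rule poly_mapping_eqI)
  fix k
  have "lookup (\<Sum>m\<in>keys p. single m (lookup p m)) k
      = (\<Sum>m\<in>keys p. if m = k then lookup p m else 0)"
    by (simp add: lookup_sum lookup_single when_def)
  also have "\<dots> = lookup p k" by (simp add: sum.delta' in_keys_iff)
  finally show "lookup p k = lookup
      (\<Sum>m\<in>keys p. single m (lookup p m)) k" by simp
qed

text \<open>One truncation serves two purposes: normal forms modulo a monomial ideal, and
  homogeneous components.\<close>

definition filt :: "('a \<Rightarrow> bool) \<Rightarrow> ('a \<Rightarrow>\<^sub>0 'b::comm_monoid_add) \<Rightarrow> 'a \<Rightarrow>\<^sub>0 'b" where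
  "filt P p = (\<Sum>m | m \<in> keys p \<and> P m. single m (lookup p m))"

lemma lookup_filt: "lookup (filt P p) k = (if P k then lookup p k else 0)"
proof -
  have "lookup (filt P p) k =
      (\<Sum>m | m \<in> keys p \<and> P m. if m = k then lookup p m else 0)"
    by (simp add: filt_def lookup_sum lookup_single when_def)
  also have "\<dots> = (if P k then lookup p k else 0)" by (simp add: sum.delta' in_keys_iff)
  finally show ?thesis .
qed

lemma keys_filt: "keys (filt P p) = {m \<in> keys p. P m}"
  by (auto simp: in_keys_iff lookup_filt split: if_splits)

lemma filt_zero [simp]: "filt P 0 = 0"
  by (rule poly_mapping_eqI) (simp add: lookup_filt)

lemma filt_add: "filt P (p + q) = filt P p + filt P q"
  by (rule poly_mapping_eqI) (simp add: lookup_filt lookup_add)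

lemma filt_diff: "filt P (p - q) = filt P p - filt P (q :: 'a \<Rightarrow>\<^sub>0 'b::ab_group_add)"
  by (rule poly_mapping_eqI) (simp add: lookup_filt lookup_minus)

lemma filt_sum: "filt P (sum f A) = (\<Sum>x\<in>A. filt P (f x))"
  by (induction A rule: infinite_finite_induct) (auto simp: filt_add)

lemma filt_id: "(\<And>m. m \<in> keys p \<Longrightarrow> P m) \<Longrightarrow> filt P p = p"
  by (rule poly_mapping_eqI) (auto simp: lookup_filt in_keys_iff)

lemma filt_eq_0: "(\<And>m. m \<in> keys p \<Longrightarrow> \<not> P m) \<Longrightarrow> filt P p = 0"
  by (rule poly_mapping_eqI) (auto simp: lookup_filt in_keys_iff)

lemma filt_filt [simp]: "filt P (filt P p) = filt P p"
  by (rule poly_mapping_eqI) (simp add: lookup_filt)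

lemma filt_commute: "filt P (filt Q p) = filt Q (filt P p)"
  by (rule poly_mapping_eqI) (simp add: lookup_filt)

lemma lookup_single_mult:
  fixes p :: "'a::cancel_comm_monoid_add \<Rightarrow>\<^sub>0 'b::comm_semiring_0"
  shows "lookup (single \<mu> c * p) (\<mu> + \<nu>) = c * lookup p \<nu>"
    and "(\<And>\<nu>. k \<noteq> \<mu> + \<nu>) \<Longrightarrow> lookup (single \<mu> c * p) k = 0"
proof -
  have eq: "single \<mu> c * p =
      (\<Sum>m\<in>keys p. single (\<mu> + m) (c * lookup p m))"
    by (subst poly_mapping_sum_single[of p]) (simp add: sum_distrib_left mult_single)
  have "lookup (single \<mu> c * p) (\<mu> + \<nu>) =
      (\<Sum>m\<in>keys p. if m = \<nu> then c * lookup p m else 0)"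
    unfolding eq by (simp add: lookup_sum lookup_single when_def)
  also have "\<dots> = c * lookup p \<nu>" by (simp add: sum.delta' in_keys_iff)
  finally show "lookup (single \<mu> c * p) (\<mu> + \<nu>) = c * lookup p \<nu>" .
  assume k: "\<And>\<nu>. k \<noteq> \<mu> + \<nu>"
  show "lookup (single \<mu> c * p) k = 0"
    unfolding eq by (simp add: lookup_sum lookup_single when_def k[symmetric])
qed

lemma filt_single_mult:
  fixes p :: "'a::cancel_comm_monoid_add \<Rightarrow>\<^sub>0 'b::comm_semiring_0"
  assumes "\<And>\<nu>. P (\<mu> + \<nu>) \<longleftrightarrow> Q \<nu>"
  shows "filt P (single \<mu> c * p) = single \<mu> c * filt Q p"
proof (rule poly_mapping_eqI)
  fix k
  show "lookup (filt P (single \<mu> c * p)) k =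
      lookup (single \<mu> c * filt Q p) k"
  proof (cases "\<exists>\<nu>. k = \<mu> + \<nu>")
    case True
    then show ?thesis by (auto simp: lookup_filt lookup_single_mult assms)
  next
    case False
    then show ?thesis by (simp add: lookup_filt lookup_single_mult(2))
  qed
qed

lemma filt_mult:
  fixes p :: "'a::cancel_comm_monoid_add \<Rightarrow>\<^sub>0 'b::comm_semiring_0"
  assumes "\<And>\<mu> \<nu>. \<mu> \<in> keys a \<Longrightarrow> P (\<mu> + \<nu>) \<longleftrightarrow> Q \<nu>"
  shows "filt P (a * p) = a * filt Q p"
proof -
  let ?a = "\<Sum>m\<in>keys a. single m (lookup a m)"
  have "filt P (?a * p) = ?a * filt Q p"
    unfolding sum_distrib_right filt_sum
    by (intro sum.cong refl filt_single_mult assms)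
  then show ?thesis by (simp flip: poly_mapping_sum_single)
qed

lemma const_coeff_sum: "const_coeff (sum f A) = (\<Sum>x\<in>A. const_coeff (f x))"
  by (simp add: const_coeff_def lookup_sum)

lemma nat_monomial_add_eq_0:
  fixes \<mu> \<nu> :: "'v \<Rightarrow>\<^sub>0 nat" shows "\<mu> + \<nu> = 0 \<longleftrightarrow> \<mu> = 0 \<and> \<nu> = 0"
  by (auto simp: poly_mapping_eq_iff fun_eq_iff lookup_add)

lemma const_coeff_single_mult:
  "const_coeff (single \<mu> c * p) = (if \<mu> = 0 then c * const_coeff p else 0)"
  unfolding const_coeff_def
proof (cases "\<mu> = 0")
  case True
  then show "lookup (single \<mu> c * p) 0 = (if \<mu> = 0 then c * lookup p 0 else 0)"
    using lookup_single_mult(1)[of 0 c p 0] by simp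
next
  case False
  then show "lookup (single \<mu> c * p) 0 = (if \<mu> = 0 then c * lookup p 0 else 0)"
    by (metis lookup_single_mult(2) nat_monomial_add_eq_0)
qed

lemma const_coeff_mult: "const_coeff (a * p) = const_coeff a * const_coeff p"
proof -
  let ?a = "\<Sum>m\<in>keys a. single m (lookup a m)"
  have "const_coeff (?a * p) = (\<Sum>m\<in>keys a. if m = 0 then lookup a m * const_coeff p else 0)"
    unfolding sum_distrib_right const_coeff_sum const_coeff_single_mult ..
  also have "\<dots> = const_coeff a * const_coeff p"
    by (simp add: sum.delta const_coeff_def in_keys_iff)
  finally show ?thesis by (simp flip: poly_mapping_sum_single)
qed

section \<open>Squarefree monomials and degrees\<close>

definition sqf :: "'v set \<Rightarrow> 'v \<Rightarrow>\<^sub>0 nat" where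
  "sqf U = (\<Sum>u\<in>U. single u 1)"

lemma lookup_sqf: "finite U \<Longrightarrow> lookup (sqf U) u = (if u \<in> U then 1 else 0)"
  by (simp add: sqf_def lookup_sum lookup_single when_def sum.delta')

lemma keys_sqf [simp]: "finite U \<Longrightarrow> keys (sqf U) = U"
  by (auto simp: in_keys_iff lookup_sqf split: if_splits)

lemma sqf_empty [simp]: "sqf {} = 0" by (simp add: sqf_def)

lemma sqf_single [simp]: "sqf {u} = single u 1" by (simp add: sqf_def)

lemma keys_add_nat: "keys (\<mu> + \<nu> :: 'v \<Rightarrow>\<^sub>0 nat) = keys \<mu> \<union> keys \<nu>"
  by (auto simp: in_keys_iff lookup_add)

lemma diff_sqf_add:
  assumes "finite U" "U \<subseteq> keys \<alpha>" shows "\<alpha> - sqf U + sqf U = \<alpha>"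
proof (rule poly_mapping_eqI)
  fix u
  show "lookup (\<alpha> - sqf U + sqf U) u = lookup \<alpha> u"
    using assms by (auto simp: lookup_add lookup_minus lookup_sqf in_keys_iff subset_iff Suc_le_eq)
qed

lemma mon_degree_eq:
  "finite S \<Longrightarrow> keys m \<subseteq> S \<Longrightarrow> mon_degree m = (\<Sum>u\<in>S. lookup m u)"
  unfolding mon_degree_def by (rule sum.mono_neutral_left) (auto simp: in_keys_iff)

lemma mon_degree_add [simp]: "mon_degree (\<mu> + \<nu>) = mon_degree \<mu> + mon_degree \<nu>"
  unfolding mon_degree_eq[of "keys \<mu> \<union> keys \<nu>" \<mu>, OF _ Un_upper1, simplified]
    mon_degree_eq[of "keys \<mu> \<union> keys \<nu>" \<nu>, OF _ Un_upper2, simplified]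
  by (subst mon_degree_eq[of "keys \<mu> \<union> keys \<nu>"])
    (auto simp: keys_add_nat lookup_add sum.distrib)

lemma mon_degree_sqf [simp]: "finite U \<Longrightarrow> mon_degree (sqf U) = card U"
  by (simp add: mon_degree_def lookup_sqf)

lemma mon_degree_zero [simp]: "mon_degree 0 = 0"
  by (simp add: mon_degree_def)

lemma alt_sign_mono: "alt_sign E \<sigma> \<Longrightarrow> E' \<subseteq> E \<Longrightarrow> alt_sign E' \<sigma>"
  using alt_sign_shift[of E \<sigma> E' "{}"] by simp

text \<open>A complex of free modules over a polynomial ring modulo a monomial ideal: the basis consists of
  the sets \<open>T \<subseteq> E\<close>, with \<open>T\<close> in the multidegree of the squarefree monomial with support
  \<open>L T\<close>, and \<open>Nf\<close> selects the monomials outside the ideal. It specialises to the Koszul complexes of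
  the ring and of a quotient, and to the Taylor resolution. The strand of multidegree \<open>\<alpha>\<close> is a
  simplicial chain complex on the generators \<open>Ea \<alpha>\<close> dividing \<open>\<alpha>\<close>.\<close>

locale monomial_complex =
  fixes E :: "'e set" and m :: "'e \<Rightarrow> 'v set" and \<sigma> :: "'e \<Rightarrow> 'e set \<Rightarrow> 'k::field"
    and Nf :: "('v \<Rightarrow>\<^sub>0 nat) \<Rightarrow> bool"
  assumes finE: "finite E" and fin_m: "\<And>e. e \<in> E \<Longrightarrow> finite (m e)" and \<sigma>: "alt_sign E \<sigma>"
    and Nf: "\<And>\<mu> \<nu>. Nf (\<mu> + \<nu>) \<Longrightarrow> Nf \<nu>"
begin

definition L :: "'e set \<Rightarrow> 'v set" where "L T = \<Union>(m ` T)"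

text \<open>The monomial factor is the quotient of two least common multiples, as in the Taylor
  complex. If the generators are the variables it is the added variable itself, as in the Koszul
  complex.\<close>

definition bd :: "('e set \<Rightarrow> ('v, 'k) mpoly) \<Rightarrow> 'e set \<Rightarrow> ('v, 'k) mpoly" where
  "bd s T = (\<Sum>e\<in>E - T. filt Nf (single (sqf (L (insert e T) - L T)) (\<sigma> e T) * s (insert e T)))"

definition Ea :: "('v \<Rightarrow>\<^sub>0 nat) \<Rightarrow> 'e set" where "Ea \<alpha> = {e\<in>E. m e \<subseteq> keys \<alpha>}"

text \<open>The second condition says that the coefficient monomial that \<open>T\<close> carries in
  multidegree \<alpha> survives in the quotient. Subtraction of exponents is truncated, but exact
  here since all generators in \<open>T\<close> divide \<alpha>.\<close>

definition face :: "('v \<Rightarrow>\<^sub>0 nat) \<Rightarrow> 'e set \<Rightarrow> bool" where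
  "face \<alpha> T \<longleftrightarrow> T \<subseteq> Ea \<alpha> \<and> Nf (\<alpha> - sqf (L T))"

text \<open>The guard is needed because exponents are subtracted with truncation: without it, a set
  whose monomial does not divide \<alpha> would contribute an unrelated coefficient.\<close>

definition strand :: "('v \<Rightarrow>\<^sub>0 nat) \<Rightarrow> ('e set \<Rightarrow> ('v, 'k) mpoly) \<Rightarrow> 'e set \<Rightarrow> 'k" where
  "strand \<alpha> s T = (if L T \<subseteq> keys \<alpha> then lookup (s T) (\<alpha> - sqf (L T)) else 0)"

lemma finL: "T \<subseteq> E \<Longrightarrow> finite (L T)"
  unfolding L_def using finE fin_m finite_subset by blast

lemma L_insert: "L (insert e T) = m e \<union> L T" by (simp add: L_def)

lemma Ea: "Ea \<alpha> \<subseteq> E" "finite (Ea \<alpha>)" "alt_sign (Ea \<alpha>) \<sigma>"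
  using finE alt_sign_mono[OF \<sigma>] by (auto simp: Ea_def)

lemma face_L: assumes "face \<alpha> T" shows "L T \<subseteq> keys \<alpha>" "T \<subseteq> E" "finite (L T)" "finite T"
proof -
  show "T \<subseteq> E" using assms Ea(1) by (auto simp: face_def)
  then show "finite (L T)" "finite T" using finL finE finite_subset by auto
  show "L T \<subseteq> keys \<alpha>" using assms by (auto simp: face_def L_def Ea_def)
qed

lemma diff_L_insert:
  assumes "e \<in> E" "T \<subseteq> E" "L (insert e T) \<subseteq> keys \<alpha>"
  shows "\<alpha> - sqf (L T) = sqf (L (insert e T) - L T) + (\<alpha> - sqf (L (insert e T)))"
proof (rule poly_mapping_eqI)
  fix u
  have "finite (L T)" "finite (L (insert e T))" using assms finL by auto
  moreover have "L T \<subseteq> L (insert e T)" by (auto simp: L_insert)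
  moreover have "u \<in> L (insert e T) \<Longrightarrow> lookup \<alpha> u > 0" using assms(3) by (auto simp: in_keys_iff)
  ultimately show "lookup (\<alpha> - sqf (L T)) u =
      lookup (sqf (L (insert e T) - L T) + (\<alpha> - sqf (L (insert e T)))) u"
    by (auto simp: lookup_add lookup_minus lookup_sqf)
qed

text \<open>Enlarging \<open>T\<close> replaces the coefficient monomial by a divisor, and divisors
  of monomials outside a monomial ideal are outside as well.\<close>

lemma face_insert: assumes "face \<alpha> T" "e \<in> Ea \<alpha>" shows "face \<alpha> (insert e T)"
proof -
  have "L (insert e T) \<subseteq> keys \<alpha>" using face_L(1)[OF assms(1)] assms(2) by (auto simp: L_insert Ea_def)
  moreover have "e \<in> E" using assms Ea(1) by blast
  ultimately have "Nf (\<alpha> - sqf (L (insert e T)))"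
    using diff_L_insert[OF _ face_L(2)[OF assms(1)]] assms(1) Nf unfolding face_def by metis
  then show ?thesis using assms by (simp add: face_def)
qed

text \<open>The differential is multigraded, so in each multidegree it reduces to a simplicial
  boundary with coefficients in the field.\<close>

lemma strand_bd:
  assumes f: "face \<alpha> T" shows "strand \<alpha> (bd s) T = bdry (Ea \<alpha>) \<sigma> (strand \<alpha> s) T"
proof -
  note LT = face_L[OF f]
  have tm: "lookup (filt Nf (single (sqf (L (insert e T) - L T)) (\<sigma> e T) * s (insert e T)))
      (\<alpha> - sqf (L T)) = (if m e \<subseteq> keys \<alpha> then \<sigma> e T * strand \<alpha> s (insert e T) else 0)" if e: "e \<in> E - T" for e
  proof (cases "m e \<subseteq> keys \<alpha>")
    case True
    then have Le: "L (insert e T) \<subseteq> keys \<alpha>" using LT by (auto simp: L_insert)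
    have "Nf (\<alpha> - sqf (L T))" using f by (simp add: face_def)
    then show ?thesis
      using diff_L_insert[OF _ LT(2) Le] e True Le by (simp add: lookup_filt lookup_single_mult strand_def)
  next
    case False
    \<comment> \<open>A variable of \<open>m e\<close> outside the support of \<alpha> is not in
      \<open>L T\<close> either; it divides the factor of this term, but not the monomial on the
      left.\<close>
    have "\<alpha> - sqf (L T) \<noteq> sqf (L (insert e T) - L T) + \<nu>" for \<nu>
    proof
      assume a: "\<alpha> - sqf (L T) = sqf (L (insert e T) - L T) + \<nu>"
      obtain u where u: "u \<in> m e" "u \<notin> keys \<alpha>" using False by blast
      then have "u \<notin> L T" using LT by blast
      moreover have "finite (L (insert e T))" using e LT finL by simp
      ultimately have "lookup (\<alpha> - sqf (L T)) u = 0"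
        "lookup (sqf (L (insert e T) - L T) + \<nu>) u \<noteq> 0"
        using u by (simp_all add: lookup_add lookup_minus lookup_sqf L_insert in_keys_iff)
      then show False using a by simp
    qed
    then show ?thesis using False by (simp add: lookup_filt lookup_single_mult(2))
  qed
  have "strand \<alpha> (bd s) T = (\<Sum>e\<in>E - T. if m e \<subseteq> keys \<alpha> then \<sigma> e T * strand \<alpha> s (insert e T) else 0)"
    using LT by (simp add: strand_def bd_def lookup_sum tm)
  also have "\<dots> = (\<Sum>e\<in>Ea \<alpha> - T. \<sigma> e T * strand \<alpha> s (insert e T))"
    by (rule sum.mono_neutral_cong_right) (auto simp: Ea_def finE)
  finally show ?thesis by (simp add: bdry_def)
qed

text \<open>A monomial \<nu> at \<open>T\<close> lives in exactly one multidegree. This turns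
  identities between strands into identities between polynomials.\<close>

lemma face_lookup:
  assumes "T \<subseteq> E" "Nf \<nu>"
  shows "face (\<nu> + sqf (L T)) T" "strand (\<nu> + sqf (L T)) s T = lookup (s T) \<nu>"
  using finL[OF assms(1)] assms by (auto simp: face_def strand_def Ea_def keys_add_nat L_def)

lemma lookup_bd_Nf: "\<not> Nf \<nu> \<Longrightarrow> lookup (bd s T) \<nu> = 0"
  by (simp add: bd_def lookup_sum lookup_filt)

lemma bd_support: "(\<And>T. s T \<noteq> 0 \<Longrightarrow> T \<subseteq> E) \<Longrightarrow> \<not> T \<subseteq> E \<Longrightarrow> bd s T = 0"
  unfolding bd_def by (rule sum.neutral) (metis filt_zero insert_subset mult_zero_right)

lemma bd_bd:
  assumes "\<And>T. s T \<noteq> 0 \<Longrightarrow> T \<subseteq> E" shows "bd (bd s) T = 0"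
proof (cases "T \<subseteq> E")
  case True
  show ?thesis
  proof (rule poly_mapping_eqI)
    fix \<nu>
    show "lookup (bd (bd s) T) \<nu> = lookup 0 \<nu>"
    proof (cases "Nf \<nu>")
      case Nf': True
      define \<alpha> where "\<alpha> = \<nu> + sqf (L T)"
      have f: "face \<alpha> T" using face_lookup[OF True Nf'] by (simp add: \<alpha>_def)
      have "lookup (bd (bd s) T) \<nu> = strand \<alpha> (bd (bd s)) T"
        using face_lookup[OF True Nf'] by (simp add: \<alpha>_def)
      also have "\<dots> = bdry (Ea \<alpha>) \<sigma> (strand \<alpha> (bd s)) T" by (rule strand_bd[OF f])
      also have "\<dots> = bdry (Ea \<alpha>) \<sigma> (bdry (Ea \<alpha>) \<sigma> (strand \<alpha> s)) T"
        unfolding bdry_def[of _ _ _ T] by (intro sum.cong) (auto simp: strand_bd face_insert f)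
      also have "\<dots> = 0" using f by (intro bdry_bdry Ea) (simp add: face_def)
      finally show ?thesis by simp
    qed (simp add: lookup_bd_Nf)
  qed
next
  case False
  show ?thesis by (rule bd_support[OF _ False]) (metis bd_support[OF assms])
qed

definition mdegs :: "('e set \<Rightarrow> ('v, 'k) mpoly) \<Rightarrow> ('v \<Rightarrow>\<^sub>0 nat) set" where
  "mdegs s = (\<Union>T\<in>Pow E. (\<lambda>\<nu>. \<nu> + sqf (L T)) ` keys (s T))"

lemma finite_mdegs: "finite (mdegs s)"
  unfolding mdegs_def using finE by auto

text \<open>The equation is solved separately in the finitely many multidegrees of \<open>s\<close>,
  and the solutions are added up. That \<open>t\<close> has no other multidegrees is recorded
  because it later shows which variables and degrees occur in \<open>t\<close>.\<close>

lemma exact_lift: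
  assumes s0: "\<And>T. s T \<noteq> 0 \<Longrightarrow> T \<subseteq> E \<and> card T = n"
    and sNf: "\<And>T \<nu>. \<nu> \<in> keys (s T) \<Longrightarrow> Nf \<nu>"
    and ex: "\<And>\<alpha>. \<alpha> \<in> mdegs s \<Longrightarrow> \<exists>b. \<forall>T. face \<alpha> T \<longrightarrow> card T = n \<longrightarrow> bdry (Ea \<alpha>) \<sigma> b T = strand \<alpha> s T"
  obtains t where "\<And>T. t T \<noteq> 0 \<Longrightarrow> T \<subseteq> E \<and> card T = Suc n"
    and "\<And>T \<nu>. \<nu> \<in> keys (t T) \<Longrightarrow> Nf \<nu> \<and> \<nu> + sqf (L T) \<in> mdegs s"
    and "bd t = s"
proof -
  obtain b where b: "\<And>\<alpha> T. \<alpha> \<in> mdegs s \<Longrightarrow> face \<alpha> T \<Longrightarrow> card T = n \<Longrightarrow> bdry (Ea \<alpha>) \<sigma> (b \<alpha>) T = strand \<alpha> s T"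
    using ex by metis
  define t where "t T = (if T \<subseteq> E \<and> card T = Suc n
    then \<Sum>\<alpha>\<in>mdegs s. if face \<alpha> T then single (\<alpha> - sqf (L T)) (b \<alpha> T) else 0 else 0)" for T
  have t: "lookup (t T) \<nu> = (if \<nu> + sqf (L T) \<in> mdegs s \<and> Nf \<nu> then b (\<nu> + sqf (L T)) T else 0)"
    if T: "T \<subseteq> E" "card T = Suc n" for T \<nu>
  proof -
    have "face \<alpha> T \<and> \<alpha> - sqf (L T) = \<nu> \<longleftrightarrow> \<alpha> = \<nu> + sqf (L T) \<and> Nf \<nu>" for \<alpha>
    proof
      assume a: "face \<alpha> T \<and> \<alpha> - sqf (L T) = \<nu>"
      then show "\<alpha> = \<nu> + sqf (L T) \<and> Nf \<nu>"
        using diff_sqf_add[OF face_L(3,1)[of \<alpha> T]] by (auto simp: face_def)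
    next
      assume "\<alpha> = \<nu> + sqf (L T) \<and> Nf \<nu>"
      then show "face \<alpha> T \<and> \<alpha> - sqf (L T) = \<nu>" using face_lookup(1)[OF T(1)] by simp
    qed
    then have "lookup (if face \<alpha> T then single (\<alpha> - sqf (L T)) (b \<alpha> T) else 0) \<nu> =
        (if \<alpha> = \<nu> + sqf (L T) then if Nf \<nu> then b \<alpha> T else 0 else 0)" for \<alpha>
      by (smt (verit) lookup_single lookup_zero when_def)
    then show ?thesis using finite_mdegs T by (simp add: t_def lookup_sum sum.delta)
  qed
  show ?thesis
  proof (rule that)
    show t0: "T \<subseteq> E \<and> card T = Suc n" if "t T \<noteq> 0" for T using that unfolding t_def by presburger
    show "Nf \<nu> \<and> \<nu> + sqf (L T) \<in> mdegs s" if "\<nu> \<in> keys (t T)" for T \<nu>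
    proof -
      have "t T \<noteq> 0" using that by auto
      then show ?thesis using t0[of T] t[of T \<nu>] that by (auto simp: in_keys_iff split: if_splits)
    qed
    show "bd t = s"
    proof (rule ext)
      fix T
      show "bd t T = s T"
      proof (cases "T \<subseteq> E \<and> card T = n")
        case False
        then have "t (insert e T) = 0" if "e \<in> E - T" for e
          using t0[of "insert e T"] that finE finite_subset by fastforce
        then have "bd t T = 0" unfolding bd_def by (intro sum.neutral) simp
        then show ?thesis using s0 False by metis
      next
        case True
        show ?thesis
        proof (rule poly_mapping_eqI)
          fix \<nu>
          show "lookup (bd t T) \<nu> = lookup (s T) \<nu>"
          proof (cases "Nf \<nu>")
            case False
            then show ?thesis using sNf[of \<nu> T] by (metis lookup_bd_Nf in_keys_iff)
          next
            case Nf': True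
            define \<alpha> where "\<alpha> = \<nu> + sqf (L T)"
            note fl = face_lookup[OF conjunct1[OF True] Nf', folded \<alpha>_def]
            have st: "strand \<alpha> t (insert e T) = (if \<alpha> \<in> mdegs s then b \<alpha> (insert e T) else 0)"
              if e: "e \<in> Ea \<alpha> - T" for e
            proof -
              have f: "face \<alpha> (insert e T)" using face_insert[OF fl(1)] e by blast
              note fL = face_L[OF f]
              have "card (insert e T) = Suc n" using True e face_L(4)[OF fl(1)] by simp
              moreover have "Nf (\<alpha> - sqf (L (insert e T)))" using f by (simp add: face_def)
              ultimately show ?thesis
                using t[OF fL(2)] diff_sqf_add[OF fL(3,1)] fL(1) by (simp add: strand_def)
            qed
            have "lookup (bd t T) \<nu> = bdry (Ea \<alpha>) \<sigma> (strand \<alpha> t) T"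
              using fl strand_bd by metis
            also have "\<dots> = (if \<alpha> \<in> mdegs s then bdry (Ea \<alpha>) \<sigma> (b \<alpha>) T else 0)"
              by (simp add: bdry_def st)
            also have "\<dots> = (if \<alpha> \<in> mdegs s then strand \<alpha> s T else 0)" using b fl(1) True by simp
            also have "\<dots> = lookup (s T) \<nu>"
            proof (cases "\<alpha> \<in> mdegs s")
              case False
              then have "\<nu> \<notin> keys (s T)" using True by (auto simp: mdegs_def \<alpha>_def)
              then show ?thesis using False by (simp add: in_keys_iff)
            qed (simp add: fl)
            finally show ?thesis .
          qed
        qed
      qed
    qed
  qed
qed

lemma strand_cycle: "bd s = (\<lambda>T. 0) \<Longrightarrow> face \<alpha> T \<Longrightarrow> bdry (Ea \<alpha>) \<sigma> (strand \<alpha> s) T = 0"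
  using strand_bd[of \<alpha> T s] by (simp add: strand_def split: if_splits)

text \<open>The generator \<open>e0\<close> is to be a cone point of the strand. Only removal of
  \<open>e0\<close> has to be assumed, as faces may always be enlarged.\<close>

lemma exact_cone:
  assumes s0: "\<And>T. s T \<noteq> 0 \<Longrightarrow> T \<subseteq> E \<and> card T = n"
    and sNf: "\<And>T \<nu>. \<nu> \<in> keys (s T) \<Longrightarrow> Nf \<nu>"
    and cyc: "bd s = (\<lambda>T. 0)"
    and cone: "\<And>\<alpha>. \<alpha> \<in> mdegs s \<Longrightarrow> \<exists>e0\<in>Ea \<alpha>. \<forall>T. T \<subseteq> Ea \<alpha> \<longrightarrow> e0 \<notin> T \<longrightarrow> face \<alpha> (insert e0 T) \<longrightarrow> face \<alpha> T"
  obtains t where "\<And>T. t T \<noteq> 0 \<Longrightarrow> T \<subseteq> E \<and> card T = Suc n"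
    and "\<And>T \<nu>. \<nu> \<in> keys (t T) \<Longrightarrow> Nf \<nu> \<and> \<nu> + sqf (L T) \<in> mdegs s"
    and "bd t = s"
proof (rule exact_lift[OF s0 sNf])
  fix \<alpha> assume "\<alpha> \<in> mdegs s"
  then obtain e0 where e0: "e0 \<in> Ea \<alpha>" "\<And>T. T \<subseteq> Ea \<alpha> \<Longrightarrow> e0 \<notin> T \<Longrightarrow> face \<alpha> (insert e0 T) \<Longrightarrow> face \<alpha> T"
    using cone by blast
  have "\<exists>b. \<forall>T. T \<subseteq> Ea \<alpha> \<longrightarrow> face \<alpha> T \<longrightarrow> card T = n \<longrightarrow> bdry (Ea \<alpha>) \<sigma> b T = strand \<alpha> s T"
    by (rule cone_exact[OF Ea(2,3) e0(1)]) (auto intro: e0 face_insert strand_cycle[OF cyc])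
  then show "\<exists>b. \<forall>T. face \<alpha> T \<longrightarrow> card T = n \<longrightarrow> bdry (Ea \<alpha>) \<sigma> b T = strand \<alpha> s T"
    by (auto simp: face_def)
qed (use that in blast)+

end

section \<open>Quotients by edge ideals\<close>

abbreviation PR :: "'v set \<Rightarrow> ('v, 'k::field) mpoly set" where "PR V \<equiv> carrier (poly_ring V)"

lemma PR_iff: "p \<in> PR V \<longleftrightarrow> (\<forall>m\<in>keys p. keys m \<subseteq> V)"
  by (simp add: poly_ring_def)

lemma PR_zero [simp]: "0 \<in> PR V" by (simp add: PR_iff)

lemma PR_one [simp]: "1 \<in> PR V" by (simp add: PR_iff)

lemma PR_add: "p \<in> PR V \<Longrightarrow> q \<in> PR V \<Longrightarrow> p + q \<in> PR V"
  unfolding PR_iff using keys_add[of p q] by blast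

lemma keys_diff_subset: "keys (p - q) \<subseteq> keys p \<union> keys (q :: 'a \<Rightarrow>\<^sub>0 'b::ab_group_add)"
  by (auto simp: in_keys_iff lookup_minus)

lemma PR_diff: "p \<in> PR V \<Longrightarrow> q \<in> PR V \<Longrightarrow> p - q \<in> PR V"
  unfolding PR_iff using keys_diff_subset[of p q] by blast

lemma PR_neg: "p \<in> PR V \<Longrightarrow> - p \<in> PR V"
  using PR_diff[of 0 V p] by simp

lemma PR_mult: "p \<in> PR V \<Longrightarrow> q \<in> PR V \<Longrightarrow> p * q \<in> PR V"
  unfolding PR_iff using keys_mult[of p q] by (fastforce simp: keys_add_nat)

lemma PR_sum: "(\<And>x. x \<in> A \<Longrightarrow> f x \<in> PR V) \<Longrightarrow> sum f A \<in> PR V"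
  by (induction A rule: infinite_finite_induct) (auto simp: PR_add)

lemma PR_filt: "p \<in> PR V \<Longrightarrow> filt P p \<in> PR V"
  by (simp add: PR_iff keys_filt)

lemma PR_single: "keys m \<subseteq> V \<Longrightarrow> single m c \<in> PR V"
  by (simp add: PR_iff)

lemma homogeneous_zero [simp]: "homogeneous n 0" by (simp add: homogeneous_def)

lemma homogeneous_diff: "homogeneous n p \<Longrightarrow> homogeneous n q \<Longrightarrow> homogeneous n (p - q)"
  unfolding homogeneous_def using keys_diff_subset[of p q] by blast

lemma homogeneous_add: "homogeneous n p \<Longrightarrow> homogeneous n q \<Longrightarrow> homogeneous n (p + q)"
  unfolding homogeneous_def using keys_add[of p q] by blast

lemma homogeneous_sum: "(\<And>x. x \<in> A \<Longrightarrow> homogeneous n (f x)) \<Longrightarrow> homogeneous n (sum f A)"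
  by (induction A rule: infinite_finite_induct) (auto simp: homogeneous_add)

lemma homogeneous_mult: "homogeneous m p \<Longrightarrow> homogeneous n q \<Longrightarrow> homogeneous (m + n) (p * q)"
  unfolding homogeneous_def using keys_mult[of p q] by fastforce

lemma homogeneous_filt: "homogeneous n p \<Longrightarrow> homogeneous n (filt P p)"
  by (simp add: homogeneous_def keys_filt)

lemma homogeneous_single: "int (mon_degree m) = n \<Longrightarrow> homogeneous n (single m c)"
  by (simp add: homogeneous_def)

definition hom_part :: "int \<Rightarrow> ('v, 'k::field) mpoly \<Rightarrow> ('v, 'k) mpoly" where
  "hom_part n = filt (\<lambda>m. int (mon_degree m) = n)"

lemma homogeneous_hom_part: "homogeneous n (hom_part n p)"
  by (simp add: homogeneous_def hom_part_def keys_filt)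

lemma hom_part_id: "homogeneous n p \<Longrightarrow> hom_part n p = p"
  unfolding hom_part_def homogeneous_def by (rule filt_id) auto

lemma hom_part_mult: "homogeneous m a \<Longrightarrow> hom_part n (a * p) = a * hom_part (n - m) p"
  unfolding hom_part_def homogeneous_def by (rule filt_mult) auto

lemma poly_ring_simps [simp]:
  "mult (poly_ring V) = (*)" "one (poly_ring V) = 1" "zero (poly_ring V) = 0" "add (poly_ring V) = (+)"
  by (simp_all add: poly_ring_def)

lemma cring_poly_ring: "cring (poly_ring V :: ('v, 'k::field) mpoly ring)"
proof (rule cringI)
  show "abelian_group (poly_ring V :: ('v, 'k) mpoly ring)"
  proof (rule abelian_groupI)
    fix x :: "('v, 'k) mpoly" assume "x \<in> carrier (poly_ring V)"
    then show "\<exists>y\<in>carrier (poly_ring V). y \<oplus>\<^bsub>poly_ring V\<^esub> x = \<zero>\<^bsub>poly_ring V\<^esub>"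
      by (intro bexI[of _ "- x"] PR_neg) auto
  qed (auto simp: PR_add ac_simps)
  show "comm_monoid (poly_ring V :: ('v, 'k) mpoly ring)"
    by (rule comm_monoidI) (auto simp: PR_mult ac_simps)
qed (auto simp: algebra_simps)

interpretation PR: cring "poly_ring V" for V by (rule cring_poly_ring)

lemma PR_uminus: "x \<in> PR V \<Longrightarrow> \<ominus>\<^bsub>poly_ring V\<^esub> x = - x"
  by (rule PR.minus_equality) (auto intro: PR_neg)

lemma PR_minus: "x \<in> PR V \<Longrightarrow> y \<in> PR V \<Longrightarrow> x \<ominus>\<^bsub>poly_ring V\<^esub> y = x - y"
  by (simp add: a_minus_def PR_uminus)

lemma PR_finsum: fixes n :: nat shows "(\<And>q. q < n \<Longrightarrow> f q \<in> PR V) \<Longrightarrow> finsum (poly_ring V) f {..<n} = (\<Sum>q<n. f q)"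
proof (induction n)
  case 0 then show ?case by (simp add: PR.finsum_0)
next
  case (Suc n)
  then show ?case unfolding lessThan_Suc by (subst PR.finsum_insert) (auto simp: add.commute)
qed

section \<open>Normal forms modulo the edge ideal\<close>

locale edge_quotient =
  fixes V :: "'v set" and Ed :: "'v set set" and K :: "'k::field itself"
  assumes finV: "finite V" and Ed: "\<And>e. e \<in> Ed \<Longrightarrow> e \<subseteq> V \<and> card e = 2"
begin

text \<open>The standard monomials, those outside the edge ideal: such an ideal is squarefree, so
  only the support counts.\<close>

definition Nf :: "('v \<Rightarrow>\<^sub>0 nat) \<Rightarrow> bool" where "Nf \<mu> \<longleftrightarrow> indep Ed (keys \<mu>)"

lemma Nf_add: "Nf (\<mu> + \<nu>) \<Longrightarrow> Nf \<nu>" "Nf (\<mu> + \<nu>) \<Longrightarrow> Nf \<mu>"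
  unfolding Nf_def keys_add_nat by (auto intro: indep_mono)

abbreviation R :: "('v, 'k) mpoly ring" where "R \<equiv> poly_ring V"
abbreviation nf :: "('v, 'k) mpoly \<Rightarrow> ('v, 'k) mpoly" where "nf \<equiv> filt Nf"

definition I :: "('v, 'k) mpoly set" where "I = edge_ideal (V, Ed)"
definition SI :: "(('v, 'k) mpoly, ('v, 'k) mpoly set) module" where "SI = quotient_module R I"

text \<open>Multiples of nonstandard monomials are nonstandard, so reducing a factor beforehand does
  not change the reduced product.\<close>

lemma nf_mult_nf: "nf (a * nf p) = nf (a * p)"
proof -
  have "nf (a * (p - nf p)) = 0"
  proof (rule filt_eq_0)
    fix m assume "m \<in> keys (a * (p - nf p))"
    then obtain x y where "m = x + y" "y \<in> keys (p - nf p)" using keys_mult by blast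
    then have "m = x + y" "\<not> Nf y" by (auto simp: in_keys_iff lookup_minus lookup_filt split: if_splits)
    then show "\<not> Nf m" using Nf_add by blast
  qed
  then show ?thesis by (simp add: right_diff_distrib filt_diff)
qed

lemma nf_mult_eq_0: "nf p = 0 \<Longrightarrow> nf (a * p) = 0" "nf p = 0 \<Longrightarrow> nf (p * a) = 0"
  using nf_mult_nf[of a p] by (simp_all add: mult.commute)

lemma finEd: "finite Ed" using finite_subset[of Ed "Pow V"] finV Ed by blast

lemma ideal_nf: "ideal {p \<in> PR V. nf p = 0} R"
proof (rule idealI)
  show "ring R" by (rule PR.ring_axioms)
  show "subgroup {p \<in> PR V. nf p = 0} (add_monoid R)"
  proof
    fix x assume x: "x \<in> {p \<in> PR V. nf p = 0}"
    then have "inv\<^bsub>add_monoid R\<^esub> x = - x" using PR_uminus[of x V] by (simp add: a_inv_def)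
    then show "inv\<^bsub>add_monoid R\<^esub> x \<in> {p \<in> PR V. nf p = 0}"
      using x filt_diff[of Nf 0 x] by (simp add: PR_neg)
  qed (auto simp: PR_add filt_add)
qed (auto simp: PR_mult nf_mult_eq_0)

text \<open>A monomial ideal is spanned by the monomials it contains, and a monomial with an edge in
  its support is a multiple of the generator of that edge. This trades the generated ideal for a
  condition on supports.\<close>

lemma I_eq: "I = {p \<in> PR V. nf p = 0}"
proof
  let ?G = "{var u * var v | u v. {u, v} \<in> Ed} :: ('v, 'k) mpoly set"
  have var: "var u * var v = (single (sqf {u, v}) 1 :: ('v, 'k) mpoly)" if "{u, v} \<in> Ed" for u v
  proof -
    have "u \<noteq> v" using Ed[OF that] by auto
    then have "sqf {u, v} = single u 1 + single v 1" by (simp add: sqf_def)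
    then show ?thesis by (simp add: var_def mult_single)
  qed
  have G: "?G \<subseteq> PR V"
  proof
    fix p :: "('v, 'k) mpoly" assume "p \<in> ?G"
    then obtain u v where "p = var u * var v" "{u, v} \<in> Ed" by blast
    then show "p \<in> PR V" using var Ed[of "{u, v}"] by (auto intro!: PR_single)
  qed
  have I: "I = Idl\<^bsub>R\<^esub> ?G" by (simp add: I_def edge_ideal_def)
  show "I \<subseteq> {p \<in> PR V. nf p = 0}"
    unfolding I
  proof (rule PR.genideal_minimal[OF ideal_nf])
    show "?G \<subseteq> {p \<in> PR V. nf p = 0}"
    proof
      fix p :: "('v, 'k) mpoly" assume p: "p \<in> ?G"
      then obtain u v where uv: "p = var u * var v" "{u, v} \<in> Ed" by blast
      have "nf p = 0"
        unfolding uv(1) var[OF uv(2)] using uv(2) by (intro filt_eq_0) (auto simp: Nf_def indep_def)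
      then show "p \<in> {p \<in> PR V. nf p = 0}" using p G by blast
    qed
  qed
  interpret I: ideal I R unfolding I by (rule PR.genideal_ideal[OF G])
  have sum_I: "sum f A \<in> I" if "\<And>x. x \<in> A \<Longrightarrow> f x \<in> I" for f and A :: "('v \<Rightarrow>\<^sub>0 nat) set"
    using that
  proof (induction A rule: infinite_finite_induct)
    case (insert x F)
    then show ?case using I.a_closed[of "f x" "sum f F"] by simp
  qed (use I.zero_closed in auto)
  show "{p \<in> PR V. nf p = 0} \<subseteq> I"
  proof clarify
    fix p :: "('v, 'k) mpoly" assume p: "p \<in> PR V" "nf p = 0"
    have "single m (lookup p m) \<in> I" if m: "m \<in> keys p" for m
    proof -
      have "lookup (nf p) m = 0" using p by simp
      then have "\<not> Nf m" using m by (auto simp: lookup_filt in_keys_iff)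
      then obtain e where e: "e \<in> Ed" "e \<subseteq> keys m" by (auto simp: Nf_def indep_def)
      obtain u v where uv: "e = {u, v}" using Ed[OF e(1)] by (meson card_2_iff)
      have "m - sqf e + sqf e = m" using e uv by (intro diff_sqf_add) auto
      then have "single m (lookup p m) =
          single (m - sqf e) (lookup p m) * (var u * var v)"
        using var[of u v] e uv by (simp add: mult_single)
      moreover have "var u * var v \<in> I" unfolding I using PR.genideal_self[OF G] e uv by blast
      moreover have "keys (m - sqf e) \<subseteq> keys m" by (auto simp: in_keys_iff lookup_minus)
      then have "single (m - sqf e) (lookup p m) \<in> PR V"
        using p(1) m by (intro PR_single) (auto simp: PR_iff)
      ultimately show ?thesis using I.I_l_closed by simp
    qed
    then show "p \<in> I" using sum_I poly_mapping_sum_single[of p] by metis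
  qed
qed

lemma ideal_I: "ideal I R" using ideal_nf I_eq by simp

lemma coset_eq_iff: "p \<in> PR V \<Longrightarrow> q \<in> PR V \<Longrightarrow> I +>\<^bsub>R\<^esub> p = I +>\<^bsub>R\<^esub> q \<longleftrightarrow> nf p = nf q"
  using PR.quotient_eq_iff_same_a_r_cos[OF ideal_I, of p q]
  by (auto simp: PR_minus I_eq PR_diff filt_diff)

lemma coset_zero: "\<zero>\<^bsub>SI\<^esub> = I +>\<^bsub>R\<^esub> 0"
proof -
  have "I +>\<^bsub>R\<^esub> 0 = I" using PR.a_coset_add_zero[of I V] by (auto simp: I_eq)
  then show ?thesis by (simp add: SI_def quotient_module_def FactRing_def)
qed

lemma carrier_SI: "carrier SI = (\<lambda>p. I +>\<^bsub>R\<^esub> p) ` PR V"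
  by (auto simp: SI_def quotient_module_def FactRing_def A_RCOSETS_def')

lemma finsum_SI:
  fixes n :: nat
  assumes "\<And>q. q < n \<Longrightarrow> s q \<in> PR V \<and> h q \<in> PR V \<and> g q = I +>\<^bsub>R\<^esub> h q"
  shows "finsum SI (\<lambda>q. s q \<odot>\<^bsub>SI\<^esub> g q) {..<n} = I +>\<^bsub>R\<^esub> (\<Sum>q<n. s q * h q)"
proof -
  interpret I: ideal I R by (rule ideal_I)
  interpret h: ring_hom_cring R "R Quot I" "(+>\<^bsub>R\<^esub>) I" by (rule I.rcos_ring_hom_cring[OF cring_poly_ring])
  have "s q \<odot>\<^bsub>SI\<^esub> g q = I +>\<^bsub>R\<^esub> (s q * h q)" if "q < n" for q
    using assms[OF that] h.hom_mult[of "s q" "h q"] by (simp add: SI_def quotient_module_def)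
  \<comment> \<open>A finite sum depends only on carrier, addition and zero, which \<open>SI\<close>
    shares with the quotient ring; so the quotient map can be applied to the sum.\<close>
  then have "finsum SI (\<lambda>q. s q \<odot>\<^bsub>SI\<^esub> g q) {..<n} =
      finsum (R Quot I) (\<lambda>q. s q \<odot>\<^bsub>SI\<^esub> g q) {..<n}"
    by (simp add: finsum_def finprod_def SI_def quotient_module_def)
  also have "\<dots> = finsum (R Quot I) ((\<lambda>p. I +>\<^bsub>R\<^esub> p) \<circ> (\<lambda>q. s q * h q)) {..<n}"
    using \<open>\<And>q. q < n \<Longrightarrow> s q \<odot>\<^bsub>SI\<^esub> g q = I +>\<^bsub>R\<^esub> (s q * h q)\<close> assms
    by (intro h.S.finsum_cong') (auto intro!: h.hom_closed PR_mult)
  also have "\<dots> = I +>\<^bsub>R\<^esub> finsum R (\<lambda>q. s q * h q) {..<n}"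
    using assms by (subst h.hom_finsum) (auto intro!: PR_mult)
  also have "finsum R (\<lambda>q. s q * h q) {..<n} = (\<Sum>q<n. s q * h q)"
    by (rule PR_finsum) (use assms in \<open>auto intro!: PR_mult\<close>)
  finally show ?thesis .
qed

text \<open>A graded free resolution of \<open>S / I\<close>, with the images of the generators replaced by
  representatives \<open>h q\<close> and equality modulo \<open>I\<close> by equality of normal forms.\<close>

definition resolves where
  "resolves r d A (h :: nat \<Rightarrow> ('v, 'k) mpoly) \<longleftrightarrow>
     (\<forall>i p q. A i p q \<in> PR V \<and> homogeneous (d (Suc i) q - d i p) (A i p q)) \<and>
     (\<forall>i p q. p \<ge> r i \<or> q \<ge> r (Suc i) \<longrightarrow> A i p q = 0) \<and>
     (\<forall>q<r 0. h q \<in> PR V \<and> homogeneous (d 0 q) (h q)) \<and>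
     (\<forall>p\<in>PR V. \<exists>s\<in>free_module V (r 0). nf (\<Sum>q<r 0. s q * h q) = nf p) \<and>
     (\<forall>s\<in>free_module V (r 0).
        nf (\<Sum>q<r 0. s q * h q) = 0 \<longleftrightarrow> s \<in> mat_app (r 1) (A 0) ` free_module V (r 1)) \<and>
     (\<forall>i. \<forall>s\<in>free_module V (r (Suc i)).
        mat_app (r (Suc i)) (A i) s = (\<lambda>p. 0) \<longleftrightarrow>
        s \<in> mat_app (r (Suc (Suc i))) (A (Suc i)) ` free_module V (r (Suc (Suc i))))"

lemma graded_free_resolution_iff:
  "graded_free_resolution V SI (quotient_grading V I) r d A g \<longleftrightarrow>
   (\<exists>h. (\<forall>q<r 0. g q = I +>\<^bsub>R\<^esub> h q) \<and> resolves r d A h)"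
proof -
  \<comment> \<open>Entries outside the ranks vanish, and 0 lies in the ring and is homogeneous of
    every degree; so the first condition may be asked of all indices.\<close>
  have matrix: "(\<forall>i p q. p < r i \<and> q < r (Suc i) \<longrightarrow>
        A i p q \<in> PR V \<and> homogeneous (d (Suc i) q - d i p) (A i p q)) \<and>
     (\<forall>i p q. p \<ge> r i \<or> q \<ge> r (Suc i) \<longrightarrow> A i p q = 0) \<longleftrightarrow>
     (\<forall>i p q. A i p q \<in> PR V \<and> homogeneous (d (Suc i) q - d i p) (A i p q)) \<and>
     (\<forall>i p q. p \<ge> r i \<or> q \<ge> r (Suc i) \<longrightarrow> A i p q = 0)"
    by (metis PR_zero homogeneous_zero not_le_imp_less)
  have aug: "(\<forall>x\<in>carrier SI. \<exists>s\<in>free_module V (r 0). x = finsum SI (\<lambda>q. s q \<odot>\<^bsub>SI\<^esub> g q) {..<r 0}) \<longleftrightarrow>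
       (\<forall>p\<in>PR V. \<exists>s\<in>free_module V (r 0). nf (\<Sum>q<r 0. s q * h q) = nf p)"
    "(\<forall>s\<in>free_module V (r 0). finsum SI (\<lambda>q. s q \<odot>\<^bsub>SI\<^esub> g q) {..<r 0} = \<zero>\<^bsub>SI\<^esub> \<longleftrightarrow> s \<in> X) \<longleftrightarrow>
       (\<forall>s\<in>free_module V (r 0). nf (\<Sum>q<r 0. s q * h q) = 0 \<longleftrightarrow> s \<in> X)"
    if h: "\<forall>q<r 0. h q \<in> PR V" "\<forall>q<r 0. g q = I +>\<^bsub>R\<^esub> h q" for h X
  proof -
    have fs: "finsum SI (\<lambda>q. s q \<odot>\<^bsub>SI\<^esub> g q) {..<r 0} = I +>\<^bsub>R\<^esub> (\<Sum>q<r 0. s q * h q)"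
      "(\<Sum>q<r 0. s q * h q) \<in> PR V" if "s \<in> free_module V (r 0)" for s
      using that h by (auto simp: free_module_def intro!: finsum_SI PR_sum PR_mult)
    show "(\<forall>x\<in>carrier SI. \<exists>s\<in>free_module V (r 0). x = finsum SI (\<lambda>q. s q \<odot>\<^bsub>SI\<^esub> g q) {..<r 0}) \<longleftrightarrow>
       (\<forall>p\<in>PR V. \<exists>s\<in>free_module V (r 0). nf (\<Sum>q<r 0. s q * h q) = nf p)"
    proof -
      have "(\<exists>s\<in>free_module V (r 0). I +>\<^bsub>R\<^esub> p = finsum SI (\<lambda>q. s q \<odot>\<^bsub>SI\<^esub> g q) {..<r 0}) \<longleftrightarrow>
          (\<exists>s\<in>free_module V (r 0). nf (\<Sum>q<r 0. s q * h q) = nf p)" if "p \<in> PR V" for p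
        by (rule bex_cong[OF refl]) (simp add: fs that coset_eq_iff eq_commute)
      then show ?thesis by (simp add: carrier_SI)
    qed
    show "(\<forall>s\<in>free_module V (r 0). finsum SI (\<lambda>q. s q \<odot>\<^bsub>SI\<^esub> g q) {..<r 0} = \<zero>\<^bsub>SI\<^esub> \<longleftrightarrow> s \<in> X) \<longleftrightarrow>
       (\<forall>s\<in>free_module V (r 0). nf (\<Sum>q<r 0. s q * h q) = 0 \<longleftrightarrow> s \<in> X)"
      by (rule ball_cong[OF refl]) (simp add: fs coset_zero coset_eq_iff)
  qed
  show ?thesis
  proof
    assume gf: "graded_free_resolution V SI (quotient_grading V I) r d A g"
    then have "\<forall>q<r 0. g q \<in> quotient_grading V I (d 0 q)" by (simp add: graded_free_resolution_def)
    then have "\<forall>q. \<exists>p. q < r 0 \<longrightarrow> p \<in> PR V \<and> homogeneous (d 0 q) p \<and> g q = I +>\<^bsub>R\<^esub> p"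
      unfolding quotient_grading_def by blast
    then obtain h where h: "\<forall>q<r 0. h q \<in> PR V \<and> homogeneous (d 0 q) (h q)" "\<forall>q<r 0. g q = I +>\<^bsub>R\<^esub> h q"
      by metis
    have "resolves r d A h"
      using gf h matrix aug[of h] unfolding graded_free_resolution_def resolves_def by simp
    then show "\<exists>h. (\<forall>q<r 0. g q = I +>\<^bsub>R\<^esub> h q) \<and> resolves r d A h" using h by blast
  next
    assume "\<exists>h. (\<forall>q<r 0. g q = I +>\<^bsub>R\<^esub> h q) \<and> resolves r d A h"
    then obtain h where h: "\<forall>q<r 0. g q = I +>\<^bsub>R\<^esub> h q" "resolves r d A h" by blast
    then have h': "\<forall>q<r 0. h q \<in> PR V" "\<forall>q<r 0. g q \<in> quotient_grading V I (d 0 q)"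
      by (auto simp: resolves_def quotient_grading_def)
    show "graded_free_resolution V SI (quotient_grading V I) r d A g"
      using h(2) h'(2) matrix aug[OF h'(1) h(1)] unfolding graded_free_resolution_def resolves_def by simp
  qed
qed

end

section \<open>Tor and the Koszul complex\<close>

lemma single_eq_0_iff: "single k c = 0 \<longleftrightarrow> c = 0"
  by (metis lookup_single_eq lookup_zero single_zero)

locale koszul = edge_quotient V Ed K for V :: "'v set" and Ed and K :: "'k::field itself" +
  fixes \<sigma> :: "'v \<Rightarrow> 'v set \<Rightarrow> 'k"
  assumes \<sigma>: "alt_sign V \<sigma>"
begin

text \<open>\<open>KS\<close> is the Koszul complex of the polynomial ring, where no monomial is
  discarded; \<open>KM\<close> is that of the quotient, computed with normal forms.\<close>

sublocale KS: monomial_complex V "\<lambda>v. {v}" \<sigma> "\<lambda>_. True"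
  by unfold_locales (auto simp: finV \<sigma>)

sublocale KM: monomial_complex V "\<lambda>v. {v}" \<sigma> Nf
  by unfold_locales (auto simp: finV \<sigma> intro: Nf_add)

lemma L_id [simp]: "KS.L T = T" "KM.L T = T"
  by (auto simp: KS.L_def KM.L_def)

lemma KS_bd: "KS.bd s T = (\<Sum>e\<in>V - T. single (single e 1) (\<sigma> e T) * s (insert e T))"
proof -
  have "insert e T - T = {e}" if "e \<in> V - T" for e using that by auto
  then show ?thesis by (simp add: KS.bd_def filt_id)
qed

lemma KM_bd: "KM.bd s T = (\<Sum>e\<in>V - T. nf (single (single e 1) (\<sigma> e T) * s (insert e T)))"
proof -
  have "insert e T - T = {e}" if "e \<in> V - T" for e using that by auto
  then show ?thesis by (simp add: KM.bd_def)
qed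

text \<open>Internal degree \<open>j\<close>, homological degree \<open>q\<close>: the basis element
  of \<open>T\<close> has degree \<open>card T\<close>, which leaves \<open>j - q\<close> for its
  coefficient.\<close>

definition koszul_SI :: "int \<Rightarrow> nat \<Rightarrow> ('v set \<Rightarrow> ('v, 'k) mpoly) set" where
  "koszul_SI j q = {c. \<forall>T. (c T \<noteq> 0 \<longrightarrow> T \<subseteq> V \<and> card T = q) \<and> c T \<in> PR V \<and>
     homogeneous (j - int q) (c T) \<and> nf (c T) = c T}"

lemma card_insert_V: "e \<in> V - T \<Longrightarrow> insert e T \<subseteq> V \<Longrightarrow> card (insert e T) = Suc (card T)"
  using finV by (simp add: finite_subset)

end

locale koszul_resolution = koszul V Ed K \<sigma> for V :: "'v set" and Ed and K :: "'k::field itself" and \<sigma> +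
  fixes r :: "nat \<Rightarrow> nat" and d :: "nat \<Rightarrow> nat \<Rightarrow> int" and A :: "nat \<Rightarrow> nat \<Rightarrow> nat \<Rightarrow> ('v, 'k) mpoly"
    and h :: "nat \<Rightarrow> ('v, 'k) mpoly" and j :: int
  assumes res: "resolves r d A h"
begin

lemmas resD = res[unfolded resolves_def]

lemma A_entry: "A i p q \<in> PR V" "homogeneous (d (Suc i) q - d i p) (A i p q)"
  "p \<ge> r i \<or> q \<ge> r (Suc i) \<Longrightarrow> A i p q = 0"
proof -
  show "A i p q \<in> PR V" "homogeneous (d (Suc i) q - d i p) (A i p q)"
    using conjunct1[OF resD] by simp_all
  show "p \<ge> r i \<or> q \<ge> r (Suc i) \<Longrightarrow> A i p q = 0"
    using conjunct1[OF conjunct2[OF resD], rule_format] .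
qed

lemma h_entry: "q < r 0 \<Longrightarrow> h q \<in> PR V" "q < r 0 \<Longrightarrow> homogeneous (d 0 q) (h q)"
  using conjunct1[OF conjunct2[OF conjunct2[OF resD]]] by simp_all

lemma aug_surj: "p \<in> PR V \<Longrightarrow> \<exists>s\<in>free_module V (r 0). nf (\<Sum>q<r 0. s q * h q) = nf p"
  and aug_exact: "s \<in> free_module V (r 0) \<Longrightarrow>
    nf (\<Sum>q<r 0. s q * h q) = 0 \<longleftrightarrow> s \<in> mat_app (r 1) (A 0) ` free_module V (r 1)"
  and mat_exact: "s \<in> free_module V (r (Suc i)) \<Longrightarrow> mat_app (r (Suc i)) (A i) s = (\<lambda>p. 0) \<longleftrightarrow>
    s \<in> mat_app (r (Suc (Suc i))) (A (Suc i)) ` free_module V (r (Suc (Suc i)))"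
proof -
  note R = conjunct2[OF conjunct2[OF conjunct2[OF resD]]]
  show "p \<in> PR V \<Longrightarrow> \<exists>s\<in>free_module V (r 0). nf (\<Sum>q<r 0. s q * h q) = nf p"
    by (rule bspec[OF conjunct1[OF R]])
  show "s \<in> free_module V (r 0) \<Longrightarrow>
    nf (\<Sum>q<r 0. s q * h q) = 0 \<longleftrightarrow> s \<in> mat_app (r 1) (A 0) ` free_module V (r 1)"
    by (rule bspec[OF conjunct1[OF conjunct2[OF R]]])
  show "s \<in> free_module V (r (Suc i)) \<Longrightarrow> mat_app (r (Suc i)) (A i) s = (\<lambda>p. 0) \<longleftrightarrow>
    s \<in> mat_app (r (Suc (Suc i))) (A (Suc i)) ` free_module V (r (Suc (Suc i)))"
    by (rule bspec[OF spec[OF conjunct2[OF conjunct2[OF R]]]])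
qed

text \<open>The double complex in degree \<open>j\<close> is the tensor product of the resolution with the Koszul complex
  of the ring: \<open>s a T\<close> is the coefficient of the \<open>a\<close>-th basis element of the resolution tensored with
  the exterior product of \<open>T\<close>.\<close>

definition D :: "nat \<Rightarrow> nat \<Rightarrow> (nat \<Rightarrow> 'v set \<Rightarrow> ('v, 'k) mpoly) set" where
  "D p q = {s. \<forall>a T. (s a T \<noteq> 0 \<longrightarrow> a < r p \<and> T \<subseteq> V \<and> card T = q) \<and> s a T \<in> PR V \<and>
     homogeneous (j - d p a - int q) (s a T)}"

definition dh :: "nat \<Rightarrow> (nat \<Rightarrow> 'v set \<Rightarrow> ('v, 'k) mpoly) \<Rightarrow> nat \<Rightarrow> 'v set \<Rightarrow> ('v, 'k) mpoly" where
  "dh p s = (\<lambda>a T. \<Sum>b<r (Suc p). A p a b * s b T)"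

definition dv :: "nat \<Rightarrow> (nat \<Rightarrow> 'v set \<Rightarrow> ('v, 'k) mpoly) \<Rightarrow> nat \<Rightarrow> 'v set \<Rightarrow> ('v, 'k) mpoly" where
  "dv q s = (\<lambda>a. KS.bd (s a))"

text \<open>The two augmentations: \<open>eh\<close> maps the resolution onto S / I, and
  \<open>ev\<close> maps the Koszul complex of the ring onto the residue field.\<close>

definition eh :: "(nat \<Rightarrow> 'v set \<Rightarrow> ('v, 'k) mpoly) \<Rightarrow> 'v set \<Rightarrow> ('v, 'k) mpoly" where
  "eh s = (\<lambda>T. nf (\<Sum>b<r 0. s b T * h b))"

definition ev :: "(nat \<Rightarrow> 'v set \<Rightarrow> ('v, 'k) mpoly) \<Rightarrow> nat \<Rightarrow> 'k" where
  "ev s = (\<lambda>a. const_coeff (s a {}))"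

lemma D_memI:
  assumes "\<And>a T. s a T \<noteq> 0 \<Longrightarrow> a < r p \<and> T \<subseteq> V \<and> card T = q"
    and "\<And>a T. a < r p \<Longrightarrow> T \<subseteq> V \<Longrightarrow> card T = q \<Longrightarrow> s a T \<in> PR V \<and> homogeneous (j - d p a - int q) (s a T)"
  shows "s \<in> D p q"
  unfolding D_def
proof (intro CollectI allI conjI impI)
  fix a T
  show "s a T \<in> PR V" "homogeneous (j - d p a - int q) (s a T)"
    using assms[of a T] by (cases "s a T = 0"; simp)+
qed (use assms(1) in blast)+

lemma D_memD:
  assumes "s \<in> D p q"
  shows "s a T \<noteq> 0 \<Longrightarrow> a < r p \<and> T \<subseteq> V \<and> card T = q" "s a T \<in> PR V" "homogeneous (j - d p a - int q) (s a T)"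
  using assms unfolding D_def by blast+

lemma D_free: "s \<in> D p q \<Longrightarrow> (\<lambda>b. s b T) \<in> free_module V (r p)"
  unfolding free_module_def
proof (intro CollectI conjI allI impI)
  fix b assume s: "s \<in> D p q"
  show "s b T \<in> PR V" by (rule D_memD(2)[OF s])
  assume "r p \<le> b"
  then show "s b T = 0" using D_memD(1)[OF s, of b T] by linarith
qed

lemma dh_mat: "dh p s a T = mat_app (r (Suc p)) (A p) (\<lambda>b. s b T) a"
  by (simp add: dh_def mat_app_def)

lemma dh_closed: assumes x: "x \<in> D (Suc p) q" shows "dh p x \<in> D p q"
proof (rule D_memI)
  fix a T assume "dh p x a T \<noteq> 0"
  then obtain b where "A p a b * x b T \<noteq> 0" unfolding dh_def by (meson sum.neutral)
  then have "A p a b \<noteq> 0" "x b T \<noteq> 0" by auto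
  then show "a < r p \<and> T \<subseteq> V \<and> card T = q" using A_entry(3) D_memD(1)[OF x] by (meson not_le)
next
  fix a T
  have "homogeneous (j - d p a - int q) (A p a b * x b T)" for b
    using homogeneous_mult[OF A_entry(2)[of p b a] D_memD(3)[OF x, of b T]] by (simp add: algebra_simps)
  then show "dh p x a T \<in> PR V \<and> homogeneous (j - d p a - int q) (dh p x a T)"
    unfolding dh_def by (intro conjI PR_sum PR_mult homogeneous_sum A_entry(1) D_memD(2)[OF x])
qed

lemma dv_closed: assumes x: "x \<in> D p (Suc q)" shows "dv q x \<in> D p q"
proof (rule D_memI)
  fix a T assume nz: "dv q x a T \<noteq> 0"
  have "\<exists>e\<in>V - T. x a (insert e T) \<noteq> 0"
  proof (rule ccontr)
    assume "\<not> (\<exists>e\<in>V - T. x a (insert e T) \<noteq> 0)"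
    then have "KS.bd (x a) T = 0" unfolding KS_bd by (intro sum.neutral) simp
    then show False using nz by (simp add: dv_def)
  qed
  then obtain e where e: "e \<in> V - T" "x a (insert e T) \<noteq> 0" by blast
  then have "a < r p" "insert e T \<subseteq> V" "card (insert e T) = Suc q" using D_memD(1)[OF x] by auto
  then show "a < r p \<and> T \<subseteq> V \<and> card T = q" using card_insert_V[OF e(1)] by auto
next
  fix a T
  have "homogeneous (j - d p a - int q) (single (single e 1) (\<sigma> e T) * x a (insert e T))" for e
    using homogeneous_mult[OF homogeneous_single[of "single e 1" 1] D_memD(3)[OF x, of a "insert e T"]]
    by (simp add: mon_degree_def algebra_simps)
  then show "dv q x a T \<in> PR V \<and> homogeneous (j - d p a - int q) (dv q x a T)"
    unfolding dv_def KS_bd by (intro conjI PR_sum PR_mult homogeneous_sum PR_single D_memD(2)[OF x]) auto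
qed

lemma eh_closed: assumes x: "x \<in> D 0 q" shows "eh x \<in> koszul_SI j q"
  unfolding koszul_SI_def
proof (intro CollectI allI conjI impI)
  fix T
  show "T \<subseteq> V" "card T = q" if nz: "eh x T \<noteq> 0"
  proof -
    have "(\<Sum>b<r 0. x b T * h b) \<noteq> 0" using nz unfolding eh_def by force
    then obtain b where "x b T * h b \<noteq> 0" by (meson sum.neutral)
    then have "x b T \<noteq> 0" by auto
    then show "T \<subseteq> V" "card T = q" using D_memD(1)[OF x] by blast+
  qed
  have "homogeneous (j - int q) (x b T * h b)" if "b < r 0" for b
    using homogeneous_mult[OF D_memD(3)[OF x, of b T] h_entry(2)[OF that]] by simp
  then show "homogeneous (j - int q) (eh x T)"
    unfolding eh_def by (intro homogeneous_filt homogeneous_sum) auto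
  show "eh x T \<in> PR V" unfolding eh_def by (intro PR_filt PR_sum PR_mult h_entry(1) D_memD(2)[OF x]) auto
  show "nf (eh x T) = eh x T" by (simp add: eh_def)
qed

lemma ev_closed: assumes x: "x \<in> D p 0" shows "ev x \<in> tensor_strand r d p j"
  unfolding tensor_strand_def
proof (intro CollectI allI impI)
  fix a assume "ev x a \<noteq> 0"
  then have k: "0 \<in> keys (x a {})" by (simp add: ev_def const_coeff_def in_keys_iff)
  then have "x a {} \<noteq> 0" by auto
  moreover have "j - d p a = 0" using D_memD(3)[OF x, of a "{}"] k unfolding homogeneous_def by force
  ultimately show "a < r p \<and> d p a = j" using D_memD(1)[OF x] by auto
qed

lemma hom_part_A:
  "hom_part (j - d p a - int q) (A p a b * t) = A p a b * hom_part (j - d (Suc p) b - int q) t"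
proof -
  have "j - d p a - int q - (d (Suc p) b - d p a) = j - d (Suc p) b - int q" by simp
  then show ?thesis using hom_part_mult[OF A_entry(2)[of p b a], of "j - d p a - int q" t] by (simp only:)
qed

text \<open>Exactness of the resolution lifts the vector at each \<open>T\<close> separately,
  without control of degrees. As the entries of \<open>A\<close> are homogeneous, the components of
  the right degree still form a lift.\<close>

lemma row_lift:
  assumes x: "x \<in> D p q" and im: "\<And>T. (\<lambda>b. x b T) \<in> mat_app (r (Suc p)) (A p) ` free_module V (r (Suc p))"
  shows "x \<in> dh p ` D (Suc p) q"
proof -
  have "\<exists>t\<in>free_module V (r (Suc p)). (\<lambda>b. x b T) = mat_app (r (Suc p)) (A p) t" for T
    using im by blast
  then obtain t where t: "\<And>T. t T \<in> free_module V (r (Suc p))"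
    "\<And>T. (\<lambda>b. x b T) = mat_app (r (Suc p)) (A p) (t T)" by metis
  define y where "y b T = (if b < r (Suc p) \<and> T \<subseteq> V \<and> card T = q
    then hom_part (j - d (Suc p) b - int q) (t T b) else 0)" for b T
  have "y \<in> D (Suc p) q"
  proof (rule D_memI)
    show "b < r (Suc p) \<and> T \<subseteq> V \<and> card T = q" if "y b T \<noteq> 0" for b T
      using that unfolding y_def by presburger
    fix b T assume "b < r (Suc p)" "T \<subseteq> V" "card T = q"
    then show "y b T \<in> PR V \<and> homogeneous (j - d (Suc p) b - int q) (y b T)"
      using t(1)[of T] by (simp add: y_def homogeneous_hom_part) (simp add: free_module_def hom_part_def PR_filt)
  qed
  moreover have "dh p y a T = x a T" for a T
  proof (cases "T \<subseteq> V \<and> card T = q")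
    case True
    have "dh p y a T = (\<Sum>b<r (Suc p). hom_part (j - d p a - int q) (A p a b * t T b))"
      unfolding dh_def using True by (intro sum.cong) (auto simp: y_def hom_part_A)
    also have "\<dots> = hom_part (j - d p a - int q) (x a T)"
      unfolding fun_cong[OF t(2)[of T], of a] by (simp add: mat_app_def hom_part_def filt_sum)
    also have "\<dots> = x a T" by (rule hom_part_id[OF D_memD(3)[OF x]])
    finally show ?thesis .
  next
    case False
    then have "y b T = 0" for b by (auto simp: y_def)
    then have "dh p y a T = 0" by (simp add: dh_def)
    then show ?thesis using D_memD(1)[OF x, of a T] False by auto
  qed
  then have "x = dh p y" by (auto simp: fun_eq_iff)
  ultimately show ?thesis by blast
qed

lemma row_exact:
  assumes x: "x \<in> D (Suc p) q" and z: "dh p x = 0" shows "x \<in> dh (Suc p) ` D (Suc (Suc p)) q"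
proof (rule row_lift[OF x])
  fix T
  have "mat_app (r (Suc p)) (A p) (\<lambda>b. x b T) = (\<lambda>p. 0)"
    unfolding dh_mat[symmetric] z by (simp add: fun_eq_iff)
  then show "(\<lambda>b. x b T) \<in> mat_app (r (Suc (Suc p))) (A (Suc p)) ` free_module V (r (Suc (Suc p)))"
    using mat_exact[OF D_free[OF x]] by blast
qed

lemma row_exact0:
  assumes x: "x \<in> D 0 q" and z: "eh x = 0" shows "x \<in> dh 0 ` D (Suc 0) q"
proof (rule row_lift[OF x])
  fix T
  have "nf (\<Sum>b<r 0. x b T * h b) = 0" using fun_cong[OF z, of T] by (simp add: eh_def)
  then show "(\<lambda>b. x b T) \<in> mat_app (r (Suc 0)) (A 0) ` free_module V (r (Suc 0))"
    using aug_exact[OF D_free[OF x]] by simp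
qed

lemma row_surj: "koszul_SI j q \<subseteq> eh ` D 0 q"
proof
  fix c assume "c \<in> koszul_SI j q"
  then have c: "\<And>T. c T \<noteq> 0 \<Longrightarrow> T \<subseteq> V \<and> card T = q" "\<And>T. c T \<in> PR V"
    "\<And>T. homogeneous (j - int q) (c T)" "\<And>T. nf (c T) = c T" unfolding koszul_SI_def by blast+
  have "\<exists>s\<in>free_module V (r 0). nf (\<Sum>q<r 0. s q * h q) = c T" for T using aug_surj[OF c(2)] c(4) by simp
  then obtain s where s: "\<And>T. s T \<in> free_module V (r 0)" "\<And>T. nf (\<Sum>q<r 0. s T q * h q) = c T" by metis
  define y where "y b T = (if b < r 0 \<and> T \<subseteq> V \<and> card T = q then hom_part (j - d 0 b - int q) (s T b) else 0)" for b T
  have "y \<in> D 0 q"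
  proof (rule D_memI)
    show "b < r 0 \<and> T \<subseteq> V \<and> card T = q" if "y b T \<noteq> 0" for b T
      using that unfolding y_def by presburger
    fix b T assume "b < r 0" "T \<subseteq> V" "card T = q"
    then show "y b T \<in> PR V \<and> homogeneous (j - d 0 b - int q) (y b T)"
      using s(1)[of T] by (simp add: y_def homogeneous_hom_part) (simp add: free_module_def hom_part_def PR_filt)
  qed
  moreover have "eh y T = c T" for T
  proof (cases "T \<subseteq> V \<and> card T = q")
    case True
    have "(\<Sum>b<r 0. y b T * h b) = (\<Sum>b<r 0. hom_part (j - int q) (s T b * h b))"
    proof (rule sum.cong[OF refl])
      fix b assume "b \<in> {..<r 0}"
      then have "hom_part (j - int q) (h b * s T b) = h b * hom_part (j - int q - d 0 b) (s T b)"
        by (intro hom_part_mult h_entry) simp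
      moreover have "j - int q - d 0 b = j - d 0 b - int q" by simp
      ultimately show "y b T * h b = hom_part (j - int q) (s T b * h b)"
        using True \<open>b \<in> {..<r 0}\<close> by (simp add: y_def mult.commute)
    qed
    also have "\<dots> = hom_part (j - int q) (\<Sum>b<r 0. s T b * h b)" by (simp add: hom_part_def filt_sum)
    finally have "eh y T = hom_part (j - int q) (nf (\<Sum>b<r 0. s T b * h b))"
      unfolding eh_def by (simp add: hom_part_def filt_commute)
    also have "\<dots> = c T" using s(2) hom_part_id[OF c(3)] by simp
    finally show ?thesis .
  next
    case False
    then have "y b T = 0" for b by (auto simp: y_def)
    then have "eh y T = 0" by (simp add: eh_def)
    then show ?thesis using c(1)[of T] False by auto
  qed
  then have "c = eh y" by (auto simp: fun_eq_iff)
  ultimately show "c \<in> eh ` D 0 q" by blast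
qed

text \<open>The Koszul complex of the ring is exact in every multidegree other than 0, since any
  variable dividing the multidegree is a cone point. The multidegrees of the lift are among those of
  \<open>x\<close>, which gives its degree and variables.\<close>

lemma col_exact_aux:
  assumes x: "x \<in> D p q" and z: "\<And>a. KS.bd (x a) = (\<lambda>T. 0)"
    and ne: "\<And>a. 0 \<notin> KS.mdegs (x a)"
  shows "x \<in> dv q ` D p (Suc q)"
proof -
  have "\<exists>t. (\<forall>T. t T \<noteq> 0 \<longrightarrow> T \<subseteq> V \<and> card T = Suc q) \<and>
    (\<forall>T. \<forall>\<nu>\<in>keys (t T). \<nu> + sqf T \<in> KS.mdegs (x a)) \<and> KS.bd t = x a" for a
  proof -
    have s0: "T \<subseteq> V \<and> card T = q" if "x a T \<noteq> 0" for T using D_memD(1)[OF x that] by blast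
    have cone: "\<exists>e0\<in>KS.Ea \<alpha>. \<forall>T. T \<subseteq> KS.Ea \<alpha> \<longrightarrow> e0 \<notin> T \<longrightarrow> KS.face \<alpha> (insert e0 T) \<longrightarrow> KS.face \<alpha> T"
      if \<alpha>: "\<alpha> \<in> KS.mdegs (x a)" for \<alpha>
    proof -
      obtain T \<nu> where T: "T \<subseteq> V" "\<nu> \<in> keys (x a T)" "\<alpha> = \<nu> + sqf T"
        using \<alpha> by (auto simp: KS.mdegs_def)
      have "\<alpha> \<noteq> 0" using \<alpha> ne by blast
      then obtain e where e: "e \<in> keys \<alpha>" by (metis all_not_in_conv keys_eq_empty)
      have "finite T" using T(1) finV finite_subset by blast
      then have "e \<in> V" using e T D_memD(2)[OF x, of a T] by (auto simp: PR_iff keys_add_nat)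
      then show ?thesis
        using e by (intro bexI[of _ e]) (auto simp: KS.face_def KS.Ea_def)
    qed
    obtain t where t: "\<And>T. t T \<noteq> 0 \<Longrightarrow> T \<subseteq> V \<and> card T = Suc q"
      "\<And>T \<nu>. \<nu> \<in> keys (t T) \<Longrightarrow> True \<and> \<nu> + sqf (KS.L T) \<in> KS.mdegs (x a)" "KS.bd t = x a"
      by (rule KS.exact_cone[OF s0 TrueI z[of a] cone]; (assumption | (rule that; blast)))
    then show ?thesis by (intro exI[of _ t]) simp
  qed
  then obtain t where t: "\<And>a T. t a T \<noteq> 0 \<Longrightarrow> T \<subseteq> V \<and> card T = Suc q"
    "\<And>a T \<nu>. \<nu> \<in> keys (t a T) \<Longrightarrow> \<nu> + sqf T \<in> KS.mdegs (x a)" "\<And>a. KS.bd (t a) = x a" by metis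
  define y where "y a = (if a < r p then t a else (\<lambda>T. 0))" for a
  have "y \<in> D p (Suc q)"
  proof (rule D_memI)
    show "a < r p \<and> T \<subseteq> V \<and> card T = Suc q" if "y a T \<noteq> 0" for a T
      using that t(1)[of a T] by (simp add: y_def split: if_splits)
    fix a T assume a: "a < r p" "T \<subseteq> V" "card T = Suc q"
    have "finite T" using a finV finite_subset by blast
    have "keys \<nu> \<subseteq> V \<and> int (mon_degree \<nu>) = j - d p a - int (Suc q)"
      if "\<nu> \<in> keys (y a T)" for \<nu>
    proof -
      have "\<nu> + sqf T \<in> KS.mdegs (x a)" using t(2) that a by (simp add: y_def)
      then obtain T' \<nu>' where T': "T' \<subseteq> V" "\<nu>' \<in> keys (x a T')" "\<nu> + sqf T = \<nu>' + sqf T'"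
        by (auto simp: KS.mdegs_def)
      have "finite T'" using T' finV finite_subset by blast
      have "x a T' \<noteq> 0" using T'(2) by auto
      then have "card T' = q" using D_memD(1)[OF x] by blast
      have "keys \<nu> \<subseteq> keys (\<nu> + sqf T)" by (simp add: keys_add_nat)
      also have "\<dots> \<subseteq> V" unfolding T'(3)
        using T' D_memD(2)[OF x, of a T'] \<open>finite T'\<close> by (auto simp: keys_add_nat PR_iff)
      finally have "keys \<nu> \<subseteq> V" .
      moreover have "mon_degree (\<nu> + sqf T) = mon_degree (\<nu>' + sqf T')" using T' by simp
      then have "mon_degree \<nu> + Suc q = mon_degree \<nu>' + q"
        using \<open>finite T\<close> \<open>finite T'\<close> \<open>card T' = q\<close> a by simp
      moreover have "int (mon_degree \<nu>') = j - d p a - int q"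
        using D_memD(3)[OF x, of a T'] T'(2) unfolding homogeneous_def by blast
      ultimately show ?thesis by simp
    qed
    then show "y a T \<in> PR V \<and> homogeneous (j - d p a - int (Suc q)) (y a T)"
      unfolding PR_iff homogeneous_def by blast
  qed
  moreover have "dv q y = x"
  proof (rule ext)
    fix a show "dv q y a = x a"
    proof (cases "a < r p")
      case True then show ?thesis by (simp add: dv_def y_def t)
    next
      case False
      then have "x a T = 0" for T using D_memD(1)[OF x, of a T] by blast
      then show ?thesis using False by (simp add: dv_def y_def KS_bd fun_eq_iff)
    qed
  qed
  ultimately show ?thesis by blast
qed

lemma col_exact:
  assumes x: "x \<in> D p (Suc q)" and z: "dv q x = 0" shows "x \<in> dv (Suc q) ` D p (Suc (Suc q))"
proof -
  have "x \<in> dv (Suc q) ` D p (Suc (Suc q))"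
  proof (rule col_exact_aux[OF x])
    show "KS.bd (x a) = (\<lambda>T. 0)" for a using fun_cong[OF z, of a] by (simp add: dv_def zero_fun_def)
    \<comment> \<open>In positive Koszul degree \<open>T\<close> is nonempty and its monomial is not
      1.\<close>
    show "0 \<notin> KS.mdegs (x a)" for a
    proof
      assume "0 \<in> KS.mdegs (x a)"
      then obtain T \<nu> where T: "T \<subseteq> V" "\<nu> \<in> keys (x a T)" "0 = \<nu> + sqf T"
        by (auto simp: KS.mdegs_def)
      then have "sqf T = 0" using nat_monomial_add_eq_0[of \<nu> "sqf T"] by simp
      then have "T = {}" using keys_sqf[of T] T(1) finV finite_subset by fastforce
      moreover have "x a T \<noteq> 0" using T(2) by auto
      ultimately show False using D_memD(1)[OF x, of a T] by simp
    qed
  qed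
  then show ?thesis .
qed

lemma col_exact0:
  assumes x: "x \<in> D p 0" and z: "ev x = 0" shows "x \<in> dv 0 ` D p (Suc 0)"
proof (rule col_exact_aux[OF x])
  have xT: "x a T = 0" if "T \<noteq> {}" for a T
    using D_memD(1)[OF x, of a T] that finV finite_subset by fastforce
  show "KS.bd (x a) = (\<lambda>T. 0)" for a
    by (simp add: KS_bd fun_eq_iff xT)
  \<comment> \<open>Multidegree 0 could only come from a constant term at the empty set, which
    \<open>ev x = 0\<close> excludes.\<close>
  show "0 \<notin> KS.mdegs (x a)" for a
  proof
    assume "0 \<in> KS.mdegs (x a)"
    then obtain T \<nu> where T: "T \<subseteq> V" "\<nu> \<in> keys (x a T)" "0 = \<nu> + sqf T"
      by (auto simp: KS.mdegs_def)
    then have "\<nu> = 0" using nat_monomial_add_eq_0[of \<nu> "sqf T"] by simp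
    moreover have "x a T \<noteq> 0" using T(2) by auto
    then have "T = {}" using xT by blast
    moreover have "lookup (x a {}) 0 = 0"
      using fun_cong[OF z, of a] by (simp add: ev_def const_coeff_def)
    ultimately show False using T(2) in_keys_iff by metis
  qed
qed

lemma col_surj: "tensor_strand r d p j \<subseteq> ev ` D p 0"
proof
  fix w :: "nat \<Rightarrow> 'k" assume "w \<in> tensor_strand r d p j"
  then have w: "w a \<noteq> 0 \<Longrightarrow> a < r p \<and> d p a = j" for a by (simp add: tensor_strand_def)
  define y :: "nat \<Rightarrow> 'v set \<Rightarrow> ('v, 'k) mpoly"
    where "y a T = (if T = {} then single 0 (w a) else 0)" for a T
  have "y \<in> D p 0"
  proof (rule D_memI)
    show "a < r p \<and> T \<subseteq> V \<and> card T = 0" if "y a T \<noteq> 0" for a T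
      using that w[of a] by (cases "w a = 0") (auto simp: y_def split: if_splits)
    show "y a T \<in> PR V \<and> homogeneous (j - d p a - int 0) (y a T)" for a T
      using w[of a] by (cases "w a = 0") (auto simp: y_def intro!: PR_single homogeneous_single)
  qed
  moreover have "w = ev y" by (simp add: fun_eq_iff ev_def y_def const_coeff_def)
  ultimately show "w \<in> ev ` D p 0" by blast
qed

text \<open>With these two edges, \<open>exact_iff\<close> becomes the balance of Tor: the Koszul
  complex of S / I against the resolution tensored with the residue field.\<close>

sublocale double_complex D "koszul_SI j" "\<lambda>p. tensor_strand r d p j" dh dv eh ev "\<lambda>_. KM.bd" "tensor_diff r A"
proof
  fix p q :: nat and x y
  show "x - y \<in> D p q" if "x \<in> D p q" "y \<in> D p q"
  proof (rule D_memI)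
    fix a T assume "(x - y) a T \<noteq> 0"
    then have "x a T \<noteq> 0 \<or> y a T \<noteq> 0" by auto
    then show "a < r p \<and> T \<subseteq> V \<and> card T = q" using D_memD(1)[OF that(1)] D_memD(1)[OF that(2)] by blast
  next
    fix a T show "(x - y) a T \<in> PR V \<and> homogeneous (j - d p a - int q) ((x - y) a T)"
      using D_memD(2,3)[OF that(1)] D_memD(2,3)[OF that(2)] by (simp add: PR_diff homogeneous_diff)
  qed
  show "dh p (x - y) = dh p x - dh p y"
    by (simp add: dh_def fun_eq_iff right_diff_distrib sum_subtractf)
  show "dv q (x - y) = dv q x - dv q y"
    by (simp add: dv_def KS_bd fun_eq_iff right_diff_distrib sum_subtractf)
  show "eh (x - y) = eh x - eh y"
    by (simp add: eh_def fun_eq_iff left_diff_distrib sum_subtractf filt_diff)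
  show "ev (x - y) = ev x - ev y"
    by (simp add: ev_def fun_eq_iff const_coeff_def lookup_minus)
  show "dh p x \<in> D p q" if "x \<in> D (Suc p) q" using that by (rule dh_closed)
  show "dv q x \<in> D p q" if "x \<in> D p (Suc q)" using that by (rule dv_closed)
  show "eh x \<in> koszul_SI j q" if "x \<in> D 0 q" using that by (rule eh_closed)
  show "ev x \<in> tensor_strand r d p j" if "x \<in> D p 0" using that by (rule ev_closed)
  show "dh p (dv q x) = dv q (dh p x)"
    unfolding dh_def dv_def KS_bd sum_distrib_left by (subst sum.swap) (simp add: mult.left_commute)
  show "eh (dv q x) = KM.bd (eh x)"
  proof (rule ext)
    fix T
    have "(\<Sum>b<r 0. dv q x b T * h b) =
        (\<Sum>e\<in>V - T. single (single e 1) (\<sigma> e T) * (\<Sum>b<r 0. x b (insert e T) * h b))"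
      unfolding dv_def KS_bd sum_distrib_left sum_distrib_right by (subst sum.swap) (simp add: mult.assoc)
    then have "eh (dv q x) T = (\<Sum>e\<in>V - T.
        nf (single (single e 1) (\<sigma> e T) * (\<Sum>b<r 0. x b (insert e T) * h b)))"
      unfolding eh_def by (simp only: filt_sum)
    then show "eh (dv q x) T = KM.bd (eh x) T"
      unfolding KM_bd by (simp only: eh_def nf_mult_nf)
  qed
  show "ev (dh p x) = tensor_diff r A p (ev x)"
    by (simp add: ev_def dh_def tensor_diff_def mat_app_def const_coeff_sum const_coeff_mult fun_eq_iff)
  show "dh p (dh (Suc p) x) = 0" if x: "x \<in> D (Suc (Suc p)) q"
  proof -
    have "dh p (dh (Suc p) x) a T = 0" for a T
    proof -
      have "(\<lambda>b. dh (Suc p) x b T) = mat_app (r (Suc (Suc p))) (A (Suc p)) (\<lambda>b. x b T)"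
        by (simp add: dh_mat fun_eq_iff)
      moreover have "(\<lambda>b. dh (Suc p) x b T) \<in> free_module V (r (Suc p))" using dh_closed[OF x] by (rule D_free)
      ultimately have "mat_app (r (Suc p)) (A p) (\<lambda>b. dh (Suc p) x b T) = (\<lambda>p. 0)"
        using mat_exact D_free[OF x] by blast
      then show ?thesis by (simp add: dh_mat[of p])
    qed
    then show ?thesis by (simp add: fun_eq_iff)
  qed
  show "eh (dh 0 x) = 0" if x: "x \<in> D (Suc 0) q"
  proof -
    have "eh (dh 0 x) T = 0" for T
    proof -
      have "(\<lambda>b. dh 0 x b T) = mat_app (r 1) (A 0) (\<lambda>b. x b T)"
        by (simp add: dh_mat fun_eq_iff)
      moreover have "(\<lambda>b. dh 0 x b T) \<in> free_module V (r 0)" using dh_closed[OF x] by (rule D_free)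
      moreover have "(\<lambda>b. x b T) \<in> free_module V (r 1)" using D_free[OF x] by simp
      ultimately show ?thesis using aug_exact by (simp add: eh_def)
    qed
    then show ?thesis by (simp add: fun_eq_iff)
  qed
  show "dv q (dv (Suc q) x) = 0" if "x \<in> D p (Suc (Suc q))"
    using KS.bd_bd D_memD(1)[OF that] by (simp add: dv_def fun_eq_iff)
  show "ev (dv 0 x) = 0"
    by (simp add: ev_def dv_def KS_bd const_coeff_sum const_coeff_single_mult single_eq_0_iff fun_eq_iff)
  show "x \<in> dh (Suc p) ` D (Suc (Suc p)) q" if "x \<in> D (Suc p) q" "dh p x = 0" using that by (rule row_exact)
  show "x \<in> dh 0 ` D (Suc 0) q" if "x \<in> D 0 q" "eh x = 0" using that by (rule row_exact0)
  show "koszul_SI j q \<subseteq> eh ` D 0 q" by (rule row_surj)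
  show "x \<in> dv (Suc q) ` D p (Suc (Suc q))" if "x \<in> D p (Suc q)" "dv q x = 0" using that by (rule col_exact)
  show "x \<in> dv 0 ` D p (Suc 0)" if "x \<in> D p 0" "ev x = 0" using that by (rule col_exact0)
  show "tensor_strand r d p j \<subseteq> ev ` D p 0" by (rule col_surj)
qed

text \<open>The right-hand side does not mention the resolution, so this also gives the independence
  of Tor from the choice of resolution.\<close>

lemma tor_iff_koszul:
  "tor_cycles r d A i j = tor_boundaries r d A i j \<longleftrightarrow> exact_at (koszul_SI j) (\<lambda>_. KM.bd) i"
proof -
  have "tor_boundaries r d A i j \<subseteq> tor_cycles r d A i j"
    unfolding tor_boundaries_def tor_cycles_def zero_fun_def[symmetric]
  proof (intro subsetI CollectI conjI allI impI)
    fix w assume "w \<in> tensor_diff r A i ` tensor_strand r d (Suc i) j"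
    then obtain w' where w': "w' \<in> tensor_strand r d (Suc i) j" "w = tensor_diff r A i w'" by blast
    show "w \<in> tensor_strand r d i j" unfolding w'(2) by (rule dN_closed[OF w'(1)])
    fix l assume l: "i = Suc l"
    show "tensor_diff r A l w = 0" unfolding w'(2) using w'(1) unfolding l by (rule dN_dN)
  qed
  then show ?thesis
    unfolding exact_iff[symmetric]
    unfolding exact_at_def tor_boundaries_def tor_cycles_def zero_fun_def by blast
qed

end

section \<open>The Taylor resolution\<close>

text \<open>Resolutions are indexed by numbers, whereas the Taylor complex has the sets of edges as
  its basis; \<open>en i\<close> numbers the sets of \<open>i\<close> edges.\<close>

locale taylor_resolution = edge_quotient V Ed K for V :: "'v set" and Ed and K :: "'k::field itself" +
  fixes \<tau> :: "'v set \<Rightarrow> 'v set set \<Rightarrow> 'k" and en :: "nat \<Rightarrow> nat \<Rightarrow> 'v set set"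
  assumes \<tau>: "alt_sign Ed \<tau>"
    and en: "bij_betw (en i) {..<card {T. T \<subseteq> Ed \<and> card T = i}} {T. T \<subseteq> Ed \<and> card T = i}"
begin

sublocale T: monomial_complex Ed "\<lambda>e. e" \<tau> "\<lambda>_. True"
proof
  show "finite e" if "e \<in> Ed" for e using Ed[OF that] finV finite_subset by blast
qed (auto simp: finEd \<tau>)

definition TS :: "nat \<Rightarrow> 'v set set set" where "TS i = {T. T \<subseteq> Ed \<and> card T = i}"
definition rk :: "nat \<Rightarrow> nat" where "rk i = card (TS i)"
definition dg :: "nat \<Rightarrow> nat \<Rightarrow> int" where "dg i q = int (card (\<Union>(en i q)))"
text \<open>If the set numbered \<open>p\<close> is contained in the set numbered \<open>q\<close>,
  the cardinalities leave a single added edge, which \<open>the_elem\<close> extracts.\<close>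

definition TA :: "nat \<Rightarrow> nat \<Rightarrow> nat \<Rightarrow> ('v, 'k) mpoly" where
  "TA i p q = (if p < rk i \<and> q < rk (Suc i) \<and> en i p \<subseteq> en (Suc i) q
    then single (sqf (\<Union>(en (Suc i) q) - \<Union>(en i p))) (\<tau> (the_elem (en (Suc i) q - en i p)) (en i p))
    else 0)"
definition idx :: "nat \<Rightarrow> 'v set set \<Rightarrow> nat" where "idx i = inv_into {..<rk i} (en i)"
text \<open>Translates vectors indexed by numbers into functions on sets of edges, where the
  multigraded argument applies.\<close>

definition up :: "nat \<Rightarrow> (nat \<Rightarrow> ('v, 'k) mpoly) \<Rightarrow> 'v set set \<Rightarrow> ('v, 'k) mpoly" where
  "up i s T = (if T \<in> TS i then s (idx i T) else 0)"

lemma en': "bij_betw (en i) {..<rk i} (TS i)" using en[of i] by (simp add: rk_def TS_def)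

lemma en_TS: "q < rk i \<Longrightarrow> en i q \<in> TS i" using en' bij_betwE by blast

lemma idx: "T \<in> TS i \<Longrightarrow> idx i T < rk i \<and> en i (idx i T) = T" "q < rk i \<Longrightarrow> idx i (en i q) = q"
proof -
  show "T \<in> TS i \<Longrightarrow> idx i T < rk i \<and> en i (idx i T) = T"
    unfolding idx_def using en'[of i] by (metis bij_betw_imp_surj_on f_inv_into_f inv_into_into lessThan_iff)
  show "q < rk i \<Longrightarrow> idx i (en i q) = q"
    unfolding idx_def using en'[of i] by (simp add: bij_betw_def)
qed

lemma up_en: "q < rk i \<Longrightarrow> up i s (en i q) = s q" by (simp add: up_def en_TS idx)

lemma finTS: "T \<in> TS i \<Longrightarrow> finite T" "finite (TS i)"
  using finEd by (auto simp: TS_def finite_subset)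

lemma finU: "T \<in> TS i \<Longrightarrow> finite (\<Union>T)"
  using T.finL[of T] by (simp add: TS_def T.L_def)

lemma L_Union [simp]: "T.L T = \<Union>T" by (simp add: T.L_def)

lemma T_bd: "T.bd s T = (\<Sum>e\<in>Ed - T. single (sqf (\<Union>(insert e T) - \<Union>T)) (\<tau> e T) * s (insert e T))"
  by (simp add: T.bd_def filt_id)

lemma mat_app_TA: assumes "p < rk i" shows "mat_app (rk (Suc i)) (TA i) s p = T.bd (up (Suc i) s) (en i p)"
proof -
  define T where "T = en i p"
  have T: "T \<subseteq> Ed" "card T = i" "finite T" using en_TS[OF assms] finTS(1)[OF en_TS[OF assms]]
    by (simp_all add: T_def TS_def)
  define F where "F T' = single (sqf (\<Union>T' - \<Union>T)) (\<tau> (the_elem (T' - T)) T) * up (Suc i) s T'" for T'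
  have "mat_app (rk (Suc i)) (TA i) s p = (\<Sum>q<rk (Suc i). if T \<subseteq> en (Suc i) q then F (en (Suc i) q) else 0)"
    unfolding mat_app_def by (rule sum.cong) (auto simp: TA_def F_def T_def assms up_en)
  also have "\<dots> = (\<Sum>T'\<in>TS (Suc i). if T \<subseteq> T' then F T' else 0)"
    by (rule sum.reindex_bij_betw[OF en'])
  also have "\<dots> = (\<Sum>e\<in>Ed - T. F (insert e T))"
  proof -
    have "(\<Sum>e\<in>Ed - T. F (insert e T)) = sum F ((\<lambda>e. insert e T) ` (Ed - T))"
      by (rule sum.reindex[symmetric, unfolded o_def]) (auto simp: inj_on_def)
    also have "(\<lambda>e. insert e T) ` (Ed - T) = {T'\<in>TS (Suc i). T \<subseteq> T'}"
    proof
      show "(\<lambda>e. insert e T) ` (Ed - T) \<subseteq> {T'\<in>TS (Suc i). T \<subseteq> T'}" using T by (auto simp: TS_def)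
      show "{T'\<in>TS (Suc i). T \<subseteq> T'} \<subseteq> (\<lambda>e. insert e T) ` (Ed - T)"
      proof
        fix T' assume T': "T' \<in> {T'\<in>TS (Suc i). T \<subseteq> T'}"
        then have "finite T'" using finTS(1) by blast
        then have "card (T' - T) = 1" using T' T by (simp add: card_Diff_subset TS_def)
        then obtain e where "T' - T = {e}" by (meson card_1_singletonE)
        then have "T' = insert e T" "e \<in> T' - T" using T' by auto
        then show "T' \<in> (\<lambda>e. insert e T) ` (Ed - T)" using T' by (auto simp: TS_def)
      qed
    qed
    finally show ?thesis using finTS(2) by (simp add: sum.inter_filter)
  qed
  also have "\<dots> = T.bd (up (Suc i) s) T"
    unfolding T_bd
  proof (rule sum.cong[OF refl])
    fix e assume "e \<in> Ed - T"
    then have "insert e T - T = {e}" by auto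
    then show "F (insert e T) = single (sqf (\<Union>(insert e T) - \<Union>T)) (\<tau> e T) * up (Suc i) s (insert e T)"
      by (simp add: F_def)
  qed
  finally show ?thesis by (simp add: T_def)
qed

lemma mat_app_TA0: "rk i \<le> p \<Longrightarrow> mat_app (rk (Suc i)) (TA i) s p = 0"
  by (simp add: mat_app_def TA_def)

lemma bd_up_support: "T \<notin> TS i \<Longrightarrow> T.bd (up (Suc i) s) T = 0"
  unfolding T_bd
proof (rule sum.neutral, rule ballI)
  fix e assume T: "T \<notin> TS i" "e \<in> Ed - T"
  have "insert e T \<notin> TS (Suc i)"
  proof
    assume a: "insert e T \<in> TS (Suc i)"
    then have "finite T" using finTS(1) by (metis finite_insert)
    then show False using a T by (auto simp: TS_def)
  qed
  then show "single (sqf (\<Union>(insert e T) - \<Union>T)) (\<tau> e T) * up (Suc i) s (insert e T) = 0"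
    by (simp add: up_def)
qed

lemma up_mat_app: "up i (mat_app (rk (Suc i)) (TA i) s) = T.bd (up (Suc i) s)"
proof (rule ext)
  fix T show "up i (mat_app (rk (Suc i)) (TA i) s) T = T.bd (up (Suc i) s) T"
  proof (cases "T \<in> TS i")
    case True
    then show ?thesis using idx(1)[OF True] by (simp add: up_def mat_app_TA)
  next
    case False
    then show ?thesis by (simp add: up_def bd_up_support)
  qed
qed

lemma up_inject:
  assumes "s \<in> free_module V (rk i)" "s' \<in> free_module V (rk i)" "up i s = up i s'" shows "s = s'"
proof (rule ext)
  fix q show "s q = s' q"
  proof (cases "q < rk i")
    case True
    then show ?thesis using up_en[of q i s] up_en[of q i s'] assms(3) by simp
  next
    case False
    then show ?thesis using assms by (simp add: free_module_def)
  qed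
qed

lemma TA_PR: "TA i p q \<in> PR V" "homogeneous (dg (Suc i) q - dg i p) (TA i p q)"
proof -
  show "TA i p q \<in> PR V"
  proof (cases "p < rk i \<and> q < rk (Suc i)")
    case True
    then have "en (Suc i) q \<in> TS (Suc i)" using en_TS by blast
    then have "\<Union>(en (Suc i) q) \<subseteq> V" "finite (\<Union>(en (Suc i) q))" using Ed finU by (auto simp: TS_def)
    then show ?thesis by (auto simp: TA_def intro!: PR_single)
  qed (auto simp: TA_def)
  show "homogeneous (dg (Suc i) q - dg i p) (TA i p q)"
  proof (cases "p < rk i \<and> q < rk (Suc i) \<and> en i p \<subseteq> en (Suc i) q")
    case True
    then have f: "finite (\<Union>(en (Suc i) q))" using en_TS finU by blast
    have s: "\<Union>(en i p) \<subseteq> \<Union>(en (Suc i) q)" using True by blast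
    then have "card (\<Union>(en (Suc i) q) - \<Union>(en i p)) = card (\<Union>(en (Suc i) q)) - card (\<Union>(en i p))"
      "card (\<Union>(en i p)) \<le> card (\<Union>(en (Suc i) q))"
      using f by (auto simp: card_Diff_subset finite_subset card_mono)
    then show ?thesis using f True by (auto simp: TA_def dg_def intro!: homogeneous_single)
  qed (auto simp: TA_def)
qed

text \<open>No monomial is discarded here, so each edge dividing the multidegree is a cone point of
  the strand. Exactness thus only requires that such an edge exists.\<close>

lemma cycle_in_image:
  assumes s: "s \<in> free_module V (rk i)" and cyc: "T.bd (up i s) = (\<lambda>T. 0)"
    and cone: "\<And>\<alpha>. \<alpha> \<in> T.mdegs (up i s) \<Longrightarrow> \<exists>e\<in>Ed. e \<subseteq> keys \<alpha>"
  shows "s \<in> mat_app (rk (Suc i)) (TA i) ` free_module V (rk (Suc i))"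
proof -
  have s0: "T \<subseteq> Ed \<and> card T = i" if "up i s T \<noteq> 0" for T
    using that by (auto simp: up_def TS_def split: if_splits)
  have cone': "\<exists>e0\<in>T.Ea \<alpha>. \<forall>T. T \<subseteq> T.Ea \<alpha> \<longrightarrow> e0 \<notin> T \<longrightarrow> T.face \<alpha> (insert e0 T) \<longrightarrow> T.face \<alpha> T"
    if \<alpha>: "\<alpha> \<in> T.mdegs (up i s)" for \<alpha>
  proof -
    obtain e where "e \<in> Ed" "e \<subseteq> keys \<alpha>" using cone[OF \<alpha>] by blast
    then show ?thesis by (intro bexI[of _ e]) (auto simp: T.face_def T.Ea_def)
  qed
  obtain t where t: "\<And>T. t T \<noteq> 0 \<Longrightarrow> T \<subseteq> Ed \<and> card T = Suc i"
    "\<And>T \<nu>. \<nu> \<in> keys (t T) \<Longrightarrow> True \<and> \<nu> + sqf (T.L T) \<in> T.mdegs (up i s)" "T.bd t = up i s"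
    by (rule T.exact_cone[OF s0 TrueI cyc cone']; (assumption | (rule that; blast)))
  define s' where "s' q = (if q < rk (Suc i) then t (en (Suc i) q) else 0)" for q
  have "t T \<in> PR V" for T
    unfolding PR_iff
  proof
    fix \<nu> assume "\<nu> \<in> keys (t T)"
    then have "\<nu> + sqf (\<Union>T) \<in> T.mdegs (up i s)" using t(2) by simp
    then obtain T' \<nu>' where T': "T' \<subseteq> Ed" "\<nu>' \<in> keys (up i s T')" "\<nu> + sqf (\<Union>T) = \<nu>' + sqf (\<Union>T')"
      by (auto simp: T.mdegs_def)
    have "up i s T' \<in> PR V" using s idx by (auto simp: up_def free_module_def)
    moreover have "\<Union>T' \<subseteq> V" "finite (\<Union>T')" using T'(1) Ed T.finL[of T'] by auto
    ultimately have "keys (\<nu>' + sqf (\<Union>T')) \<subseteq> V" using T'(2) by (auto simp: keys_add_nat PR_iff)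
    moreover have "keys \<nu> \<subseteq> keys (\<nu> + sqf (\<Union>T))" by (simp add: keys_add_nat)
    ultimately show "keys \<nu> \<subseteq> V" using T'(3) by simp
  qed
  then have s': "s' \<in> free_module V (rk (Suc i))" by (auto simp: free_module_def s'_def)
  have "up (Suc i) s' T = t T" for T
  proof (cases "T \<in> TS (Suc i)")
    case True
    then show ?thesis using idx(1)[OF True] by (simp add: up_def s'_def)
  next
    case False
    then show ?thesis using t(1)[of T] by (auto simp: up_def TS_def)
  qed
  then have "up (Suc i) s' = t" by blast
  then have "up i (mat_app (rk (Suc i)) (TA i) s') = up i s" using t(3) up_mat_app by simp
  moreover have "mat_app (rk (Suc i)) (TA i) s' \<in> free_module V (rk i)"
    using s' TA_PR(1) by (auto simp: free_module_def mat_app_TA0) (auto simp: mat_app_def intro!: PR_sum PR_mult)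
  ultimately have "mat_app (rk (Suc i)) (TA i) s' = s" using up_inject s by blast
  then show ?thesis using s' by blast
qed

lemma TS0: "TS 0 = {{}}" using finEd by (auto simp: TS_def finite_subset)

lemma rk0: "rk 0 = 1" "en 0 0 = {}"
proof -
  show "rk 0 = 1" by (simp add: rk_def TS0)
  then show "en 0 0 = {}" using en_TS[of 0 0] by (simp add: TS0)
qed

lemma resolves_taylor: "resolves rk dg TA (\<lambda>_. 1)"
  unfolding resolves_def
proof (intro conjI allI impI ballI)
  show "TA i p q \<in> PR V" "homogeneous (dg (Suc i) q - dg i p) (TA i p q)" for i p q by (rule TA_PR)+
  show "TA i p q = 0" if "rk i \<le> p \<or> rk (Suc i) \<le> q" for i p q using that by (auto simp: TA_def)
  show "1 \<in> PR V" by simp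
  show "homogeneous (dg 0 q) 1" if "q < rk 0" for q
    using that rk0 by (simp add: homogeneous_def dg_def)
  show "\<exists>s\<in>free_module V (rk 0). nf (\<Sum>q<rk 0. s q * 1) = nf p" if "p \<in> PR V" for p
    by (rule bexI[of _ "\<lambda>q. if q = 0 then p else 0"]) (auto simp: rk0 free_module_def that)
  show "nf (\<Sum>q<rk 0. s q * 1) = 0 \<longleftrightarrow> s \<in> mat_app (rk 1) (TA 0) ` free_module V (rk 1)"
    if s: "s \<in> free_module V (rk 0)" for s
  proof
    assume "nf (\<Sum>q<rk 0. s q * 1) = 0"
    then have nf0: "nf (s 0) = 0" by (simp add: rk0)
    have up0: "up 0 s T = (if T = {} then s 0 else 0)" for T
      using up_en[of 0 0 s] by (simp add: rk0 up_def TS0)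
    have "s \<in> mat_app (rk (Suc 0)) (TA 0) ` free_module V (rk (Suc 0))"
    proof (rule cycle_in_image[OF s])
      show "T.bd (up 0 s) = (\<lambda>T. 0)" by (simp add: T_bd up0 fun_eq_iff)
      \<comment> \<open>In homological degree 0 the multidegrees are just the monomials of
        \<open>s 0\<close>; as these lie in the ideal, each is divisible by an edge.\<close>
      fix \<alpha> assume "\<alpha> \<in> T.mdegs (up 0 s)"
      then have "\<alpha> \<in> keys (s 0)" by (auto simp: T.mdegs_def up0 split: if_splits)
      then have "\<not> Nf \<alpha>" using nf0 keys_filt[of Nf "s 0"] by auto
      then show "\<exists>e\<in>Ed. e \<subseteq> keys \<alpha>" by (simp add: Nf_def indep_def)
    qed
    then show "s \<in> mat_app (rk 1) (TA 0) ` free_module V (rk 1)" by simp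
  next
    assume "s \<in> mat_app (rk 1) (TA 0) ` free_module V (rk 1)"
    then obtain t where t: "s = mat_app (rk (Suc 0)) (TA 0) t" by auto
    have "s 0 = T.bd (up 1 t) {}" using mat_app_TA[of 0 0 t] by (simp add: t rk0)
    also have "nf \<dots> = 0"
      unfolding T_bd filt_sum
    proof (rule sum.neutral, rule ballI)
      fix e assume e: "e \<in> Ed - {}"
      have "finite e" using e Ed finV finite_subset by blast
      then have "nf (single (sqf e) (\<tau> e {})) = 0"
        using e by (intro filt_eq_0) (auto simp: Nf_def indep_def split: if_splits)
      then show "nf (single (sqf (\<Union>(insert e {}) - \<Union>{})) (\<tau> e {}) * up 1 t (insert e {})) = 0"
        using nf_mult_eq_0(2) by simp
    qed
    finally show "nf (\<Sum>q<rk 0. s q * 1) = 0" by (simp add: rk0)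
  qed
  show "mat_app (rk (Suc i)) (TA i) s = (\<lambda>p. 0) \<longleftrightarrow>
        s \<in> mat_app (rk (Suc (Suc i))) (TA (Suc i)) ` free_module V (rk (Suc (Suc i)))"
    if s: "s \<in> free_module V (rk (Suc i))" for i s
  proof
    assume z: "mat_app (rk (Suc i)) (TA i) s = (\<lambda>p. 0)"
    show "s \<in> mat_app (rk (Suc (Suc i))) (TA (Suc i)) ` free_module V (rk (Suc (Suc i)))"
    proof (rule cycle_in_image[OF s])
      show "T.bd (up (Suc i) s) = (\<lambda>T. 0)" unfolding up_mat_app[symmetric] z by (simp add: up_def fun_eq_iff)
      \<comment> \<open>In positive homological degree \<open>T\<close> is nonempty, and any of its
        edges divides the multidegree.\<close>
      fix \<alpha> assume "\<alpha> \<in> T.mdegs (up (Suc i) s)"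
      then obtain T \<nu> where T: "T \<subseteq> Ed" "\<nu> \<in> keys (up (Suc i) s T)" "\<alpha> = \<nu> + sqf (\<Union>T)"
        by (auto simp: T.mdegs_def)
      have "T \<in> TS (Suc i)" using T(2) by (auto simp: up_def split: if_splits)
      then have "T \<noteq> {}" by (auto simp: TS_def)
      then obtain e where e: "e \<in> T" by blast
      moreover have "finite (\<Union>T)" using finU \<open>T \<in> TS (Suc i)\<close> by blast
      ultimately have "e \<subseteq> keys \<alpha>" using T(3) by (auto simp: keys_add_nat)
      then show "\<exists>e\<in>Ed. e \<subseteq> keys \<alpha>" using e T(1) by blast
    qed
  next
    assume "s \<in> mat_app (rk (Suc (Suc i))) (TA (Suc i)) ` free_module V (rk (Suc (Suc i)))"
    then obtain t where t: "s = mat_app (rk (Suc (Suc i))) (TA (Suc i)) t" by blast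
    have t0: "T \<subseteq> Ed" if "up (Suc (Suc i)) t T \<noteq> 0" for T
      using that by (auto simp: up_def TS_def split: if_splits)
    show "mat_app (rk (Suc i)) (TA i) s = (\<lambda>p. 0)"
    proof (rule ext)
      fix p show "mat_app (rk (Suc i)) (TA i) s p = 0"
      proof (cases "p < rk i")
        case True
        then show ?thesis unfolding mat_app_TA[OF True] t up_mat_app by (rule_tac T.bd_bd[OF t0])
      qed (simp add: mat_app_TA0)
    qed
  qed
qed

end

lemma (in edge_quotient) resolution_exists: "\<exists>r d A h. resolves r d A h"
proof -
  obtain \<tau> :: "'v set \<Rightarrow> 'v set set \<Rightarrow> 'k" where \<tau>: "alt_sign Ed \<tau>" using alt_sign_exists[OF finEd] by blast
  have "\<exists>f. bij_betw f {..<card {T. T \<subseteq> Ed \<and> card T = i}} {T. T \<subseteq> Ed \<and> card T = i}" for i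
    using ex_bij_betw_nat_finite[of "{T. T \<subseteq> Ed \<and> card T = i}"] finEd by (simp add: atLeast0LessThan)
  then have en: "bij_betw (SOME f. bij_betw f {..<card {T. T \<subseteq> Ed \<and> card T = i}} {T. T \<subseteq> Ed \<and> card T = i})
      {..<card {T. T \<subseteq> Ed \<and> card T = i}} {T. T \<subseteq> Ed \<and> card T = i}" for i
    by (rule someI_ex)
  interpret taylor_resolution V Ed K \<tau>
    "\<lambda>i. SOME f. bij_betw f {..<card {T. T \<subseteq> Ed \<and> card T = i}} {T. T \<subseteq> Ed \<and> card T = i}"
    by unfold_locales (rule \<tau> en)+
  show ?thesis using resolves_taylor by blast
qed

section \<open>Regularity of chordal graphs\<close>

definition ind_num :: "'v set set \<Rightarrow> nat" where
  "ind_num Ed = Max (card ` {Mt. ind_matching Ed Mt})"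

lemma ind_num_ge: "finite Ed \<Longrightarrow> ind_matching Ed Mt \<Longrightarrow> card Mt \<le> ind_num Ed"
  unfolding ind_num_def
  by (rule Max_ge) (auto simp: ind_matching_def intro!: finite_imageI finite_subset[of _ "Pow Ed"])

lemma ind_num_attained:
  assumes "finite Ed" "{} \<notin> Ed" obtains Mt where "ind_matching Ed Mt" "card Mt = ind_num Ed"
proof -
  have "ind_matching Ed {}" using assms(2) by (auto simp: ind_matching_def)
  moreover have "finite {Mt. ind_matching Ed Mt}"
    by (rule finite_subset[of _ "Pow Ed"]) (auto simp: ind_matching_def assms)
  ultimately have "ind_num Ed \<in> card ` {Mt. ind_matching Ed Mt}"
    unfolding ind_num_def by (intro Max_in) auto
  then obtain Mt where "ind_num Ed = card Mt" "ind_matching Ed Mt" by auto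
  then show ?thesis using that[of Mt] by simp
qed

section \<open>Vanishing and nonvanishing of Koszul homology\<close>

context koszul begin

lemma koszul_SI_D:
  assumes "c \<in> koszul_SI j q"
  shows "c T \<noteq> 0 \<Longrightarrow> T \<subseteq> V \<and> card T = q" "c T \<in> PR V" "homogeneous (j - int q) (c T)" "nf (c T) = c T"
    "\<nu> \<in> keys (c T) \<Longrightarrow> Nf \<nu>"
proof -
  show "c T \<noteq> 0 \<Longrightarrow> T \<subseteq> V \<and> card T = q" "c T \<in> PR V" "homogeneous (j - int q) (c T)"
    and nf: "nf (c T) = c T" using assms by (auto simp: koszul_SI_def)
  show "\<nu> \<in> keys (c T) \<Longrightarrow> Nf \<nu>" using keys_filt[of Nf "c T"] nf by auto
qed

lemma Ea_keys: "keys \<alpha> \<subseteq> V \<Longrightarrow> KM.Ea \<alpha> = keys \<alpha>"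
  by (auto simp: KM.Ea_def)

lemma keys_diff_sqf: "finite T \<Longrightarrow>
    keys (\<alpha> - sqf T) = (keys \<alpha> - T) \<union> {v. lookup \<alpha> v \<ge> 2}"
  by (auto simp: in_keys_iff lookup_minus lookup_sqf split: if_splits)

text \<open>A variable whose square divides \<open>\<alpha>\<close> is a cone point of the strand of multidegree \<open>\<alpha>\<close>; in
  squarefree multidegrees the strand computes the cohomology of an independence complex.\<close>

lemma strand_exact:
  assumes ch: "chordal Ed V"
    and no: "\<not> (\<exists>Mt. ind_matching Ed Mt \<and> finite Mt \<and> card Mt = k)"
    and \<alpha>: "keys \<alpha> \<subseteq> V" "mon_degree \<alpha> = i + k"
    and cyc: "\<And>T. KM.face \<alpha> T \<Longrightarrow> Suc (card T) = i \<Longrightarrow> bdry (KM.Ea \<alpha>) \<sigma> c T = 0"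
  shows "\<exists>b. \<forall>T. KM.face \<alpha> T \<longrightarrow> card T = i \<longrightarrow> bdry (KM.Ea \<alpha>) \<sigma> b T = c T"
proof (cases "\<exists>p. lookup \<alpha> p \<ge> 2")
  case True
  then obtain p where p: "lookup \<alpha> p \<ge> 2" by blast
  then have pE: "p \<in> KM.Ea \<alpha>" unfolding Ea_keys[OF \<alpha>(1)] by (simp add: in_keys_iff)
  have "\<exists>b. \<forall>T. T \<subseteq> KM.Ea \<alpha> \<longrightarrow> KM.face \<alpha> T \<longrightarrow> card T = i \<longrightarrow> bdry (KM.Ea \<alpha>) \<sigma> b T = c T"
  proof (rule cone_exact[OF KM.Ea(2,3) pE])
    fix T assume T: "T \<subseteq> KM.Ea \<alpha>" "p \<notin> T"
    then have "finite T" using KM.Ea(2) finite_subset by blast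
    then have "keys (\<alpha> - sqf (insert p T)) = keys (\<alpha> - sqf T)"
      using p by (subst (1 2) keys_diff_sqf) auto
    then show "KM.face \<alpha> (insert p T) = KM.face \<alpha> T" using T pE by (simp add: KM.face_def Nf_def)
  qed (use cyc in blast)
  then show ?thesis by (auto simp: KM.face_def)
next
  case False
  define U where "U = keys \<alpha>"
  have EU: "KM.Ea \<alpha> = U" using Ea_keys[OF \<alpha>(1)] by (simp add: U_def)
  have finU: "finite U" by (simp add: U_def)
  have lk: "lookup \<alpha> u = 1" if "u \<in> U" for u
  proof -
    have "lookup \<alpha> u \<noteq> 0" "\<not> 2 \<le> lookup \<alpha> u"
      using that False by (auto simp: U_def in_keys_iff)
    then show ?thesis by linarith
  qed
  have "mon_degree \<alpha> = card U" unfolding mon_degree_def using lk by (simp add: U_def)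
  then have card: "card U = i + k" using \<alpha>(2) by simp
  have face: "KM.face \<alpha> T \<longleftrightarrow> T \<subseteq> U \<and> indep Ed (U - T)" for T
  proof (cases "T \<subseteq> U")
    case T: True
    then have "finite T" using finU finite_subset by blast
    then have "keys (\<alpha> - sqf T) = U - T" using False by (simp add: keys_diff_sqf U_def)
    then show ?thesis using T by (simp add: KM.face_def EU Nf_def)
  qed (simp add: KM.face_def EU)
  have "\<exists>b. \<forall>T. T \<subseteq> U \<longrightarrow> indep Ed (U - T) \<longrightarrow> card T + k = card U \<longrightarrow> bdry U \<sigma> b T = c T"
  proof (rule indep_exact)
    show "\<forall>e\<in>Ed. card e = 2" using Ed by blast
    show "chordal Ed U" using chordal_mono[OF ch] \<alpha>(1) by (simp add: U_def)
    show "alt_sign U \<sigma>" using alt_sign_mono[OF \<sigma>] \<alpha>(1) by (simp add: U_def)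
    show "\<not> (\<exists>Mt. ind_matching Ed Mt \<and> \<Union>Mt \<subseteq> U \<and> finite Mt \<and> card Mt = k)" using no by blast
    show "bdry U \<sigma> c T = 0" if "T \<subseteq> U" "indep Ed (U - T)" "Suc (card T) + k = card U" for T
      using cyc[of T] that by (simp add: face EU card)
  qed (rule finU)
  then show ?thesis by (simp add: face EU card imp_conjL)
qed

text \<open>In a squarefree multidegree of degree \<open>j\<close>, a set of \<open>i\<close>
  variables has an independent complement of \<open>j - i\<close> vertices. This is the size of
  induced matching that could obstruct exactness, and hence the upper bound on the
  regularity.\<close>

lemma koszul_exact:
  assumes ch: "chordal Ed V"
    and no: "int i \<le> j \<Longrightarrow> \<not> (\<exists>Mt. ind_matching Ed Mt \<and> finite Mt \<and> card Mt = nat (j - int i))"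
  shows "exact_at (koszul_SI j) (\<lambda>_. KM.bd) i"
  unfolding exact_at_def
proof (intro ballI impI)
  fix c assume c: "c \<in> koszul_SI j i" and cyc: "\<forall>l. i = Suc l \<longrightarrow> KM.bd c = 0"
  note cD = koszul_SI_D[OF c]
  show "c \<in> KM.bd ` koszul_SI j (Suc i)"
  proof (cases "int i \<le> j")
    case False
    \<comment> \<open>The coefficients would have the negative degree \<open>j - i\<close>.\<close>
    have "c T = 0" for T
    proof -
      have "keys (c T) = {}" using cD(3)[of T] False unfolding homogeneous_def by force
      then show ?thesis by simp
    qed
    then have "c = KM.bd (\<lambda>T. 0)" by (simp add: KM_bd fun_eq_iff)
    moreover have "(\<lambda>T. 0) \<in> koszul_SI j (Suc i)" by (simp add: koszul_SI_def)
    ultimately show ?thesis by blast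
  next
    case True
    define k where "k = nat (j - int i)"
    have md: "keys \<alpha> \<subseteq> V \<and> mon_degree \<alpha> = i + k" if \<alpha>: "\<alpha> \<in> KM.mdegs c" for \<alpha>
    proof -
      obtain T \<nu> where T: "T \<subseteq> V" "\<nu> \<in> keys (c T)" "\<alpha> = \<nu> + sqf T"
        using \<alpha> by (auto simp: KM.mdegs_def)
      have "finite T" using T(1) finV finite_subset by blast
      moreover have "c T \<noteq> 0" using T(2) by auto
      then have "card T = i" using cD(1) by blast
      moreover have "int (mon_degree \<nu>) = j - int i" using cD(3)[of T] T(2) unfolding homogeneous_def by blast
      moreover have "keys \<nu> \<subseteq> V" using cD(2)[of T] T(2) by (auto simp: PR_iff)
      ultimately show ?thesis using T True by (auto simp: keys_add_nat k_def)
    qed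
    have ex: "\<exists>b. \<forall>T. KM.face \<alpha> T \<longrightarrow> card T = i \<longrightarrow> bdry (KM.Ea \<alpha>) \<sigma> b T = KM.strand \<alpha> c T"
      if \<alpha>: "\<alpha> \<in> KM.mdegs c" for \<alpha>
    proof (rule strand_exact[OF ch])
      show "\<not> (\<exists>Mt. ind_matching Ed Mt \<and> finite Mt \<and> card Mt = k)" using no[OF True] by (simp add: k_def)
      show "keys \<alpha> \<subseteq> V" "mon_degree \<alpha> = i + k" using md[OF \<alpha>] by auto
      fix T assume T: "KM.face \<alpha> T" "Suc (card T) = i"
      then have "KM.bd c = 0" using cyc by blast
      then have "KM.bd c = (\<lambda>T. 0)" by (simp add: zero_fun_def)
      then show "bdry (KM.Ea \<alpha>) \<sigma> (KM.strand \<alpha> c) T = 0" using KM.strand_cycle T(1) by blast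
    qed
    obtain t where t: "\<And>T. t T \<noteq> 0 \<Longrightarrow> T \<subseteq> V \<and> card T = Suc i"
      "\<And>T \<nu>. \<nu> \<in> keys (t T) \<Longrightarrow> Nf \<nu> \<and> \<nu> + sqf (KM.L T) \<in> KM.mdegs c" "KM.bd t = c"
      by (rule KM.exact_lift[OF cD(1,5) ex]; (assumption | (rule that; blast)))
    have "t \<in> koszul_SI j (Suc i)"
      unfolding koszul_SI_def
    proof (intro CollectI allI conjI impI)
      fix T
      have kT: "keys \<nu> \<subseteq> V \<and> int (mon_degree \<nu>) = j - int (Suc i) \<and> Nf \<nu>"
        if \<nu>: "\<nu> \<in> keys (t T)" for \<nu>
      proof -
        have "t T \<noteq> 0" using \<nu> by auto
        then have T: "T \<subseteq> V" "card T = Suc i" using t(1) by blast+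
        then have "finite T" using finV finite_subset by blast
        moreover have "Nf \<nu>" and md': "\<nu> + sqf T \<in> KM.mdegs c" using t(2)[OF \<nu>] by simp_all
        ultimately show ?thesis using md[OF md'] T True by (auto simp: keys_add_nat k_def)
      qed
      show "t T \<in> PR V" unfolding PR_iff using kT by blast
      show "homogeneous (j - int (Suc i)) (t T)" unfolding homogeneous_def using kT by blast
      show "nf (t T) = t T" using kT by (intro filt_id) blast
      show "T \<subseteq> V" "card T = Suc i" if "t T \<noteq> 0" using t(1)[OF that] by auto
    qed
    then show ?thesis using t(3) by blast
  qed
qed

text \<open>The lower bound, found in the multidegree of the product of all \<open>2 * i\<close>
  matched vertices. The induced subgraph on these has no other edges, so its independence complex is
  the boundary of the cross polytope.\<close>

lemma koszul_not_exact:
  assumes Mt: "ind_matching Ed Mt" and card: "card Mt = i"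
  shows "\<not> exact_at (koszul_SI (2 * int i)) (\<lambda>_. KM.bd) i"
proof
  assume exact: "exact_at (koszul_SI (2 * int i)) (\<lambda>_. KM.bd) i"
  define U where "U = \<Union>Mt"
  have MtEd: "Mt \<subseteq> Ed" "\<forall>e\<in>Mt. card e = 2" using Mt Ed by (auto simp: ind_matching_def)
  have disj: "\<forall>e\<in>Mt. \<forall>e'\<in>Mt. e \<noteq> e' \<longrightarrow> e \<inter> e' = {}" using Mt by (simp add: ind_matching_def)
  have indU: "e \<in> Mt" if "e \<in> Ed" "e \<subseteq> U" for e using Mt that by (simp add: ind_matching_def U_def)
  have finMt: "finite Mt" using MtEd finEd finite_subset by blast
  have UV: "U \<subseteq> V" using MtEd Ed by (auto simp: U_def)
  have finU: "finite U" using UV finV finite_subset by blast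
  have "\<exists>x. x \<in> e" if "e \<in> Mt" for e using MtEd(2) that by (metis card.empty ex_in_conv zero_neq_numeral)
  then obtain pick where pick: "\<And>e. e \<in> Mt \<Longrightarrow> pick e \<in> e" by metis
  define A0 where "A0 = pick ` Mt"
  have A0e: "A0 \<inter> e = {pick e}" if em: "e \<in> Mt" for e
  proof -
    have eq: "pick e' = pick e" if e': "e' \<in> Mt" "pick e' \<in> e" for e'
    proof (rule ccontr)
      assume "pick e' \<noteq> pick e"
      then have "e' \<noteq> e" by blast
      then have "e' \<inter> e = {}" using disj e'(1) em by simp
      then show False using pick[OF e'(1)] e'(2) by blast
    qed
    show ?thesis
    proof (intro equalityI subsetI)
      fix x assume "x \<in> A0 \<inter> e"
      then obtain e' where "e' \<in> Mt" "x = pick e'" "pick e' \<in> e" by (auto simp: A0_def)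
      then show "x \<in> {pick e}" using eq by simp
    qed (use pick[OF em] em in \<open>auto simp: A0_def\<close>)
  qed
  have A0: "transversal Mt A0" unfolding transversal_def A0_def
  proof (intro conjI ballI subsetI)
    show "\<exists>x. pick ` Mt \<inter> e = {x}" if "e \<in> Mt" for e using A0e[OF that] by (auto simp: A0_def)
    show "x \<in> \<Union>Mt" if "x \<in> pick ` Mt" for x using that pick by blast
  qed
  have A0U: "A0 \<subseteq> U" using pick by (auto simp: A0_def U_def)
  have cardA0: "card A0 = i"
  proof -
    have "inj_on pick Mt"
    proof (rule inj_onI)
      fix e e' assume "e \<in> Mt" "e' \<in> Mt" "pick e = pick e'"
      then show "e = e'" using disj pick[of e] pick[of e'] by auto
    qed
    then show ?thesis by (simp add: A0_def card_image card)
  qed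
  have cardU: "card U = 2 * i"
  proof -
    have "finite e" if "e \<in> Mt" for e using MtEd(2) that card.infinite by fastforce
    then have "card U = (\<Sum>e\<in>Mt. card e)"
      unfolding U_def using disj by (intro card_Union_disjoint) (auto simp: pairwise_def disjnt_def)
    then show ?thesis using MtEd(2) card by simp
  qed
  have indA: "indep Ed (U - A)" if "transversal Mt A" for A
    unfolding indep_def
  proof (intro ballI notI)
    fix e assume e: "e \<in> Ed" "e \<subseteq> U - A"
    then have "e \<in> Mt" using indU by blast
    then show False using that e unfolding transversal_def by blast
  qed
  have finUA: "finite (U - A)" for A using finU by blast
  \<comment> \<open>A single facet: one end of each edge as the exterior part, the product of the
    other ends as the coefficient.\<close>
  define c :: "'v set \<Rightarrow> ('v, 'k) mpoly" where
    "c T = (if T = A0 then single (sqf (U - A0)) 1 else 0)" for T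
  have c: "c \<in> koszul_SI (2 * int i) i"
  proof -
    have "card (U - A0) = i" using A0U finU cardU cardA0 by (simp add: card_Diff_subset finite_subset)
    then have "single (sqf (U - A0)) 1 \<in> PR V"
      "homogeneous (2 * int i - int i) (single (sqf (U - A0)) (1 :: 'k))"
      using finUA[of A0] UV by (auto intro!: PR_single homogeneous_single)
    moreover have "nf (single (sqf (U - A0)) 1) = single (sqf (U - A0)) (1 :: 'k)"
      using indA[OF A0] finUA by (intro filt_id) (simp add: Nf_def)
    ultimately show ?thesis using A0U UV cardA0 by (auto simp: koszul_SI_def c_def)
  qed
  have "KM.bd c T = 0" for T
    unfolding KM_bd
  proof (rule sum.neutral, rule ballI)
    fix e assume e: "e \<in> V - T"
    show "nf (single (single e 1) (\<sigma> e T) * c (insert e T)) = 0"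
    proof (cases "insert e T = A0")
      case True
      then have "e \<in> A0" by blast
      then obtain m where m: "m \<in> Mt" "e = pick m" by (auto simp: A0_def)
      \<comment> \<open>The coefficient contains the other end of the matching edge at
        \<open>e\<close>, so multiplying it by the variable of \<open>e\<close> lands in the
        ideal.\<close>
      have "m \<subseteq> insert e (U - A0)" using A0e[OF m(1)] m by (auto simp: U_def)
      then have "\<not> Nf (single e 1 + sqf (U - A0))"
        using m(1) MtEd finUA[of A0] unfolding Nf_def indep_def keys_add_nat by auto
      then show ?thesis by (intro filt_eq_0) (auto simp: c_def True mult_single split: if_splits)
    qed (simp add: c_def)
  qed
  then have "KM.bd c = 0" by (simp add: fun_eq_iff)
  then obtain b where b: "KM.bd b = c" using exact c unfolding exact_at_def by (metis imageE)
  define \<alpha> where "\<alpha> = sqf U"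
  have EU: "KM.Ea \<alpha> = U" using Ea_keys[of \<alpha>] UV finU by (simp add: \<alpha>_def)
  show False
  proof (rule transversal_not_boundary[OF finMt MtEd(2) disj _ A0])
    show "alt_sign (\<Union>Mt) \<sigma>" using alt_sign_mono[OF \<sigma> UV] by (simp add: U_def)
    fix A assume A: "transversal Mt A"
    then have AU: "A \<subseteq> U" by (simp add: transversal_def U_def)
    then have finA: "finite A" using finU finite_subset by blast
    have diff: "sqf U - sqf A = sqf (U - A)"
      by (rule poly_mapping_eqI) (use AU finA finU in \<open>auto simp: lookup_minus lookup_sqf\<close>)
    have f: "KM.face \<alpha> A" unfolding KM.face_def EU using AU indA[OF A] finUA by (simp add: \<alpha>_def diff Nf_def)
    have "bdry (\<Union>Mt) \<sigma> (KM.strand \<alpha> b) A = KM.strand \<alpha> c A"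
      using KM.strand_bd[OF f, of b] by (simp add: b EU U_def)
    also have "\<dots> = (if A = A0 then 1 else 0)"
      using AU finU by (simp add: KM.strand_def \<alpha>_def diff c_def)
    finally show "bdry (\<Union>Mt) \<sigma> (KM.strand \<alpha> b) A = (if A = A0 then 1 else 0)" .
  qed
qed

text \<open>From left to right the unknown resolution is compared with the Koszul complex; from
  right to left some resolution must be exhibited, and the Taylor resolution serves.\<close>

lemma tor_nonzero_iff:
  "tor_nonzero V SI (quotient_grading V I) i j \<longleftrightarrow> \<not> exact_at (koszul_SI j) (\<lambda>_. KM.bd) i"
proof -
  have tor: "tor_cycles r d A i j = tor_boundaries r d A i j \<longleftrightarrow> exact_at (koszul_SI j) (\<lambda>_. KM.bd) i"
    if "resolves r d A h" for r d A h
  proof -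
    interpret koszul_resolution V Ed K \<sigma> r d A h j by unfold_locales (rule that)
    show ?thesis by (rule tor_iff_koszul)
  qed
  obtain r d A h where res: "resolves r d A h" using resolution_exists by blast
  show ?thesis
  proof
    assume "tor_nonzero V SI (quotient_grading V I) i j"
    then obtain r d A g where g: "graded_free_resolution V SI (quotient_grading V I) r d A g"
      "tor_cycles r d A i j \<noteq> tor_boundaries r d A i j" unfolding tor_nonzero_def by blast
    from iffD1[OF graded_free_resolution_iff g(1)] obtain h where "resolves r d A h" by blast
    from tor[OF this] g(2) show "\<not> exact_at (koszul_SI j) (\<lambda>_. KM.bd) i" by simp
  next
    assume "\<not> exact_at (koszul_SI j) (\<lambda>_. KM.bd) i"
    moreover have "graded_free_resolution V SI (quotient_grading V I) r d A (\<lambda>q. I +>\<^bsub>R\<^esub> h q)"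
      by (rule iffD2[OF graded_free_resolution_iff]) (use res in blast)
    ultimately show "tor_nonzero V SI (quotient_grading V I) i j"
      unfolding tor_nonzero_def using tor[OF res] by blast
  qed
qed

lemma regularity_eq:
  assumes ch: "chordal Ed V"
  shows "regularity V SI (quotient_grading V I) = int (ind_num Ed)"
proof -
  have e0: "{} \<notin> Ed" using Ed by fastforce
  let ?S = "{j - int i | i j. tor_nonzero V SI (quotient_grading V I) i j}"
  have sub: "?S \<subseteq> {0..int (ind_num Ed)}"
  proof
    fix x assume "x \<in> ?S"
    then obtain i j where x: "x = j - int i" "\<not> exact_at (koszul_SI j) (\<lambda>_. KM.bd) i"
      using tor_nonzero_iff by blast
    then obtain Mt where Mt: "int i \<le> j" "ind_matching Ed Mt" "card Mt = nat (j - int i)"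
      using koszul_exact[OF ch, of i j] by blast
    then show "x \<in> {0..int (ind_num Ed)}" using ind_num_ge[OF finEd Mt(2)] x(1) by simp
  qed
  obtain Mt where Mt: "ind_matching Ed Mt" "card Mt = ind_num Ed"
    using ind_num_attained[OF finEd e0] .
  \<comment> \<open>The maximum is attained at homological degree equal to the induced matching
    number and twice that internal degree.\<close>
  have "tor_nonzero V SI (quotient_grading V I) (ind_num Ed) (2 * int (ind_num Ed))"
    unfolding tor_nonzero_iff by (rule koszul_not_exact[OF Mt])
  moreover have "int (ind_num Ed) = 2 * int (ind_num Ed) - int (ind_num Ed)" by simp
  ultimately have "int (ind_num Ed) \<in> ?S" by blast
  moreover have "finite ?S" using sub by (rule finite_subset) simp
  moreover have "x \<le> int (ind_num Ed)" if "x \<in> ?S" for x using subsetD[OF sub that] by simp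
  ultimately show ?thesis unfolding regularity_def by (intro Max_eqI)
qed

end

theorem edge_reg_chordal:
  assumes "finite (vertices H)" "\<And>e. e \<in> edges H \<Longrightarrow> e \<subseteq> vertices H \<and> card e = 2"
    and "chordal (edges H) (vertices H)"
  shows "edge_reg TYPE('k::field) H = int (ind_num (edges H))"
proof -
  obtain \<sigma> :: "'a \<Rightarrow> 'a set \<Rightarrow> 'k" where \<sigma>: "alt_sign (vertices H) \<sigma>"
    using alt_sign_exists[OF assms(1)] by blast
  interpret koszul "vertices H" "edges H" "TYPE('k)" \<sigma>
    by unfold_locales (use assms \<sigma> in auto)
  show ?thesis
    using regularity_eq[OF assms(3)] by (simp add: edge_reg_def SI_def I_def)
qed

section \<open>Gluing at the neighbours of two leaves\<close>

definition del :: "'v set set \<Rightarrow> 'v \<Rightarrow> 'v set set" where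
  "del E x = {e\<in>E. x \<notin> e}"

lemma del_subset: "del E x \<subseteq> E" by (auto simp: del_def)

locale edge_set =
  fixes E :: "'v set set"
  assumes fin: "finite E" and card2: "\<forall>e\<in>E. card e = 2"
begin

lemma del: "edge_set (del E x)"
  by unfold_locales (use fin card2 in \<open>auto simp: del_def\<close>)

lemma edge_other:
  assumes "e \<in> E" "x \<in> e" obtains u where "e = {u, x}" "u \<noteq> x"
proof -
  obtain a b where "e = {a, b}" "a \<noteq> b" using card2 assms(1) by (meson card_2_iff)
  then show ?thesis using that[of a] that[of b] assms(2) by auto
qed

lemma ind_num_le:
  assumes "\<And>Mt. ind_matching E Mt \<Longrightarrow> card Mt \<le> b"
  shows "ind_num E \<le> b"
proof -
  have "{} \<notin> E" using card2 by fastforce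
  from ind_num_attained[OF fin this] obtain Mt where "ind_matching E Mt" "card Mt = ind_num E" .
  then show ?thesis using assms by metis
qed

lemma ind_num_obtain:
  obtains Mt where "ind_matching E Mt" "card Mt = ind_num E"
proof -
  have "{} \<notin> E" using card2 by fastforce
  then show ?thesis using ind_num_attained[OF fin] that by blast
qed

lemma ind_matching_D:
  assumes "ind_matching E Mt"
  shows "Mt \<subseteq> E" "finite Mt" "e \<in> Mt \<Longrightarrow> e' \<in> Mt \<Longrightarrow> x \<in> e \<Longrightarrow> x \<in> e' \<Longrightarrow> e = e'"
    "e \<in> E \<Longrightarrow> e \<subseteq> \<Union>Mt \<Longrightarrow> e \<in> Mt" "{} \<notin> Mt"
proof -
  show "Mt \<subseteq> E" using assms by (simp add: ind_matching_def)
  then show "finite Mt" using fin finite_subset by blast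
  show "{} \<notin> Mt" using \<open>Mt \<subseteq> E\<close> card2 by fastforce
  show "e \<in> Mt \<Longrightarrow> e' \<in> Mt \<Longrightarrow> x \<in> e \<Longrightarrow> x \<in> e' \<Longrightarrow> e = e'"
    using assms unfolding ind_matching_def by (metis disjoint_iff)
  show "e \<in> E \<Longrightarrow> e \<subseteq> \<Union>Mt \<Longrightarrow> e \<in> Mt" using assms by (simp add: ind_matching_def)
qed

lemma ind_matchingI:
  assumes "Mt \<subseteq> E" "\<And>e e' x. e \<in> Mt \<Longrightarrow> e' \<in> Mt \<Longrightarrow> x \<in> e \<Longrightarrow> x \<in> e' \<Longrightarrow> e = e'"
    "\<And>e. e \<in> E \<Longrightarrow> e \<subseteq> \<Union>Mt \<Longrightarrow> e \<in> Mt"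
  shows "ind_matching E Mt"
  unfolding ind_matching_def
proof (intro conjI ballI impI)
  show "e \<inter> e' = {}" if "e \<in> Mt" "e' \<in> Mt" "e \<noteq> e'" for e e'
    using assms(2)[OF that(1,2)] that(3) by auto
qed (use assms in auto)

lemma ind_matching_subset:
  assumes Mt: "ind_matching E Mt" and s: "Mt' \<subseteq> Mt" shows "ind_matching E Mt'"
proof (rule ind_matchingI)
  note D = ind_matching_D[OF Mt]
  show "Mt' \<subseteq> E" using D(1) s by blast
  show "e = e'" if "e \<in> Mt'" "e' \<in> Mt'" "x \<in> e" "x \<in> e'" for e e' x
    by (rule D(3)[OF subsetD[OF s that(1)] subsetD[OF s that(2)] that(3,4)])
  fix e assume e: "e \<in> E" "e \<subseteq> \<Union>Mt'"
  then have eM: "e \<in> Mt" using D(4) s by blast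
  have "e \<noteq> {}" using D(5) eM by blast
  then obtain x where x: "x \<in> e" by blast
  then obtain e' where e': "e' \<in> Mt'" "x \<in> e'" using e(2) by blast
  then have "e = e'" using D(3)[of e e' x] eM x s by blast
  then show "e \<in> Mt'" using e'(1) by simp
qed

lemma ind_matching_del_imp:
  assumes "ind_matching (del E x) Mt" shows "ind_matching E Mt" "x \<notin> \<Union>Mt"
proof -
  interpret d: edge_set "del E x" by (rule del)
  note D = d.ind_matching_D[OF assms]
  show x: "x \<notin> \<Union>Mt" using D(1) by (auto simp: del_def)
  show "ind_matching E Mt"
  proof (rule ind_matchingI)
    show "Mt \<subseteq> E" by (rule order_trans[OF D(1) del_subset])
    show "e = e'" if "e \<in> Mt" "e' \<in> Mt" "y \<in> e" "y \<in> e'" for e e' y by (rule D(3)[OF that])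
    show "e \<in> Mt" if "e \<in> E" "e \<subseteq> \<Union>Mt" for e
      using D(4)[of e] that x by (auto simp: del_def)
  qed
qed

lemma ind_matching_to_del:
  assumes "ind_matching E Mt" "x \<notin> \<Union>Mt" shows "ind_matching (del E x) Mt"
  using assms by (auto simp: ind_matching_def del_def)

lemma card_le_ind_num: "ind_matching E Mt \<Longrightarrow> card Mt \<le> ind_num E"
  using ind_num_ge[OF fin] .

lemma card_le_ind_num_del: "ind_matching E Mt \<Longrightarrow> x \<notin> \<Union>Mt \<Longrightarrow> card Mt \<le> ind_num (del E x)"
  using ind_matching_to_del edge_set.card_le_ind_num[OF del] by blast

lemma ind_num_del_le: "ind_num (del E x) \<le> ind_num E"
  by (rule edge_set.ind_num_le[OF del]) (use ind_matching_del_imp(1) card_le_ind_num in blast)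

text \<open>At most one edge of a matching contains \<open>x\<close>.\<close>

lemma ind_num_le_del: "ind_num E \<le> Suc (ind_num (del E x))"
proof (rule ind_num_le)
  fix Mt assume Mt: "ind_matching E Mt"
  note D = ind_matching_D[OF Mt]
  show "card Mt \<le> Suc (ind_num (del E x))"
  proof (cases "x \<in> \<Union>Mt")
    case False
    then show ?thesis using card_le_ind_num_del[OF Mt] by (simp add: le_SucI)
  next
    case True
    then obtain e where e: "e \<in> Mt" "x \<in> e" by blast
    have "x \<notin> \<Union>(Mt - {e})" using D(3)[OF e(1) _ e(2)] by blast
    then have "card (Mt - {e}) \<le> ind_num (del E x)"
      by (rule card_le_ind_num_del[OF ind_matching_subset[OF Mt Diff_subset]])
    then show ?thesis using e(1) D(2) by (simp add: card_Diff_singleton_if)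
  qed
qed

lemma ind_matching_far:
  assumes Mt: "ind_matching E Mt" and e: "{x, y} \<in> Mt" and u: "u \<in> \<Union>(Mt - {{x, y}})"
  shows "u \<noteq> x \<and> u \<noteq> y \<and> {u, x} \<notin> E \<and> {u, y} \<notin> E"
proof -
  note D = ind_matching_D[OF Mt]
  obtain e' where e': "e' \<in> Mt" "e' \<noteq> {x, y}" "u \<in> e'" using u by blast
  have u_ne: "u \<notin> {x, y}" using D(3)[OF e'(1) e e'(3)] e'(2) by blast
  have "{u, w} \<notin> E" if w: "w \<in> {x, y}" for w
  proof
    assume "{u, w} \<in> E"
    moreover have "{u, w} \<subseteq> \<Union>Mt" using e e' w by blast
    ultimately have "{u, w} \<in> Mt" by (rule D(4))
    then have "{u, w} = {x, y}" using D(3)[of "{u, w}" "{x, y}" w] e w by blast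
    then show False using u_ne by blast
  qed
  then show ?thesis using u_ne by blast
qed

lemma ind_matching_exchange:
  assumes Mt: "ind_matching E Mt" and e: "{x, y} \<in> Mt" and ab: "{a, b} \<in> E"
    and far: "\<And>u. u \<in> \<Union>(Mt - {{x, y}}) \<Longrightarrow> u \<noteq> a \<and> u \<noteq> b \<and> {u, a} \<notin> E \<and> {u, b} \<notin> E"
  shows "ind_matching E (insert {a, b} (Mt - {{x, y}}))" "card (insert {a, b} (Mt - {{x, y}})) = card Mt"
proof -
  note D = ind_matching_D[OF Mt]
  show "ind_matching E (insert {a, b} (Mt - {{x, y}}))"
    by (rule ind_matching_insert[OF ind_matching_subset[OF Mt] card2 ab far]) auto
  have "{a, b} \<notin> Mt - {{x, y}}" using far by blast
  then have "card (insert {a, b} (Mt - {{x, y}})) = Suc (card (Mt - {{x, y}}))" using D(2) by simp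
  then show "card (insert {a, b} (Mt - {{x, y}})) = card Mt"
    using card_Suc_Diff1[OF D(2) e] by simp
qed

end

text \<open>Needed because the second graph sits in the glued one only after its vertex
  \<open>v2\<close> has been renamed.\<close>

lemma ind_num_image:
  assumes E: "edge_set E" and inj: "inj_on \<phi> (\<Union>E)"
  shows "ind_num ((`) \<phi> ` E) = ind_num E"
proof -
  have injE: "inj_on ((`) \<phi>) (Pow (\<Union>E))" using inj by (rule inj_on_image_Pow)
  have sub: "E \<subseteq> Pow (\<Union>E)" by blast
  have iff: "ind_matching ((`) \<phi> ` E) ((`) \<phi> ` Mt) \<longleftrightarrow> ind_matching E Mt" if Mt: "Mt \<subseteq> E" for Mt
  proof -
    have U: "\<Union>((`) \<phi> ` Mt) = \<phi> ` (\<Union>Mt)" by blast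
    have MU: "\<Union>Mt \<subseteq> \<Union>E" using Mt by blast
    have 1: "(\<phi> ` e \<noteq> \<phi> ` e' \<longrightarrow> \<phi> ` e \<inter> \<phi> ` e' = {}) \<longleftrightarrow> (e \<noteq> e' \<longrightarrow> e \<inter> e' = {})" if "e \<in> Mt" "e' \<in> Mt" for e e'
    proof -
      have ee: "e \<subseteq> \<Union>E" "e' \<subseteq> \<Union>E" using that Mt by blast+
      then have "\<phi> ` e = \<phi> ` e' \<longleftrightarrow> e = e'" using inj_on_image_eq_iff[OF inj] by blast
      moreover have "\<phi> ` e \<inter> \<phi> ` e' = \<phi> ` (e \<inter> e')" using inj_on_image_Int[OF inj ee] by simp
      ultimately show ?thesis by simp
    qed
    have 2: "(\<phi> ` e \<subseteq> \<phi> ` (\<Union>Mt) \<longrightarrow> \<phi> ` e \<in> (`) \<phi> ` Mt) \<longleftrightarrow> (e \<subseteq> \<Union>Mt \<longrightarrow> e \<in> Mt)" if "e \<in> E" for e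
    proof -
      have "\<phi> ` e \<subseteq> \<phi> ` (\<Union>Mt) \<longleftrightarrow> e \<subseteq> \<Union>Mt"
      proof
        assume a: "\<phi> ` e \<subseteq> \<phi> ` (\<Union>Mt)"
        show "e \<subseteq> \<Union>Mt"
        proof
          fix x assume "x \<in> e"
          then have "x \<in> \<Union>E" "\<phi> x \<in> \<phi> ` (\<Union>Mt)" using that a by blast+
          then show "x \<in> \<Union>Mt" using inj_on_image_mem_iff[OF inj _ MU] by blast
        qed
      qed (rule image_mono)
      moreover have "\<phi> ` e \<in> (`) \<phi> ` Mt \<longleftrightarrow> e \<in> Mt"
        using inj_on_image_mem_iff[OF injE, of e Mt] that Mt by blast
      ultimately show ?thesis by simp
    qed
    show ?thesis unfolding ind_matching_def U using Mt 1 2 by (simp add: image_mono)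
  qed
  have "card ` {Mt. ind_matching ((`) \<phi> ` E) Mt} = card ` {Mt. ind_matching E Mt}"
  proof (intro equalityI subsetI)
    fix n assume "n \<in> card ` {Mt. ind_matching ((`) \<phi> ` E) Mt}"
    then obtain Mt where Mt: "ind_matching ((`) \<phi> ` E) Mt" "n = card Mt" by blast
    then have "Mt \<subseteq> (`) \<phi> ` E" by (simp add: ind_matching_def)
    then obtain Mt' where Mt': "Mt' \<subseteq> E" "Mt = (`) \<phi> ` Mt'" by (meson subset_imageE)
    moreover have "card Mt = card Mt'"
      unfolding Mt'(2) using Mt'(1) inj_on_subset[OF injE] sub by (intro card_image) blast
    ultimately show "n \<in> card ` {Mt. ind_matching E Mt}" using iff[OF Mt'(1)] Mt by blast
  next
    fix n assume "n \<in> card ` {Mt. ind_matching E Mt}"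
    then obtain Mt where Mt: "ind_matching E Mt" "n = card Mt" by blast
    then have ME: "Mt \<subseteq> E" by (simp add: ind_matching_def)
    have "card ((`) \<phi> ` Mt) = card Mt"
      using ME inj_on_subset[OF injE] sub by (intro card_image) blast
    then show "n \<in> card ` {Mt. ind_matching ((`) \<phi> ` E) Mt}" using iff[OF ME] Mt by (metis imageI mem_Collect_eq)
  qed
  then show ?thesis by (simp add: ind_num_def)
qed

lemma image_del:
  assumes "inj_on \<phi> A" "\<Union>E \<subseteq> A" "x \<in> A"
  shows "(`) \<phi> ` del E x = del ((`) \<phi> ` E) (\<phi> x)"
proof -
  have "\<phi> x \<in> \<phi> ` e \<longleftrightarrow> x \<in> e" if "e \<in> E" for e
    using inj_on_image_mem_iff[OF assms(1,3)] assms(2) that by blast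
  then show ?thesis by (auto simp: del_def)
qed

section \<open>Edge sets with a leaf, glued at its neighbour\<close>

locale leaf_edges = edge_set E for E :: "'v set set" +
  fixes f v :: 'v
  assumes fv: "{f, v} \<in> E" and leaf_unique: "\<And>e. e \<in> E \<Longrightarrow> f \<in> e \<Longrightarrow> e = {f, v}"
begin

lemma f_neq_v: "f \<noteq> v" using fv card2 by force

lemma del_v_subset: "del E v \<subseteq> del E f"
  using leaf_unique by (auto simp: del_def)

lemma del_del: "del (del E f) v = del E v" "del (del E v) f = del E v"
  using leaf_unique by (auto simp: del_def)

text \<open>The only edge at the leaf passes through \<open>v\<close>, so deleting \<open>v\<close>
  removes at least the edges that deleting \<open>f\<close> removes.\<close>

lemma ind_num_chain: "ind_num (del E v) \<le> ind_num (del E f)" "ind_num (del E f) \<le> ind_num E"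
  using edge_set.ind_num_del_le[OF del, of f v] ind_num_del_le del_del by simp_all

text \<open>The leaf has no neighbour besides \<open>v\<close>, so the leaf edge can be added as
  soon as the matching stays away from \<open>v\<close>.\<close>

lemma insert_leaf:
  assumes Mt: "ind_matching (del E f) Mt" and v: "\<And>u. u \<in> \<Union>Mt \<Longrightarrow> u \<noteq> v \<and> {u, v} \<notin> E"
  shows "Suc (card Mt) \<le> ind_num E"
proof -
  note M = ind_matching_del_imp[OF Mt]
  have "ind_matching E (insert {f, v} Mt)"
  proof (rule ind_matching_insert[OF M(1) card2 fv])
    fix u assume u: "u \<in> \<Union>Mt"
    then have "u \<noteq> f" "u \<noteq> v" using M(2) v by auto
    moreover have "{u, f} \<notin> E" using leaf_unique[of "{u, f}"] \<open>u \<noteq> v\<close> \<open>u \<noteq> f\<close> by auto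
    ultimately show "u \<noteq> f \<and> u \<noteq> v \<and> {u, f} \<notin> E \<and> {u, v} \<notin> E" using v[OF u] by blast
  qed
  moreover have "{f, v} \<notin> Mt" using M(2) by blast
  ultimately show ?thesis using card_le_ind_num ind_matching_D(2)[OF M(1)] by fastforce
qed

end

locale glued = G1: leaf_edges E1 f1 v + G2: leaf_edges E2 f2 v
  for E1 E2 :: "'v set set" and f1 f2 v +
  assumes inter: "\<Union>E1 \<inter> \<Union>E2 \<subseteq> {v}"
begin

definition E where "E = del E1 f1 \<union> del E2 f2"

sublocale G: edge_set E
  by unfold_locales (use G1.fin G2.fin G1.card2 G2.card2 in \<open>auto simp: E_def del_def\<close>)

lemma swap: "glued E2 E1 f2 f1 v"
  by unfold_locales (use inter in auto)

lemma E_swap: "glued.E E2 E1 f2 f1 = E"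
  unfolding E_def glued.E_def[OF swap] by blast

lemma edge_disjoint: "e \<in> E1 \<Longrightarrow> e \<notin> E2"
proof
  assume e: "e \<in> E1" "e \<in> E2"
  then have "e \<subseteq> {v}" using inter by blast
  then have "card e \<le> 1" using card_mono[of "{v}" e] by simp
  then show False using G1.card2 e(1) by simp
qed

text \<open>The sides meet only in \<open>v\<close>, which \<open>M2\<close> avoids. The only
  possible contact is an edge of the second side from \<open>v\<close>, covered by
  \<open>M1\<close>, to a vertex of \<open>M2\<close>; this is what \<open>far\<close>
  forbids.\<close>

lemma union_ind_matching:
  assumes M1: "ind_matching (del E1 f1) M1" and M2: "ind_matching (del E2 v) M2"
    and far: "v \<in> \<Union>M1 \<Longrightarrow> (\<And>u. u \<in> \<Union>M2 \<Longrightarrow> {u, v} \<notin> E2)"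
  shows "card M1 + card M2 \<le> ind_num E"
proof -
  interpret d1: edge_set "del E1 f1" by (rule G1.del)
  interpret d2: edge_set "del E2 v" by (rule G2.del)
  note D1 = d1.ind_matching_D[OF M1] and D2 = d2.ind_matching_D[OF M2]
  have M1E: "M1 \<subseteq> E1" "M2 \<subseteq> E2" using order_trans[OF D1(1) del_subset] order_trans[OF D2(1) del_subset] .
  have v2: "v \<notin> \<Union>M2" using D2(1) by (auto simp: del_def)
  have sub: "\<Union>M1 \<subseteq> \<Union>E1" "\<Union>M2 \<subseteq> \<Union>E2" using M1E by blast+
  have disj: "\<Union>M1 \<inter> \<Union>M2 = {}"
  proof -
    have "\<Union>M1 \<inter> \<Union>M2 \<subseteq> {v}" using inter sub by blast
    then show ?thesis using v2 by blast
  qed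
  have "ind_matching E (M1 \<union> M2)"
  proof (rule G.ind_matchingI)
    show "M1 \<union> M2 \<subseteq> E" using D1(1) D2(1) G2.del_v_subset by (auto simp: E_def)
    show "e = e'" if "e \<in> M1 \<union> M2" "e' \<in> M1 \<union> M2" "x \<in> e" "x \<in> e'" for e e' x
    proof -
      have "(e \<in> M1 \<and> e' \<in> M1) \<or> (e \<in> M2 \<and> e' \<in> M2)" using that disj by blast
      then show ?thesis
      proof (elim disjE conjE)
        assume "e \<in> M1" "e' \<in> M1" then show ?thesis using that(3,4) by (rule D1(3))
      next
        assume "e \<in> M2" "e' \<in> M2" then show ?thesis using that(3,4) by (rule D2(3))
      qed
    qed
    fix e assume e: "e \<in> E" "e \<subseteq> \<Union>(M1 \<union> M2)"
    show "e \<in> M1 \<union> M2"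
    proof (cases "e \<in> del E1 f1")
      case True
      then have "e \<subseteq> \<Union>E1" by (auto simp: del_def)
      then have "e \<inter> \<Union>M2 \<subseteq> \<Union>E1 \<inter> \<Union>E2" using sub(2) by blast
      then have "e \<inter> \<Union>M2 = {}" using inter v2 by blast
      then have "e \<subseteq> \<Union>M1" using e(2) by blast
      then show ?thesis using D1(4)[OF True] by blast
    next
      case False
      then have e2: "e \<in> del E2 f2" using e(1) by (simp add: E_def)
      then have eE2: "e \<in> E2" by (simp add: del_def)
      have i: "e \<inter> \<Union>M1 \<subseteq> {v}" using inter sub eE2 by blast
      show ?thesis
      proof (cases "v \<in> e")
        case True
        obtain u where u: "e = {u, v}" "u \<noteq> v"
          using G2.edge_other[OF eE2 True] .
        have "u \<in> \<Union>M2" using e(2) i u by blast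
        moreover have "v \<in> \<Union>M1" using e(2) u v2 by blast
        ultimately have "{u, v} \<notin> E2" using far by blast
        then show ?thesis using eE2 u by simp
      next
        case False
        then have "e \<subseteq> \<Union>M2" using e(2) i by blast
        moreover have "e \<in> del E2 v" using False eE2 by (simp add: del_def)
        ultimately show ?thesis using D2(4) by blast
      qed
    qed
  qed
  moreover have "M1 \<inter> M2 = {}" using edge_disjoint M1E by blast
  ultimately show ?thesis using G.card_le_ind_num D1(2) D2(2) card_Un_disjoint by metis
qed

lemma lower: "ind_num (del E1 v) + ind_num (del E2 v) \<le> ind_num E"
proof -
  obtain M1 where M1: "ind_matching (del E1 v) M1" "card M1 = ind_num (del E1 v)"
    using edge_set.ind_num_obtain[OF G1.del] .
  obtain M2 where M2: "ind_matching (del E2 v) M2" "card M2 = ind_num (del E2 v)"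
    using edge_set.ind_num_obtain[OF G2.del] .
  note M1' = edge_set.ind_matching_del_imp[OF G1.del, of f1 v M1, unfolded G1.del_del, OF M1(1)]
  show ?thesis using union_ind_matching[OF M1'(1) M2(1)] M1'(2) M1(2) M2(2) by simp
qed

text \<open>Under the hypothesis each maximum induced matching of the second side uses
  \<open>v\<close>. After its edge at \<open>v\<close> is dropped, the rest is far from
  \<open>v\<close> and fits to any induced matching of the first side without its leaf.\<close>

lemma lower':
  assumes "ind_num (del E2 v) < ind_num E2"
  shows "ind_num (del E1 f1) + ind_num E2 \<le> Suc (ind_num E)"
proof -
  obtain M1 where M1: "ind_matching (del E1 f1) M1" "card M1 = ind_num (del E1 f1)"
    using edge_set.ind_num_obtain[OF G1.del] .
  obtain M2 where M2: "ind_matching E2 M2" "card M2 = ind_num E2" using G2.ind_num_obtain .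
  note D2 = G2.ind_matching_D[OF M2(1)]
  have "v \<in> \<Union>M2" using G2.card_le_ind_num_del[OF M2(1)] assms M2(2) by fastforce
  then obtain e where e: "e \<in> M2" "v \<in> e" by blast
  obtain u where u: "e = {u, v}"
    using G2.edge_other[OF subsetD[OF D2(1) e(1)] e(2)] .
  define M2' where "M2' = M2 - {{u, v}}"
  have far: "w \<noteq> v \<and> {w, v} \<notin> E2" if "w \<in> \<Union>M2'" for w
    using G2.ind_matching_far[OF M2(1), of u v w] e u that by (simp add: M2'_def)
  have "ind_matching E2 M2'" using G2.ind_matching_subset[OF M2(1)] by (auto simp: M2'_def)
  then have "ind_matching (del E2 v) M2'" using far by (intro G2.ind_matching_to_del) blast+
  then have "card M1 + card M2' \<le> ind_num E" using union_ind_matching[OF M1(1)] far by blast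
  moreover have "Suc (card M2') = card M2" using card_Suc_Diff1[OF D2(2) e(1)] u by (simp add: M2'_def)
  ultimately show ?thesis using M1(2) M2(2) by simp
qed

lemma restrict1:
  assumes M: "ind_matching E M" shows "ind_matching (del E1 f1) (M \<inter> E1)"
proof -
  interpret d1: edge_set "del E1 f1" by (rule G1.del)
  note D = G.ind_matching_D[OF M]
  have 1: "M \<inter> E1 \<subseteq> del E1 f1" using D(1) edge_disjoint by (auto simp: E_def del_def)
  show ?thesis
  proof (rule d1.ind_matchingI[OF 1])
    show "e = e'" if "e \<in> M \<inter> E1" "e' \<in> M \<inter> E1" "x \<in> e" "x \<in> e'" for e e' x
      using that by (intro D(3)[of e e' x]) auto
    fix e assume "e \<in> del E1 f1" "e \<subseteq> \<Union>(M \<inter> E1)"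
    then have "e \<in> E" "e \<subseteq> \<Union>M" "e \<in> E1" by (auto simp: E_def del_def)
    then show "e \<in> M \<inter> E1" using D(4)[of e] by blast
  qed
qed

text \<open>If \<open>M\<close> uses \<open>v\<close> on the first side, then the edge at the removed leaf \<open>f2\<close> extends its second
  half.\<close>

lemma touching:
  assumes M: "ind_matching E M" and v: "v \<in> \<Union>(M \<inter> E1)"
  shows "card (M \<inter> E1) \<le> ind_num (del E1 f1)" "Suc (card (M \<inter> E2)) \<le> ind_num E2"
    "card (M \<inter> E2) \<le> ind_num (del E2 v)"
proof -
  interpret d1: edge_set "del E1 f1" by (rule G1.del)
  interpret sw: glued E2 E1 f2 f1 v by (rule swap)
  note D = G.ind_matching_D[OF M]
  have M': "ind_matching sw.E M" using M E_swap by simp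
  have M2: "ind_matching (del E2 f2) (M \<inter> E2)" by (rule sw.restrict1[OF M'])
  show "card (M \<inter> E1) \<le> ind_num (del E1 f1)" using restrict1[OF M] by (rule d1.card_le_ind_num)
  obtain e1 where e1: "e1 \<in> M" "e1 \<in> E1" "v \<in> e1" using v by blast
  have nv: "v \<notin> e" if "e \<in> M" "e \<in> E2" for e
  proof
    assume "v \<in> e"
    then have "e = e1" using D(3)[of e e1 v] that(1) e1 by blast
    then show False using edge_disjoint e1(2) that(2) by blast
  qed
  have far: "u \<noteq> v \<and> {u, v} \<notin> E2" if u: "u \<in> \<Union>(M \<inter> E2)" for u
  proof (intro conjI notI)
    obtain e where e: "e \<in> M" "e \<in> E2" "u \<in> e" using u by blast
    show "False" if "u = v" using nv e that by blast
    assume uv: "{u, v} \<in> E2"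
    have "e \<in> del E2 f2" using M2 e by (auto simp: ind_matching_def)
    then have "u \<noteq> f2" using e by (auto simp: del_def)
    then have "{u, v} \<in> E" using uv G2.f_neq_v by (auto simp: E_def del_def)
    moreover have "{u, v} \<subseteq> \<Union>M" using e e1 by blast
    ultimately have "{u, v} \<in> M" by (rule D(4))
    then show False using nv uv by blast
  qed
  show "Suc (card (M \<inter> E2)) \<le> ind_num E2" by (rule G2.insert_leaf[OF M2 far])
  have "ind_matching E2 (M \<inter> E2)" using G2.ind_matching_del_imp(1)[OF M2] .
  then show "card (M \<inter> E2) \<le> ind_num (del E2 v)" using far by (intro G2.card_le_ind_num_del) blast+
qed

text \<open>The alternatives are that a maximum induced matching of the glued graph avoids
  \<open>v\<close>, uses it on the first side, or uses it on the second side.\<close>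

lemma upper:
  "ind_num E \<le> ind_num (del E1 v) + ind_num (del E2 v) \<or>
   Suc (ind_num E) \<le> ind_num (del E1 f1) + ind_num E2 \<and> ind_num E \<le> ind_num (del E1 f1) + ind_num (del E2 v) \<or>
   Suc (ind_num E) \<le> ind_num (del E2 f2) + ind_num E1 \<and> ind_num E \<le> ind_num (del E2 f2) + ind_num (del E1 v)"
proof -
  interpret sw: glued E2 E1 f2 f1 v by (rule swap)
  obtain M where M: "ind_matching E M" "card M = ind_num E" using G.ind_num_obtain .
  note D = G.ind_matching_D[OF M(1)]
  have M': "ind_matching sw.E M" using M(1) E_swap by simp
  have ME: "M = (M \<inter> E1) \<union> (M \<inter> E2)" using D(1) by (auto simp: E_def del_def)
  have "card M = card (M \<inter> E1) + card (M \<inter> E2)"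
    by (subst ME, rule card_Un_disjoint) (use D(2) edge_disjoint in auto)
  then have c: "ind_num E = card (M \<inter> E1) + card (M \<inter> E2)" using M(2) by simp
  show ?thesis
  proof (cases "v \<in> \<Union>(M \<inter> E1)")
    case True
    then show ?thesis using touching[OF M(1) True] c by linarith
  next
    case F1: False
    show ?thesis
    proof (cases "v \<in> \<Union>(M \<inter> E2)")
      case True
      then show ?thesis using sw.touching[OF M' True] c by linarith
    next
      case False
      have "card (M \<inter> E1) \<le> ind_num (del E1 v)"
        using G1.ind_matching_del_imp(1)[OF restrict1[OF M(1)]] F1 by (rule G1.card_le_ind_num_del)
      moreover have "card (M \<inter> E2) \<le> ind_num (del E2 v)"
        using G2.ind_matching_del_imp(1)[OF sw.restrict1[OF M']] False by (rule G2.card_le_ind_num_del)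
      ultimately show ?thesis using c by linarith
    qed
  qed
qed

end

section \<open>Fan graphs\<close>

text \<open>The last assumption is all that is needed of the nested structure of a fan: if a clique meets \<open>B\<close>
  in \<open>u\<close> only, then \<open>u\<close> is the first vertex of its fan, and a further clique through \<open>u\<close> contains a
  later vertex \<open>w\<close>.\<close>

locale fan =
  fixes W B :: "'v set" and \<C> :: "'v set set"
  assumes finB: "finite B" and fin\<C>: "finite \<C>" and finC: "\<And>C. C \<in> \<C> \<Longrightarrow> finite C" and WB: "W \<subseteq> B"
    and base: "\<And>C. C \<in> \<C> \<Longrightarrow> C \<inter> B \<noteq> {}" "\<And>C. C \<in> \<C> \<Longrightarrow> C \<inter> B \<subseteq> W"
    and new: "\<And>C. C \<in> \<C> \<Longrightarrow> \<exists>x\<in>C. x \<notin> B"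
    and sep: "\<And>C C'. C \<in> \<C> \<Longrightarrow> C' \<in> \<C> \<Longrightarrow> C \<noteq> C' \<Longrightarrow> C \<inter> C' \<subseteq> B"
    and cover: "\<And>u. u \<in> W \<Longrightarrow> \<exists>C\<in>\<C>. u \<in> C"
    and chain: "\<And>C C' u. C \<in> \<C> \<Longrightarrow> C' \<in> \<C> \<Longrightarrow> C \<inter> B = {u} \<Longrightarrow> u \<in> C' \<Longrightarrow> C' \<noteq> C \<Longrightarrow>
      \<exists>w\<in>C' \<inter> B. w \<noteq> u \<and> (\<forall>C''\<in>\<C>. w \<in> C'' \<longrightarrow> u \<in> C'')"
begin

definition Eg where "Eg = {e. card e = 2 \<and> (e \<subseteq> B \<or> (\<exists>C\<in>\<C>. e \<subseteq> C))}"
definition Vg where "Vg = B \<union> \<Union>\<C>"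

lemma edge_iff: "{a, b} \<in> Eg \<longleftrightarrow> a \<noteq> b \<and> (a \<in> B \<and> b \<in> B \<or> (\<exists>C\<in>\<C>. a \<in> C \<and> b \<in> C))"
  by (auto simp: Eg_def card_insert_if)

lemma Eg_sub: "e \<in> Eg \<Longrightarrow> e \<subseteq> Vg" by (auto simp: Eg_def Vg_def)

lemma finV: "finite Vg" using finB fin\<C> finC by (auto simp: Vg_def)

lemma edge_set: "edge_set Eg"
proof
  show "finite Eg" by (rule finite_subset[of _ "Pow Vg"]) (use Eg_sub finV in auto)
qed (simp add: Eg_def)

text \<open>Cliques meet only inside \<open>B\<close>, so a new vertex lies in exactly one of
  them.\<close>

lemma new_nbr: assumes "C \<in> \<C>" "y \<in> C" "y \<notin> B" "{u, y} \<in> Eg" shows "u \<in> C"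
proof -
  obtain C' where C': "C' \<in> \<C>" "u \<in> C'" "y \<in> C'" using assms(3,4) edge_iff by blast
  then have "C' = C" using sep[OF assms(1) C'(1)] assms(2,3) by blast
  then show ?thesis using C' by simp
qed

text \<open>Either \<open>X\<close> lies in the clique \<open>B\<close>, where every vertex is
  simplicial, or it contains a new vertex, whose neighbours all lie in one clique. A vertex other
  than \<open>v\<close> is asked for because gluing can destroy simpliciality at
  \<open>v\<close>.\<close>

lemma simplicial_avoiding:
  assumes "v \<in> B" "X \<subseteq> Vg" "\<not> X \<subseteq> {v}"
  shows "\<exists>z\<in>X. z \<noteq> v \<and> simplicial Eg X z"
proof (cases "X \<subseteq> B")
  case True
  obtain z where z: "z \<in> X" "z \<noteq> v" using assms(3) by blast
  have "simplicial Eg X z" unfolding simplicial_def using True by (auto simp: edge_iff)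
  then show ?thesis using z by blast
next
  case False
  then obtain z where z: "z \<in> X" "z \<notin> B" by blast
  then obtain C where C: "C \<in> \<C>" "z \<in> C" using assms(2) by (auto simp: Vg_def)
  have "simplicial Eg X z" unfolding simplicial_def
  proof (intro ballI impI)
    fix a b assume "{a, z} \<in> Eg" "{b, z} \<in> Eg" "a \<noteq> b"
    then have "a \<in> C" "b \<in> C" using new_nbr[OF C z(2)] by auto
    then show "{a, b} \<in> Eg" using \<open>a \<noteq> b\<close> C edge_iff by blast
  qed
  moreover have "z \<noteq> v" using z(2) assms(1) by blast
  ultimately show ?thesis using z(1) by blast
qed

end

section \<open>From lists of cliques to the abstract fan\<close>

lemma nth_in_take_iff:
  assumes "distinct us" "i < length us" "j < length us"
  shows "us ! i \<in> set (take (Suc j) us) \<longleftrightarrow> i \<le> j"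
proof
  assume "us ! i \<in> set (take (Suc j) us)"
  then obtain m where m: "m < Suc j" "us ! m = us ! i" using assms by (auto simp: in_set_conv_nth)
  then have "m = i" using assms by (simp add: nth_eq_iff_index_eq)
  then show "i \<le> j" using m by simp
next
  assume "i \<le> j"
  then have "i < length (take (Suc j) us)" using assms by simp
  then have "take (Suc j) us ! i \<in> set (take (Suc j) us)" by (rule nth_mem)
  then show "us ! i \<in> set (take (Suc j) us)" using \<open>i \<le> j\<close> by simp
qed

lemma k_fan_graph_fan:
  assumes "k_fan_graph k W B H"
  obtains \<C> where "fan W B \<C>" "vertices H = fan.Vg B \<C>" "edges H = fan.Eg B \<C>"
proof -
  obtain Us Css where len: "length Us = k" "length Css = k" and finB: "finite B"
    and fans: "\<And>l. l < k \<Longrightarrow> fan_on B (Us ! l) (Css ! l)"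
    and Udisj: "\<And>l m. l < k \<Longrightarrow> m < k \<Longrightarrow> l \<noteq> m \<Longrightarrow> set (Us ! l) \<inter> set (Us ! m) = {}"
    and Cdisj: "\<And>l m. l < k \<Longrightarrow> m < k \<Longrightarrow> l \<noteq> m \<Longrightarrow> \<Union>(set (Css ! l)) \<inter> \<Union>(set (Css ! m)) \<subseteq> B"
    and W: "W = (\<Union>l<k. set (Us ! l))"
    and H: "H = (\<Union>C\<in>insert B (\<Union>l<k. set (Css ! l)). vertices (complete_graph C),
                 \<Union>C\<in>insert B (\<Union>l<k. set (Css ! l)). edges (complete_graph C))"
    using assms unfolding k_fan_graph_def Let_def by metis
  define \<C> where "\<C> = (\<Union>l<k. set (Css ! l))"
  have lenC: "length (Css ! l) = length (Us ! l)" "distinct (Us ! l)" "set (Us ! l) \<subseteq> B" if "l < k" for l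
    using fans[OF that] by (auto simp: fan_on_def)
  have at: "finite (Css ! l ! i)" "card (Css ! l ! i) > Suc i" "B \<inter> Css ! l ! i = set (take (Suc i) (Us ! l))"
    if "l < k" "i < length (Us ! l)" for l i
    using fans[OF that(1)] that(2) by (auto simp: fan_on_def)
  have sep: "Css ! l ! i \<inter> Css ! l ! j \<subseteq> B" if "l < k" "i < length (Us ! l)" "j < length (Us ! l)" "i \<noteq> j" for l i j
    using fans[OF that(1)] that(2-) by (simp add: fan_on_def)
  have C: "\<exists>l i. l < k \<and> i < length (Us ! l) \<and> C = Css ! l ! i" if C: "C \<in> \<C>" for C
  proof -
    obtain l where l: "l < k" "C \<in> set (Css ! l)" using C by (auto simp: \<C>_def)
    then show ?thesis using lenC(1)[OF l(1)] by (metis in_set_conv_nth)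
  qed
  have in\<C>: "Css ! l ! i \<in> \<C>" if "l < k" "i < length (Us ! l)" for l i
  proof -
    have "Css ! l ! i \<in> set (Css ! l)" using that(2) lenC(1)[OF that(1)] by simp
    then show ?thesis using that(1) by (auto simp: \<C>_def)
  qed
  \<comment> \<open>The parts of the partition are disjoint, so all cliques through a vertex of a
    part belong to the fan on that part.\<close>
  have same: "l = l'" if "l < k" "l' < k" "u \<in> set (Us ! l)" "i < length (Us ! l')" "u \<in> Css ! l' ! i" "u \<in> B" for l l' i u
  proof (rule ccontr)
    assume "l \<noteq> l'"
    moreover have "u \<in> set (Us ! l')" using at(3)[OF that(2,4)] that(5,6) by (metis IntI in_set_takeD)
    ultimately show False using Udisj[OF that(1,2)] that(3) by blast
  qed
  have "fan W B \<C>"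
  proof
    show "finite B" by (rule finB)
    show "finite \<C>" by (simp add: \<C>_def)
    show "W \<subseteq> B" using lenC(3) by (auto simp: W)
    fix C assume "C \<in> \<C>"
    then obtain l i where li: "l < k" "i < length (Us ! l)" "C = Css ! l ! i" using C by blast
    note a = at[OF li(1,2), folded li(3)]
    show "finite C" by (rule a(1))
    have pos: "0 < length (Us ! l)" using li(2) by linarith
    have "Us ! l ! 0 \<in> set (take (Suc i) (Us ! l))"
      by (rule iffD2[OF nth_in_take_iff[OF lenC(2)[OF li(1)] pos li(2)]]) simp
    then show "C \<inter> B \<noteq> {}" using a(3) by blast
    show "C \<inter> B \<subseteq> W" using a(3) li(1) set_take_subset[of "Suc i" "Us ! l"] by (auto simp: W)
    show "\<exists>x\<in>C. x \<notin> B"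
    proof (rule ccontr)
      assume "\<not> (\<exists>x\<in>C. x \<notin> B)"
      then have "C = set (take (Suc i) (Us ! l))" using a(3) by blast
      then have "card C \<le> Suc i" using card_length[of "take (Suc i) (Us ! l)"] by simp
      then show False using a(2) by simp
    qed
    fix C' assume "C' \<in> \<C>"
    then obtain l' i' where li': "l' < k" "i' < length (Us ! l')" "C' = Css ! l' ! i'" using C by blast
    note a' = at[OF li'(1,2), folded li'(3)]
    show "C \<inter> C' \<subseteq> B" if "C \<noteq> C'"
    proof (cases "l = l'")
      case True
      then show ?thesis using sep li li' that by blast
    next
      case False
      have "C \<in> set (Css ! l)" "C' \<in> set (Css ! l')" using li li' lenC(1) by simp_all
      then show ?thesis using Cdisj[OF li(1) li'(1) False] by blast
    qed
    fix u assume u: "C \<inter> B = {u}" "u \<in> C'" "C' \<noteq> C"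
    have dl: "distinct (Us ! l)" by (rule lenC(2)[OF li(1)])
    have us: "set (take (Suc i) (Us ! l)) = {u}" using a(3) u(1) by blast
    \<comment> \<open>The clique with list index \<open>i\<close> meets \<open>B\<close> in
      \<open>i + 1\<close> vertices, so meeting it in one vertex means being the first.\<close>
    have "card (set (take (Suc i) (Us ! l))) = Suc i"
      using distinct_card[of "take (Suc i) (Us ! l)"] dl li(2) by simp
    then have i0: "i = 0" using us by simp
    have u0: "u = Us ! l ! 0" using us li(2) by (simp add: i0 take_Suc_conv_app_nth)
    have uU: "u \<in> set (Us ! l)" using u0 li(2) i0 by simp
    have "u \<in> B" using u(1) by blast
    then have ll: "l' = l" using same[OF li(1) li'(1) uU li'(2)] u(2) li'(3) by simp
    have i': "i' \<noteq> 0" using u(3) li(3) li'(3) ll i0 by auto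
    \<comment> \<open>The last vertex of \<open>B\<close> in \<open>C'\<close>. Cliques through
      \<open>w\<close> belong to the same fan, and all cliques of a fan contain its first vertex
      \<open>u\<close>.\<close>
    define w where "w = Us ! l ! i'"
    have i'l: "i' < length (Us ! l)" using li'(2) ll by simp
    have "w \<in> set (take (Suc i') (Us ! l))"
      unfolding w_def by (rule iffD2[OF nth_in_take_iff[OF dl i'l i'l]]) simp
    then have "w \<in> C' \<inter> B" using a'(3) ll by blast
    moreover have "w \<noteq> u" unfolding w_def u0 nth_eq_iff_index_eq[OF dl i'l pos] by (rule i')
    moreover have "u \<in> C''" if C'': "C'' \<in> \<C>" "w \<in> C''" for C''
    proof -
      obtain l'' i'' where li'': "l'' < k" "i'' < length (Us ! l'')" "C'' = Css ! l'' ! i''" using C C''(1) by blast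
      have "w \<in> set (Us ! l)" unfolding w_def using i'l by simp
      moreover have "w \<in> B" using \<open>w \<in> C' \<inter> B\<close> by blast
      moreover have "w \<in> Css ! l'' ! i''" using C''(2) li''(3) by simp
      ultimately have "l'' = l" using same[OF li(1) li''(1) _ li''(2), of w] by blast
      moreover have "u \<in> set (take (Suc i'') (Us ! l))"
        unfolding u0 using iffD2[OF nth_in_take_iff[OF dl pos, of i'']] li''(2) \<open>l'' = l\<close> by simp
      ultimately show ?thesis using at(3)[OF li''(1,2)] li''(3) by blast
    qed
    ultimately show "\<exists>w\<in>C' \<inter> B. w \<noteq> u \<and> (\<forall>C''\<in>\<C>. w \<in> C'' \<longrightarrow> u \<in> C'')" by blast
  next
    fix u assume "u \<in> W"
    then obtain l where l: "l < k" "u \<in> set (Us ! l)" by (auto simp: W)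
    then obtain i where i: "i < length (Us ! l)" "u = Us ! l ! i" by (metis in_set_conv_nth)
    then have "u \<in> Css ! l ! i" using iffD2[OF nth_in_take_iff[OF lenC(2)[OF l(1)] i(1) i(1)] order_refl] at(3)[OF l(1) i(1)] by blast
    then show "\<exists>C\<in>\<C>. u \<in> C" using in\<C>[OF l(1) i(1)] by blast
  qed
  moreover have "vertices H = fan.Vg B \<C>"
    unfolding fan.Vg_def[OF calculation] H by (auto simp: complete_graph_def \<C>_def)
  moreover have "edges H = fan.Eg B \<C>"
    unfolding fan.Eg_def[OF \<open>fan W B \<C>\<close>] H by (auto simp: complete_graph_def \<C>_def)
  ultimately show ?thesis using that by blast
qed

section \<open>Fans with a leaf\<close>

locale fan_leaf = fan W B \<C> for W B :: "'v set" and \<C> +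
  fixes f v :: 'v
  assumes two: "card B \<ge> 2" and fv: "{f, v} \<in> Eg" and leaf_nbr: "\<And>u. {u, f} \<in> Eg \<Longrightarrow> u = v"
    and deg_v: "\<exists>w. w \<noteq> f \<and> {w, v} \<in> Eg"
begin

lemma leaf_edges: "leaf_edges Eg f v"
proof -
  interpret edge_set Eg by (rule edge_set)
  show ?thesis
  proof
    show "{f, v} \<in> Eg" by (rule fv)
    fix e assume e: "e \<in> Eg" "f \<in> e"
    obtain u where u: "e = {u, f}" "u \<noteq> f"
      using edge_other[OF e] .
    then have "u = v" using leaf_nbr e(1) by simp
    then show "e = {f, v}" using u by blast
  qed
qed

lemma f_neq_v: "f \<noteq> v" using fv edge_iff by blast

lemma other_in_B: "\<exists>b\<in>B. b \<noteq> x"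
proof (rule ccontr)
  assume "\<not> (\<exists>b\<in>B. b \<noteq> x)"
  then have "B \<subseteq> {x}" by blast
  then have "card B \<le> 1" using card_mono[of "{x}" B] by simp
  then show False using two by simp
qed

text \<open>A leaf in \<open>B\<close> is adjacent to the rest of \<open>B\<close>, which must
  therefore be \<open>v\<close> alone; a clique through the leaf would add a new vertex as second
  neighbour.\<close>

lemma f_in_B: "f \<in> B \<Longrightarrow> f \<notin> W \<and> B = {v, f}"
proof
  assume f: "f \<in> B"
  show "f \<notin> W"
  proof
    assume "f \<in> W"
    then obtain C where C: "C \<in> \<C>" "f \<in> C" using cover by blast
    obtain x where x: "x \<in> C" "x \<notin> B" using new[OF C(1)] by blast
    have "x = v" using leaf_nbr[of x] edge_iff x C f by blast
    obtain b where b: "b \<in> B" "b \<noteq> f" using other_in_B by blast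
    then have "b = v" using leaf_nbr[of b] edge_iff f by blast
    then show False using \<open>x = v\<close> x b by blast
  qed
  have "b = v" if "b \<in> B" "b \<noteq> f" for b using leaf_nbr[of b] edge_iff f that by blast
  then have "B \<subseteq> {v, f}" by blast
  moreover have "v \<in> B" using other_in_B[of f] \<open>\<And>b. b \<in> B \<Longrightarrow> b \<noteq> f \<Longrightarrow> b = v\<close> by blast
  ultimately show "B = {v, f}" using f by blast
qed

text \<open>Any vertex other than the leaf in its clique is a neighbour of the leaf, so the clique
  has two vertices, and the one in \<open>B\<close> is \<open>v\<close>.\<close>

lemma f_notin_B: "f \<notin> B \<Longrightarrow> {v, f} \<in> \<C> \<and> v \<in> B"
proof -
  assume f: "f \<notin> B"
  then obtain C where C: "C \<in> \<C>" "f \<in> C" "v \<in> C" using fv edge_iff by blast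
  have "u = v" if "u \<in> C" "u \<noteq> f" for u using leaf_nbr[of u] edge_iff C that by blast
  then have "C = {v, f}" using C by blast
  moreover have "v \<in> B" using base(1)[OF C(1)] f calculation by blast
  ultimately show ?thesis using C by simp
qed

lemma vB: "v \<in> B" using f_in_B f_notin_B by blast

lemma chordal_Eg: "chordal Eg Vg"
  unfolding chordal_def
proof (intro allI impI)
  fix X assume X: "X \<subseteq> Vg" "X \<noteq> {}"
  show "\<exists>z\<in>X. simplicial Eg X z"
  proof (cases "X \<subseteq> {v}")
    case True
    then show ?thesis using X(2) unfolding simplicial_def by blast
  next
    case False
    then show ?thesis using simplicial_avoiding[OF vB X(1)] by blast
  qed
qed

lemma vW: "v \<in> W"
proof (cases "f \<in> B")
  case True
  obtain w where w: "w \<noteq> f" "{w, v} \<in> Eg" using deg_v by blast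
  then have "w \<noteq> v" using edge_iff by blast
  then have "w \<notin> B" using w f_in_B[OF True] by blast
  then obtain C where "C \<in> \<C>" "v \<in> C" using w edge_iff by blast
  then show ?thesis using base(2)[of C] vB by blast
next
  case False
  then show ?thesis using f_notin_B[OF False] base(2)[of "{v, f}"] by blast
qed

text \<open>The edge \<open>{f, v}\<close> of a maximum induced matching can be exchanged for the edge from \<open>v\<close> to the
  vertex in \<open>B - W\<close>, which is adjacent to \<open>B\<close> only; if that vertex is \<open>f\<close>, for any other edge at \<open>v\<close>.\<close>

lemma exists_matching_avoiding_leaf:
  assumes W: "card W = card B - 1" and lt: "ind_num (del Eg v) < ind_num Eg"
  shows "ind_num (del Eg f) = ind_num Eg"
proof -
  interpret leaf_edges Eg f v by (rule leaf_edges)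
  obtain M where M: "ind_matching Eg M" "card M = ind_num Eg" using ind_num_obtain .
  note D = ind_matching_D[OF M(1)]
  have "\<exists>M'. ind_matching Eg M' \<and> card M' = ind_num Eg \<and> f \<notin> \<Union>M'"
  proof (cases "{f, v} \<in> M")
    case False
    have "f \<notin> \<Union>M" using leaf_unique D(1) False by blast
    then show ?thesis using M by blast
  next
    case True
    have far: "u \<noteq> f \<and> u \<noteq> v \<and> {u, f} \<notin> Eg \<and> {u, v} \<notin> Eg" if "u \<in> \<Union>(M - {{f, v}})" for u
      by (rule ind_matching_far[OF M(1) True that])
    have farB: "u \<notin> B" if "u \<in> \<Union>(M - {{f, v}})" for u
      using far[OF that] vB edge_iff by blast
    have "card (B - W) = card B - card W" using WB finB finite_subset by (intro card_Diff_subset) blast+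
    then have "card (B - W) = 1" using W two by simp
    then obtain z where z: "B - W = {z}" by (meson card_1_singletonE)
    have "\<exists>x. x \<noteq> f \<and> {x, v} \<in> Eg \<and> (\<forall>u. u \<in> \<Union>(M - {{f, v}}) \<longrightarrow> u \<noteq> x \<and> {u, x} \<notin> Eg)"
    proof (cases "f \<in> B")
      case fB: False
      then have zf: "z \<noteq> f" using z by blast
      have zv: "z \<noteq> v" "z \<in> B" "z \<notin> W" using z vW by blast+
      have "{z, v} \<in> Eg" using zv vB edge_iff by blast
      moreover have "u \<noteq> z \<and> {u, z} \<notin> Eg" if u: "u \<in> \<Union>(M - {{f, v}})" for u
      proof
        show "u \<noteq> z" using farB[OF u] zv by blast
        show "{u, z} \<notin> Eg"
        proof
          assume "{u, z} \<in> Eg"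
          then obtain C where "C \<in> \<C>" "z \<in> C" using farB[OF u] edge_iff by blast
          then show False using base(2)[of C] zv by blast
        qed
      qed
      ultimately show ?thesis using zf by blast
    next
      case fB: True
      obtain x where x: "x \<noteq> f" "{x, v} \<in> Eg" using deg_v by blast
      \<comment> \<open>Here \<open>B\<close> consists of \<open>v\<close> and the leaf, and
        \<open>W\<close> of \<open>v\<close>; so every clique contains \<open>v\<close>, and no
        further edge can be far from \<open>v\<close>.\<close>
      have "\<Union>(M - {{f, v}}) = {}"
      proof (rule ccontr)
        assume "\<Union>(M - {{f, v}}) \<noteq> {}"
        then obtain u e where u: "u \<in> e" "e \<in> M - {{f, v}}" by blast
        then have "e \<in> Eg" "u \<notin> B" using D(1) farB by blast+
        then obtain C where C: "C \<in> \<C>" "u \<in> C" using u(1) by (auto simp: Eg_def)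
        have "W = {v}" using f_in_B[OF fB] WB vW by blast
        then have "v \<in> C" using base[OF C(1)] by blast
        then have "{u, v} \<in> Eg" using edge_iff C \<open>u \<notin> B\<close> vB by blast
        then show False using far u by blast
      qed
      then show ?thesis using x by blast
    qed
    then obtain x where x: "x \<noteq> f" "{x, v} \<in> Eg" "\<And>u. u \<in> \<Union>(M - {{f, v}}) \<Longrightarrow> u \<noteq> x \<and> {u, x} \<notin> Eg"
      by blast
    have "u \<noteq> x \<and> u \<noteq> v \<and> {u, x} \<notin> Eg \<and> {u, v} \<notin> Eg" if "u \<in> \<Union>(M - {{f, v}})" for u
      using x(3)[OF that] far[OF that] by blast
    note ex = ind_matching_exchange[OF M(1) True x(2) this]
    have "f \<notin> \<Union>(insert {x, v} (M - {{f, v}}))" using far x(1) f_neq_v by blast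
    then show ?thesis using ex M(2) by metis
  qed
  then obtain M' where M': "ind_matching Eg M'" "card M' = ind_num Eg" "f \<notin> \<Union>M'" by blast
  then show ?thesis using card_le_ind_num_del[OF M'(1,3)] ind_num_del_le[of f] by simp
qed

text \<open>In a maximum induced matching, an edge \<open>{v, x}\<close> other than \<open>{f, v}\<close> can be exchanged for an edge
  \<open>{a, x}\<close> avoiding \<open>v\<close>, where \<open>a\<close> is a new vertex of a clique through \<open>x\<close> if \<open>x\<close> lies in \<open>B\<close>, and a later
  vertex of the fan of \<open>v\<close> otherwise.\<close>

lemma no_matching_avoiding_leaf:
  assumes W: "W = B" and lt: "ind_num (del Eg v) < ind_num Eg"
  shows "ind_num (del Eg f) < ind_num Eg"
proof (rule ccontr)
  interpret leaf_edges Eg f v by (rule leaf_edges)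
  assume "\<not> ind_num (del Eg f) < ind_num Eg"
  then have eq: "ind_num (del Eg f) = ind_num Eg" using ind_num_del_le[of f] by simp
  obtain M where M0: "ind_matching (del Eg f) M" "card M = ind_num Eg"
    using edge_set.ind_num_obtain[OF del] eq by metis
  note M = ind_matching_del_imp[OF M0(1)]
  note D = ind_matching_D[OF M(1)]
  have "v \<in> \<Union>M" using card_le_ind_num_del[OF M(1)] M0(2) lt by fastforce
  then obtain e where e: "e \<in> M" "v \<in> e" by blast
  obtain x where x': "e = {x, v}" "x \<noteq> v"
    using edge_other[OF subsetD[OF D(1) e(1)] e(2)] .
  then have x: "e = {v, x}" "v \<noteq> x" by auto
  have vx: "{v, x} \<in> M" "{x, v} \<in> Eg" "x \<noteq> f" using e x D(1) M(2) by (auto simp: insert_commute)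
  have far: "u \<noteq> v \<and> u \<noteq> x \<and> {u, v} \<notin> Eg \<and> {u, x} \<notin> Eg" if "u \<in> \<Union>(M - {{v, x}})" for u
    by (rule ind_matching_far[OF M(1) vx(1) that])
  have farB: "u \<notin> B" if "u \<in> \<Union>(M - {{v, x}})" for u
    using far[OF that] vB edge_iff by blast
  have fB: "f \<notin> B" using f_in_B W by blast
  then have C: "{v, f} \<in> \<C>" "{v, f} \<inter> B = {v}" using f_notin_B vB by blast+
  have "\<exists>a. a \<noteq> v \<and> {a, x} \<in> Eg \<and> (\<forall>u\<in>\<Union>(M - {{v, x}}). u \<noteq> a \<and> {u, a} \<notin> Eg)"
  proof (cases "x \<in> B")
    case True
    then obtain C' where C': "C' \<in> \<C>" "x \<in> C'" using cover W by blast
    obtain y where y: "y \<in> C'" "y \<notin> B" using new[OF C'(1)] by blast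
    have yx: "{y, x} \<in> Eg" using edge_iff C' y True by blast
    have "u \<noteq> y \<and> {u, y} \<notin> Eg" if u: "u \<in> \<Union>(M - {{v, x}})" for u
    proof
      show "u \<noteq> y" using far[OF u] yx by blast
      show "{u, y} \<notin> Eg"
      proof
        assume "{u, y} \<in> Eg"
        then have "u \<in> C'" by (rule new_nbr[OF C'(1) y])
        then show False using far[OF u] edge_iff C' by blast
      qed
    qed
    moreover have "y \<noteq> v" using y(2) vB by blast
    ultimately show ?thesis using yx by blast
  next
    case False
    then obtain C' where C': "C' \<in> \<C>" "x \<in> C'" "v \<in> C'" using vx(2) edge_iff by blast
    have "C' \<noteq> {v, f}" using C' vx(3) x(2) by blast
    \<comment> \<open>The clique \<open>{v, f}\<close> meets \<open>B\<close> only in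
      \<open>v\<close>, so another clique through \<open>v\<close> supplies \<open>w\<close>. A
      neighbour of \<open>w\<close> lies in \<open>B\<close> or shares a clique with
      \<open>v\<close>, so vertices far from \<open>v\<close> are far from \<open>w\<close>.\<close>
    then obtain w where w: "w \<in> C'" "w \<in> B" "w \<noteq> v" "\<And>C''. C'' \<in> \<C> \<Longrightarrow> w \<in> C'' \<Longrightarrow> v \<in> C''"
      using chain[OF C(1) C'(1) C(2) C'(3)] by blast
    have wx: "{w, x} \<in> Eg" using edge_iff C' w False by blast
    have "u \<noteq> w \<and> {u, w} \<notin> Eg" if u: "u \<in> \<Union>(M - {{v, x}})" for u
    proof
      show "u \<noteq> w" using farB[OF u] w(2) by blast
      show "{u, w} \<notin> Eg"
      proof
        assume "{u, w} \<in> Eg"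
        then obtain C'' where C'': "C'' \<in> \<C>" "u \<in> C''" "w \<in> C''" using farB[OF u] edge_iff by blast
        then have "v \<in> C''" using w(4) by blast
        then show False using far[OF u] edge_iff C'' by blast
      qed
    qed
    then show ?thesis using wx w(3) by (intro exI[of _ w]) blast
  qed
  then obtain a where a: "a \<noteq> v" "{a, x} \<in> Eg" "\<And>u. u \<in> \<Union>(M - {{v, x}}) \<Longrightarrow> u \<noteq> a \<and> {u, a} \<notin> Eg"
    by blast
  have "u \<noteq> a \<and> u \<noteq> x \<and> {u, a} \<notin> Eg \<and> {u, x} \<notin> Eg" if "u \<in> \<Union>(M - {{v, x}})" for u
    using a(3)[OF that] far[OF that] by blast
  note ex = ind_matching_exchange[OF M(1) vx(1) a(2) this]
  have "v \<notin> \<Union>(insert {a, x} (M - {{v, x}}))" using far a(1) x(2) by blast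
  then have "card M \<le> ind_num (del Eg v)" using card_le_ind_num_del[OF ex(1)] ex(2) by simp
  then show False using lt M0(2) by simp
qed

end

section \<open>Renaming vertices and chordality of the glued graph\<close>

lemma leaf_edges_image:
  assumes "leaf_edges E f v" "inj_on \<phi> A" "\<Union>E \<subseteq> A"
  shows "leaf_edges ((`) \<phi> ` E) (\<phi> f) (\<phi> v)"
proof -
  interpret leaf_edges E f v by (rule assms)
  have fA: "f \<in> A" using fv assms(3) by blast
  show ?thesis
  proof
    show "finite ((`) \<phi> ` E)" using fin by simp
    show "\<forall>e\<in>(`) \<phi> ` E. card e = 2"
    proof clarify
      fix e assume "e \<in> E"
      then have "inj_on \<phi> e" using assms(2,3) inj_on_subset by blast
      then show "card (\<phi> ` e) = 2" using card2 \<open>e \<in> E\<close> by (simp add: card_image)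
    qed
    have "\<phi> ` {f, v} \<in> (`) \<phi> ` E" using fv by (rule imageI)
    then show "{\<phi> f, \<phi> v} \<in> (`) \<phi> ` E" by simp
    fix e assume e: "e \<in> (`) \<phi> ` E" "\<phi> f \<in> e"
    then obtain e' where e': "e' \<in> E" "e = \<phi> ` e'" by blast
    then have "f \<in> e'" using e(2) inj_on_image_mem_iff[OF assms(2) fA, of e'] assms(3) by blast
    then have "e' = {f, v}" using leaf_unique e'(1) by blast
    then show "e = {\<phi> f, \<phi> v}" using e' by simp
  qed
qed

lemma circ_op_eq:
  assumes "\<phi> = (\<lambda>x. if x = v2 then v1 else x)"
  shows "vertices (circ_op H1 f1 v1 H2 f2 v2) = \<phi> ` (vertices H1 - {f1}) \<union> \<phi> ` (vertices H2 - {f2})"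
    and "edges (circ_op H1 f1 v1 H2 f2 v2) = (`) \<phi> ` del (edges H1) f1 \<union> (`) \<phi> ` del (edges H2) f2"
  unfolding circ_op_def identify_def disjoint_union_graph_def delete_vertex_def Let_def del_def
    fst_conv snd_conv image_Un assms by (rule refl)+

lemma simplicial_image:
  assumes inj: "inj_on \<phi> A" and E: "\<Union>E \<subseteq> A" and X: "X \<subseteq> A" "z \<in> A" and s: "simplicial E X z"
  shows "simplicial ((`) \<phi> ` E) (\<phi> ` X) (\<phi> z)"
proof -
  have edge: "{a, b} \<in> E" if "{\<phi> a, \<phi> b} \<in> (`) \<phi> ` E" "a \<in> A" "b \<in> A" for a b
  proof -
    have "\<phi> ` {a, b} \<in> (`) \<phi> ` E" using that(1) by simp
    then obtain e where e: "e \<in> E" "\<phi> ` {a, b} = \<phi> ` e" by (rule imageE)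
    have "e \<subseteq> A" using e(1) E by blast
    then have "{a, b} = e" using inj_on_image_eq_iff[OF inj, of "{a, b}" e] that(2,3) e(2) by simp
    then show ?thesis using e(1) by simp
  qed
  show ?thesis
    unfolding simplicial_def
  proof (intro ballI impI)
    fix u' w' assume a: "u' \<in> \<phi> ` X" "w' \<in> \<phi> ` X" "{u', \<phi> z} \<in> (`) \<phi> ` E" "{w', \<phi> z} \<in> (`) \<phi> ` E" "u' \<noteq> w'"
    then obtain u w where uw: "u \<in> X" "w \<in> X" "u' = \<phi> u" "w' = \<phi> w" by blast
    then have "{u, z} \<in> E" "{w, z} \<in> E" using a edge X by blast+
    then have "{u, w} \<in> E" using s uw a(5) unfolding simplicial_def by blast
    then have "\<phi> ` {u, w} \<in> (`) \<phi> ` E" by (rule imageI)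
    then show "{u', w'} \<in> (`) \<phi> ` E" using uw by simp
  qed
qed

lemma chordal_del: assumes "chordal E V" shows "chordal (del E x) (V - {x})"
  unfolding chordal_def
proof (intro allI impI)
  fix X assume X: "X \<subseteq> V - {x}" "X \<noteq> {}"
  then obtain z where z: "z \<in> X" "simplicial E X z" using assms unfolding chordal_def by (meson Diff_subset order_trans)
  have "simplicial (del E x) X z"
    using z(2) X(1) unfolding simplicial_def del_def by auto
  then show "\<exists>z\<in>X. simplicial (del E x) X z" using z(1) by blast
qed

lemma edge_reg_delete_vertex:
  assumes "finite (vertices H)" "\<And>e. e \<in> edges H \<Longrightarrow> e \<subseteq> vertices H \<and> card e = 2"
    and "chordal (edges H) (vertices H)"
  shows "edge_reg TYPE('k::field) (delete_vertex H x) = int (ind_num (del (edges H) x))"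
proof -
  have eq: "delete_vertex H x = (vertices H - {x}, del (edges H) x)"
    by (simp add: delete_vertex_def del_def)
  have "edge_reg TYPE('k) (vertices H - {x}, del (edges H) x) =
      int (ind_num (edges (vertices H - {x}, del (edges H) x)))"
  proof (rule edge_reg_chordal)
    show "e \<subseteq> vertices (vertices H - {x}, del (edges H) x) \<and> card e = 2"
      if "e \<in> edges (vertices H - {x}, del (edges H) x)" for e
      using assms(2)[of e] that by (auto simp: del_def)
  qed (use assms(1) chordal_del[OF assms(3)] in simp_all)
  then show ?thesis by (simp add: eq)
qed

lemma simplicial_subset_singleton: "X \<subseteq> {v} \<Longrightarrow> simplicial E X z"
  unfolding simplicial_def by blast

context glued begin

text \<open>All edges at a vertex other than \<open>v\<close> lie on its own side, so its
  neighbourhood is unaffected by the gluing.\<close>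

lemma simplicial_glued:
  assumes V: "\<Union>E1 \<subseteq> V1" "\<Union>E2 \<subseteq> V2" "V1 \<inter> V2 \<subseteq> {v}" and X: "X \<subseteq> V1 - {f1} \<union> (V2 - {f2})"
    and z: "z \<in> X \<inter> V1" "z \<noteq> v" "simplicial E1 (X \<inter> V1) z"
  shows "simplicial E X z"
  unfolding simplicial_def
proof (intro ballI impI)
  fix u w assume u: "u \<in> X" "w \<in> X" "{u, z} \<in> E" "{w, z} \<in> E" "u \<noteq> w"
  have zV2: "z \<notin> V2" using z V(3) by blast
  have "e \<in> E1" if "e \<in> E" "z \<in> e" for e
    using that zV2 V(2) unfolding E_def del_def by blast
  then have e: "{u, z} \<in> E1" "{w, z} \<in> E1" using u by blast+
  then have uV: "u \<in> V1" "w \<in> V1" using V(1) by blast+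
  then have "{u, w} \<in> E1" using z(3) u e unfolding simplicial_def by blast
  moreover have "f1 \<notin> {u, w}"
  proof
    assume "f1 \<in> {u, w}"
    then have "f1 \<in> V2 - {f2}" "f1 \<in> V1" using X u(1,2) uV by auto
    then have "f1 = v" using V(3) by blast
    then show False using G1.f_neq_v by simp
  qed
  ultimately show "{u, w} \<in> E" by (simp add: E_def del_def)
qed

text \<open>A set not inside \<open>{v}\<close> has on one of the sides a vertex other than
  \<open>v\<close>, and hence a simplicial vertex other than \<open>v\<close> of its trace on that
  side.\<close>

lemma chordal_glued:
  assumes V: "\<Union>E1 \<subseteq> V1" "\<Union>E2 \<subseteq> V2" "V1 \<inter> V2 \<subseteq> {v}"
    and s1: "\<And>X. X \<subseteq> V1 \<Longrightarrow> \<not> X \<subseteq> {v} \<Longrightarrow> \<exists>z\<in>X. z \<noteq> v \<and> simplicial E1 X z"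
    and s2: "\<And>X. X \<subseteq> V2 \<Longrightarrow> \<not> X \<subseteq> {v} \<Longrightarrow> \<exists>z\<in>X. z \<noteq> v \<and> simplicial E2 X z"
  shows "chordal E (V1 - {f1} \<union> (V2 - {f2}))"
  unfolding chordal_def
proof (intro allI impI)
  interpret sw: glued E2 E1 f2 f1 v by (rule swap)
  fix X assume X: "X \<subseteq> V1 - {f1} \<union> (V2 - {f2})" "X \<noteq> {}"
  consider "X \<subseteq> {v}" | "\<not> X \<inter> V1 \<subseteq> {v}" | "\<not> X \<inter> V2 \<subseteq> {v}" using X(1) by blast
  then show "\<exists>z\<in>X. simplicial E X z"
  proof cases
    case 1
    obtain z where "z \<in> X" using X(2) by blast
    then show ?thesis using simplicial_subset_singleton[OF 1, of E z] by blast
  next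
    case 2
    then obtain z where "z \<in> X \<inter> V1" "z \<noteq> v" "simplicial E1 (X \<inter> V1) z" using s1[of "X \<inter> V1"] by blast
    then show ?thesis using simplicial_glued[OF V X(1)] by blast
  next
    case 3
    then obtain z where z: "z \<in> X \<inter> V2" "z \<noteq> v" "simplicial E2 (X \<inter> V2) z" using s2[of "X \<inter> V2"] by blast
    have "simplicial sw.E X z"
      by (rule sw.simplicial_glued[OF V(2,1) _ _ z]) (use V(3) X(1) in auto)
    then show ?thesis using z(1) E_swap by auto
  qed
qed

end

section \<open>Arithmetic of the matching numbers and conclusion\<close>

lemma card_filter_two:
  "card {i \<in> {1, 2}. P i} = (if P 1 then 1 else 0) + (if P 2 then 1 else 0)" for P :: "nat \<Rightarrow> bool"
proof -
  have "{i \<in> {1, 2}. P i} = (if P 1 then {1} else {}) \<union> (if P 2 then {2} else {})" by auto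
  then show ?thesis by simp
qed

text \<open>For each side, \<open>n\<close>, \<open>m\<close> and \<open>p\<close> stand for the
  induced matching numbers of the graph, without \<open>v\<close>, and without the leaf;
  \<open>N\<close> belongs to the glued graph. \<open>P1\<close>, \<open>P2\<close> and
  \<open>Q1\<close>, \<open>Q2\<close> stand for the conditions that \<open>W\<close> misses one
  vertex of the base clique or none.\<close>

lemma glued_arith:
  fixes N n1 m1 p1 n2 m2 p2 t :: nat
  assumes low: "m1 + m2 \<le> N" "m2 < n2 \<Longrightarrow> p1 + n2 \<le> Suc N" "m1 < n1 \<Longrightarrow> p2 + n1 \<le> Suc N"
    and up: "N \<le> m1 + m2 \<or> Suc N \<le> p1 + n2 \<and> N \<le> p1 + m2 \<or> Suc N \<le> p2 + n1 \<and> N \<le> p2 + m1"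
    and bounds: "m1 \<le> p1" "p1 \<le> n1" "n1 \<le> Suc m1" "m2 \<le> p2" "p2 \<le> n2" "n2 \<le> Suc m2"
    and t: "t = (if m1 \<noteq> n1 then 1 else 0) + (if m2 \<noteq> n2 then 1 else 0)"
    and P: "P1 \<Longrightarrow> m1 < n1 \<Longrightarrow> p1 = n1" "P2 \<Longrightarrow> m2 < n2 \<Longrightarrow> p2 = n2"
    and Q: "Q1 \<Longrightarrow> m1 < n1 \<Longrightarrow> p1 < n1" "Q2 \<Longrightarrow> m2 < n2 \<Longrightarrow> p2 < n2"
  shows "(t \<le> 1 \<longrightarrow> int N = int n1 + int n2 - int t) \<and>
    (t = 2 \<and> (P1 \<or> P2) \<longrightarrow> int N = int n1 + int n2 - 1) \<and>
    (t = 2 \<and> (Q1 \<and> Q2) \<longrightarrow> int N = int n1 + int n2 - 2)"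
proof (cases "m1 = n1 \<or> m2 = n2")
  case True
  then have "t \<le> 1" "int N = int n1 + int n2 - int t" using low(1) up bounds t by auto
  then show ?thesis by simp
next
  case False
  then have lt: "m1 < n1" "m2 < n2" "t = 2" using bounds t by auto
  have "int N = int n1 + int n2 - 1" if "P1 \<or> P2"
    using that low(2,3) up bounds P lt by auto
  moreover have "int N = int n1 + int n2 - 2" if "Q1" "Q2"
    using Q(1)[OF that(1) lt(1)] Q(2)[OF that(2) lt(2)] low(1) up bounds lt by auto
  ultimately show ?thesis using lt by simp
qed

theorem theorem3p8:
  fixes Gs :: "nat \<Rightarrow> 'v sgraph" and W B :: "nat \<Rightarrow> 'v set"
    and k n :: "nat \<Rightarrow> nat" and f v :: "nat \<Rightarrow> 'v"
    and G :: "'v sgraph" and t :: nat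
    and reg :: "'v sgraph \<Rightarrow> int"
  assumes "\<And>i. i \<in> {1, 2} \<Longrightarrow> card (B i) = n i"
    and "\<And>i. i \<in> {1, 2} \<Longrightarrow> n i \<ge> 2"
    and "\<And>i. i \<in> {1, 2} \<Longrightarrow> k i \<ge> 1"
    and "\<And>i. i \<in> {1, 2} \<Longrightarrow> k_fan_graph (k i) (W i) (B i) (Gs i)"
    and "\<And>i. i \<in> {1, 2} \<Longrightarrow> leaf (Gs i) (f i)"
    and "\<And>i. i \<in> {1, 2} \<Longrightarrow> {f i, v i} \<in> edges (Gs i)"
    and "\<And>i. i \<in> {1, 2} \<Longrightarrow> degree (Gs i) (v i) \<ge> 2"
    and "vertices (Gs 1) \<inter> vertices (Gs 2) = {}"
  defines "G \<equiv> circ_op (Gs 1) (f 1) (v 1) (Gs 2) (f 2) (v 2)"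
    and "reg \<equiv> edge_reg TYPE('k::field)"
    and "t \<equiv> card {i \<in> {1, 2}. reg (delete_vertex (Gs i) (v i)) \<noteq> reg (Gs i)}"
  shows "(t \<le> 1 \<longrightarrow> reg G = reg (Gs 1) + reg (Gs 2) - int t) \<and>
         (t = 2 \<and> (\<exists>i\<in>{1, 2}. card (W i) = n i - 1) \<longrightarrow> reg G = reg (Gs 1) + reg (Gs 2) - 1) \<and>
         (t = 2 \<and> (\<forall>i\<in>{1, 2}. card (W i) = n i) \<longrightarrow> reg G = reg (Gs 1) + reg (Gs 2) - 2)"
proof -
  have fans: "\<exists>\<C>. fan_leaf (W i) (B i) \<C> (f i) (v i) \<and>
      vertices (Gs i) = fan.Vg (B i) \<C> \<and> edges (Gs i) = fan.Eg (B i) \<C>" if i: "i \<in> {1, 2}" for i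
  proof -
    obtain \<C> where fan: "fan (W i) (B i) \<C>"
      and VE: "vertices (Gs i) = fan.Vg (B i) \<C>" "edges (Gs i) = fan.Eg (B i) \<C>"
      using k_fan_graph_fan[OF assms(4)[OF i]] .
    interpret fan "W i" "B i" \<C> by (rule fan)
    note V = VE(1)[symmetric] and E = VE(2)[symmetric]
    have mem: "a \<in> vertices (Gs i)" if "{a, b} \<in> edges (Gs i)" for a b
      using Eg_sub[of "{a, b}"] that V E by simp
    have "fan_leaf (W i) (B i) \<C> (f i) (v i)"
    proof
      show "2 \<le> card (B i)" using assms(1,2)[OF i] by simp
      show "{f i, v i} \<in> Eg" using assms(6)[OF i] E by simp
      have "card {u \<in> vertices (Gs i). {u, f i} \<in> edges (Gs i)} = 1"
        using assms(5)[OF i] by (simp add: leaf_def degree_def)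
      then obtain y where y: "{u \<in> vertices (Gs i). {u, f i} \<in> edges (Gs i)} = {y}"
        by (meson card_1_singletonE)
      have nbr: "u = y" if "{u, f i} \<in> edges (Gs i)" for u using y mem[OF that] that by blast
      have "v i = y" using nbr[of "v i"] assms(6)[OF i] by (simp add: insert_commute)
      then show "u = v i" if "{u, f i} \<in> Eg" for u using nbr[of u] that E by simp
      show "\<exists>w. w \<noteq> f i \<and> {w, v i} \<in> Eg"
      proof (rule ccontr)
        assume "\<not> ?thesis"
        then have "{u \<in> vertices (Gs i). {u, v i} \<in> edges (Gs i)} \<subseteq> {f i}" using E by auto
        then have "degree (Gs i) (v i) \<le> card {f i}" unfolding degree_def by (intro card_mono) auto
        then show False using assms(7)[OF i] by simp
      qed
    qed
    then show ?thesis using VE by blast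
  qed
  have "1 \<in> {1::nat, 2}" "2 \<in> {1::nat, 2}" by simp_all
  from fans[OF this(1)] fans[OF this(2)] obtain \<C>1 \<C>2
    where fl1: "fan_leaf (W 1) (B 1) \<C>1 (f 1) (v 1)"
      and G1: "vertices (Gs 1) = fan.Vg (B 1) \<C>1" "edges (Gs 1) = fan.Eg (B 1) \<C>1"
      and fl2: "fan_leaf (W 2) (B 2) \<C>2 (f 2) (v 2)"
      and G2: "vertices (Gs 2) = fan.Vg (B 2) \<C>2" "edges (Gs 2) = fan.Eg (B 2) \<C>2" by blast
  interpret F1: fan_leaf "W 1" "B 1" \<C>1 "f 1" "v 1" by (rule fl1)
  interpret F2: fan_leaf "W 2" "B 2" \<C>2 "f 2" "v 2" by (rule fl2)
  \<comment> \<open>The identification as a renaming: since the two graphs are disjoint, it fixes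
    the first one and is injective on the second, which from here on is replaced by its
    image.\<close>
  define \<phi> where "\<phi> = (\<lambda>x. if x = v 2 then v 1 else x)"
  have disj: "F1.Vg \<inter> F2.Vg = {}" using assms(8) G1(1) G2(1) by simp
  have in1: "v 1 \<in> F1.Vg" "f 1 \<in> F1.Vg" and in2: "v 2 \<in> F2.Vg" "f 2 \<in> F2.Vg"
    using F1.Eg_sub[OF F1.fv] F2.Eg_sub[OF F2.fv] by auto
  have \<phi>1: "\<phi> x = x" if "x \<in> F1.Vg" for x using that in2 disj by (auto simp: \<phi>_def)
  have inj: "inj_on \<phi> F2.Vg" using in1 disj by (auto simp: inj_on_def \<phi>_def)
  have \<phi>v: "\<phi> (v 2) = v 1" "\<phi> (f 2) = f 2" using F2.f_neq_v by (auto simp: \<phi>_def)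
  have UE1: "\<Union>F1.Eg \<subseteq> F1.Vg" and UE2: "\<Union>F2.Eg \<subseteq> F2.Vg" using F1.Eg_sub F2.Eg_sub by blast+
  define E2 where "E2 = (`) \<phi> ` F2.Eg"
  have UE2': "\<Union>E2 \<subseteq> \<phi> ` F2.Vg" using UE2 by (auto simp: E2_def)
  have meet: "F1.Vg \<inter> \<phi> ` F2.Vg \<subseteq> {v 1}" using disj by (auto simp: \<phi>_def)
  interpret L1: leaf_edges F1.Eg "f 1" "v 1" by (rule F1.leaf_edges)
  interpret L2: leaf_edges F2.Eg "f 2" "v 2" by (rule F2.leaf_edges)
  interpret L2': leaf_edges E2 "f 2" "v 1"
    using leaf_edges_image[OF F2.leaf_edges inj UE2] by (simp add: E2_def \<phi>v)
  interpret gl: glued F1.Eg E2 "f 1" "f 2" "v 1"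
    by unfold_locales (use UE1 UE2' meet in blast)

  have vG: "vertices G = F1.Vg - {f 1} \<union> (\<phi> ` F2.Vg - {f 2})"
  proof -
    have "\<phi> ` (F1.Vg - {f 1}) = F1.Vg - {f 1}" using \<phi>1 by force
    moreover have "\<phi> ` (F2.Vg - {f 2}) = \<phi> ` F2.Vg - {f 2}"
      using inj_on_image_set_diff[OF inj, of F2.Vg "{f 2}"] in2 \<phi>v by simp
    ultimately show ?thesis unfolding G_def circ_op_eq(1)[OF \<phi>_def] G1 G2 by simp
  qed
  have eG: "edges G = gl.E"
  proof -
    have "\<phi> ` e = e" if "e \<in> del F1.Eg (f 1)" for e
    proof -
      have "e \<subseteq> F1.Vg" using that F1.Eg_sub by (auto simp: del_def)
      then show ?thesis using \<phi>1 by force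
    qed
    then have "(`) \<phi> ` del F1.Eg (f 1) = del F1.Eg (f 1)" by force
    moreover have "(`) \<phi> ` del F2.Eg (f 2) = del E2 (f 2)"
      using image_del[OF inj UE2 in2(2)] by (simp add: E2_def \<phi>v)
    ultimately show ?thesis unfolding G_def circ_op_eq(2)[OF \<phi>_def] G1 G2 gl.E_def by simp
  qed

  have edges: "e \<subseteq> F1.Vg \<and> card e = 2" if "e \<in> F1.Eg" for e
    using that F1.Eg_sub L1.card2 by blast
  have edges': "e \<subseteq> F2.Vg \<and> card e = 2" if "e \<in> F2.Eg" for e
    using that F2.Eg_sub L2.card2 by blast
  have H1: "finite (vertices (Gs 1))" "\<And>e. e \<in> edges (Gs 1) \<Longrightarrow> e \<subseteq> vertices (Gs 1) \<and> card e = 2"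
    "chordal (edges (Gs 1)) (vertices (Gs 1))"
    unfolding G1 by (rule F1.finV F1.chordal_Eg | erule edges)+
  have H2: "finite (vertices (Gs 2))" "\<And>e. e \<in> edges (Gs 2) \<Longrightarrow> e \<subseteq> vertices (Gs 2) \<and> card e = 2"
    "chordal (edges (Gs 2)) (vertices (Gs 2))"
    unfolding G2 by (rule F2.finV F2.chordal_Eg | erule edges')+
  have reg1: "reg (Gs 1) = int (ind_num F1.Eg)"
    "reg (delete_vertex (Gs 1) (v 1)) = int (ind_num (del F1.Eg (v 1)))"
    unfolding reg_def G1(2)[symmetric]
    using edge_reg_chordal[where 'k = 'k, OF H1] edge_reg_delete_vertex[where 'k = 'k, OF H1] by simp_all
  have reg2: "reg (Gs 2) = int (ind_num F2.Eg)"
    "reg (delete_vertex (Gs 2) (v 2)) = int (ind_num (del F2.Eg (v 2)))"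
    unfolding reg_def G2(2)[symmetric]
    using edge_reg_chordal[where 'k = 'k, OF H2] edge_reg_delete_vertex[where 'k = 'k, OF H2] by simp_all
  have regG: "reg G = int (ind_num gl.E)"
    unfolding reg_def eG[symmetric]
  proof (rule edge_reg_chordal)
    show "finite (vertices G)" using F1.finV F2.finV by (simp add: vG)
    show "e \<subseteq> vertices G \<and> card e = 2" if e: "e \<in> edges G" for e
    proof
      show "card e = 2" using gl.G.card2 e eG by simp
      have "e \<subseteq> F1.Vg \<and> f 1 \<notin> e \<or> e \<subseteq> \<phi> ` F2.Vg \<and> f 2 \<notin> e"
        using e UE1 UE2' unfolding eG gl.E_def del_def by blast
      then have "e \<subseteq> F1.Vg - {f 1} \<or> e \<subseteq> \<phi> ` F2.Vg - {f 2}"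
        by (simp only: subset_Diff_insert Diff_empty)
      then show "e \<subseteq> vertices G" unfolding vG by (rule disjE) (rule le_supI1 le_supI2; assumption)+
    qed
    show "chordal (edges G) (vertices G)"
      unfolding vG eG
    proof (rule gl.chordal_glued[OF UE1 UE2' meet])
      show "\<exists>z\<in>X. z \<noteq> v 1 \<and> simplicial F1.Eg X z" if "X \<subseteq> F1.Vg" "\<not> X \<subseteq> {v 1}" for X
        by (rule F1.simplicial_avoiding[OF F1.vB that])
      show "\<exists>z\<in>X. z \<noteq> v 1 \<and> simplicial E2 X z" if X: "X \<subseteq> \<phi> ` F2.Vg" "\<not> X \<subseteq> {v 1}" for X
      proof -
        obtain X0 where X0: "X0 \<subseteq> F2.Vg" "X = \<phi> ` X0" using X(1) by (meson subset_imageE)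
        then have "\<not> X0 \<subseteq> {v 2}" using X(2) \<phi>v(1) by blast
        then obtain z where z: "z \<in> X0" "z \<noteq> v 2" "simplicial F2.Eg X0 z"
          using F2.simplicial_avoiding[OF F2.vB X0(1)] by blast
        have "\<phi> z \<noteq> v 1" using z X0(1) inj_onD[OF inj, of z "v 2"] \<phi>v(1) in2(1) by auto
        moreover have "simplicial E2 X (\<phi> z)"
          unfolding E2_def X0(2) using z X0(1) by (intro simplicial_image[OF inj UE2]) auto
        ultimately show ?thesis using z(1) X0(2) by blast
      qed
    qed
  qed

  \<comment> \<open>The matching numbers of the renamed second side are translated back to the
    original graph, to which the regularities refer.\<close>
  have n2: "ind_num E2 = ind_num F2.Eg"
    unfolding E2_def by (rule ind_num_image[OF F2.edge_set inj_on_subset[OF inj UE2]])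
  have "ind_num (del E2 (\<phi> x)) = ind_num (del F2.Eg x)" if "x \<in> F2.Vg" for x
  proof -
    have "\<Union>(del F2.Eg x) \<subseteq> F2.Vg" using UE2 by (auto simp: del_def)
    then show ?thesis
      unfolding E2_def image_del[OF inj UE2 that, symmetric]
      by (intro ind_num_image[OF L2.del] inj_on_subset[OF inj])
  qed
  then have m2: "ind_num (del E2 (v 1)) = ind_num (del F2.Eg (v 2))"
    and p2: "ind_num (del E2 (f 2)) = ind_num (del F2.Eg (f 2))"
    using in2 \<phi>v by metis+
  interpret sw: glued E2 F1.Eg "f 2" "f 1" "v 1" by (rule gl.swap)
  note low = gl.lower gl.lower' sw.lower' gl.upper
  note low' = low[unfolded gl.E_swap n2 m2 p2]
  note bounds = L1.ind_num_chain L1.ind_num_le_del[of "v 1"] L2.ind_num_chain L2.ind_num_le_del[of "v 2"]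

  have t: "t = (if ind_num (del F1.Eg (v 1)) \<noteq> ind_num F1.Eg then 1 else 0) +
      (if ind_num (del F2.Eg (v 2)) \<noteq> ind_num F2.Eg then 1 else 0)"
    unfolding t_def card_filter_two by (simp only: reg1 reg2 of_nat_eq_iff)
  have pA: "ind_num (del F1.Eg (f 1)) = ind_num F1.Eg"
    if "card (W 1) = n 1 - 1" "ind_num (del F1.Eg (v 1)) < ind_num F1.Eg"
    by (rule F1.exists_matching_avoiding_leaf) (use that assms(1)[of 1] in simp_all)
  have pA': "ind_num (del F2.Eg (f 2)) = ind_num F2.Eg"
    if "card (W 2) = n 2 - 1" "ind_num (del F2.Eg (v 2)) < ind_num F2.Eg"
    by (rule F2.exists_matching_avoiding_leaf) (use that assms(1)[of 2] in simp_all)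
  have pB: "ind_num (del F1.Eg (f 1)) < ind_num F1.Eg"
    if "card (W 1) = n 1" "ind_num (del F1.Eg (v 1)) < ind_num F1.Eg"
    by (rule F1.no_matching_avoiding_leaf[OF card_subset_eq[OF F1.finB F1.WB]]) (use that assms(1)[of 1] in simp_all)
  have pB': "ind_num (del F2.Eg (f 2)) < ind_num F2.Eg"
    if "card (W 2) = n 2" "ind_num (del F2.Eg (v 2)) < ind_num F2.Eg"
    by (rule F2.no_matching_avoiding_leaf[OF card_subset_eq[OF F2.finB F2.WB]]) (use that assms(1)[of 2] in simp_all)
  have ex: "(\<exists>i\<in>{1, 2}. P i) \<longleftrightarrow> P 1 \<or> P 2" and all: "(\<forall>i\<in>{1, 2}. P i) \<longleftrightarrow> P 1 \<and> P 2"
    for P :: "nat \<Rightarrow> bool" by auto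
  show ?thesis
    unfolding reg1 reg2 regG ex all
    by (rule glued_arith[OF low' bounds(1-3) bounds(4-6) t]) (assumption | erule (1) pA pA' pB pB')+
qed

end
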